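(* Let $\mathcal A$ be a well-powered abelian category with all small coproducts, equipped with its epi--mono factorization system, and let $G\in\mathcal A$ be nonzero. Equip $\mathbf{Set}$ with its surjection--injection system. Define the copower functor $H_G:\mathbf{Set}\to\mathcal A$ by $H_G(X)=\coprod_{x\in X}G$ and $H_G(f)i_x=i_{f(x)}$ for each function $f:X\to Y$, where $i_x$ and $i_{f(x)}$ are the corresponding coproduct injections. Then $H_G$ is a transfer functor. Consequently every nonzero such category (well-powered abelian with all small coproducts) is a universal target; in particular, this holds for every nonzero Grothendieck abelian category.
   Context: "Universal target": a category $\mathcal D$ with a specified proper factorization system $(\mathcal E_{\mathcal D},\mathcal M_{\mathcal D})$, pullbacks of two $\mathcal M_{\mathcal D}$-morphisms and pushouts of two $\mathcal E_{\mathcal D}$-morphisms, such that for every category $\mathcal C$ with a proper factorization system $(\mathcal E,\mathcal M)$, pullbacks of two $\mathcal M$-morphisms with common codomain and pushouts of two $\mathcal E$-morphisms with common domain, $\mathcal C$ has a noetherian form inducing $(\mathcal E,\mathcal M)$ if and only if there is a transfer functor $\mathcal C\to\mathcal D$. Conventions: categories are locally small; "set" is relative to a fixed universe. A conservative functor is one that reflects isomorphisms. A proper factorization system $(\mathcal E,\mathcal M)$ is an orthogonal factorization system with every morphism in $\mathcal E$ an epimorphism and every morphism in $\mathcal M$ a monomorphism. Transfer functors. Let $\mathcal C,\mathcal D$ have specified proper factorization systems $(\mathcal E_{\mathcal C},\mathcal M_{\mathcal C})$, $(\mathcal E_{\mathcal D},\mathcal M_{\mathcal D})$, and suppose both have pullbacks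 of two right-class morphisms with common codomain and pushouts of two left-class morphisms with common domain. A transfer functor $T:\mathcal C\to\mathcal D$ is a conservative functor with $T(\mathcal E_{\mathcal C})\subseteq\mathcal E_{\mathcal D}$, $T(\mathcal M_{\mathcal C})\subseteq\mathcal M_{\mathcal D}$, preserving pullbacks of two $\mathcal M_{\mathcal C}$-morphisms and pushouts of two $\mathcal E_{\mathcal C}$-morphisms. Forms. An (orean) form $\mathsf F$ on a category $\mathcal C$ assigns to each object $X$ a set-sized bounded lattice $\mathsf F(X)$ (the fibre over $X$; its elements are called clusters) and to each morphism $f:X\to Y$ monotone maps $f_!:\mathsf F(X)\to\mathsf F(Y)$ and $f^*:\mathsf F(Y)\to\mathsf F(X)$ with $f_!S\le T\iff S\le f^*T$, such that $(gf)_!=g_!f_!$, $(gf)^*=f^*g^*$, and identities act as identities. Put $\operatorname{Im}f=f_!\top_X$ and $\operatorname{Ker}f=f^*\bot_Y$. A cluster in $\mathsf F(X)$ is conormal if it is the image of some morphism of $\mathcal C$ with codomain $X$, and normal if it is the kernel of some morphism of $\mathcal C$ with domain $X$. An embedding of a conormal $S\in\mathsf F(X)$ is a morphism $\iota$ into $X$ with $\operatorname{Im}\iota=S$ such that every morphism $f$ into $X$ with $\operatorname{Im}f\le S$ factors as $f=\iota h$ for a unique $h$. A quotient of a normal $K\in\mathsf F(X)$ is a morphism $\pi$ out of $X$ with $\operatorname{Ker}\pi=K$ such that every morphism $g$ out of $X$ with $K\le\operatorname{Ker}g$ factors as $g=h\pi$ for a unique $h$. The form is noetherian if: (N1) $f^*f_!S=S\vee\operatorname{Ker}f$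 and $f_!f^*T=T\wedge\operatorname{Im}f$ for all $f,S,T$; (N2) every morphism $f$ factors as $f=me$ with $e$ a quotient of $\operatorname{Ker}f$ and $m$ an embedding of $\operatorname{Im}f$; (N3) the join of two normal clusters (in the same fibre) is normal, and the meet of two conormal clusters is conormal. For a noetherian form, the class $\mathcal E$ of all quotients (of normal clusters) and the class $\mathcal M$ of all embeddings (of conormal clusters) form a proper factorization system, the one induced by the form. *)

theory Defs
  imports "HOL-Algebra.Group"
begin

unbundle cardinal_syntax

section \<open>Smallness\<close>

text \<open>
  A type \<open>'u\<close> plays the role of the fixed universe. For a Grothendieck universe \<open>U\<close>, a subset
  \<open>A\<close> of \<open>U\<close> is an element of \<open>U\<close> iff \<open>A\<close> has smaller cardinality than \<open>U\<close>. Hence the sets of the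
  universe are taken to be the subsets of \<open>'u\<close> of cardinality less than that of \<open>'u\<close>, and a set
  over any other type is small when it is equinumerous with one of these. The closure conditions
  below say that the cardinality of \<open>'u\<close> is a regular strong limit. Uncountability is not
  demanded: every uncountable universe is covered, and so are the hereditarily finite sets.
\<close>

definition small :: "'u itself \<Rightarrow> 'a set \<Rightarrow> bool" where
  "small U A \<longleftrightarrow> |A| <o |UNIV :: 'u set|"

definition grothendieck_universe :: "'u itself \<Rightarrow> bool" where
  "grothendieck_universe U \<longleftrightarrow>
     (\<forall>X :: 'u set. small U X \<longrightarrow> small U (Pow X)) \<and>
     (\<forall>(I :: 'u set) (X :: 'u \<Rightarrow> 'u set).
        small U I \<and> (\<forall>i\<in>I. small U (X i)) \<longrightarrow> small U (\<Union>i\<in>I. X i))"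


section \<open>Categories\<close>

record ('o, 'm) cat =
  Obj :: "'o set"
  Arr :: "'m set"
  Dom :: "'m \<Rightarrow> 'o"
  Cod :: "'m \<Rightarrow> 'o"
  Id :: "'o \<Rightarrow> 'm"
  Comp :: "'m \<Rightarrow> 'm \<Rightarrow> 'm" (infixl \<open>\<cdot>\<index>\<close> 70)

definition Hom :: "('o, 'm) cat \<Rightarrow> 'o \<Rightarrow> 'o \<Rightarrow> 'm set" where
  "Hom C X Y = {f \<in> Arr C. Dom C f = X \<and> Cod C f = Y}"

locale category =
  fixes C :: "('o, 'm) cat" (structure)
  assumes Dom_in_Obj: "f \<in> Arr C \<Longrightarrow> Dom C f \<in> Obj C"
    and Cod_in_Obj: "f \<in> Arr C \<Longrightarrow> Cod C f \<in> Obj C"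
    and Id_in_Hom: "X \<in> Obj C \<Longrightarrow> Id C X \<in> Hom C X X"
    and Comp_in_Hom: "f \<in> Hom C X Y \<Longrightarrow> g \<in> Hom C Y Z \<Longrightarrow> g \<cdot> f \<in> Hom C X Z"
    and Comp_Id: "f \<in> Hom C X Y \<Longrightarrow> f \<cdot> Id C X = f"
    and Id_Comp: "f \<in> Hom C X Y \<Longrightarrow> Id C Y \<cdot> f = f"
    and Comp_assoc: "f \<in> Hom C W X \<Longrightarrow> g \<in> Hom C X Y \<Longrightarrow> h \<in> Hom C Y Z \<Longrightarrow>
                       (h \<cdot> g) \<cdot> f = h \<cdot> (g \<cdot> f)"

definition locally_small :: "'u itself \<Rightarrow> ('o, 'm) cat \<Rightarrow> bool" where
  "locally_small U C \<longleftrightarrow> category C \<and> (\<forall>X\<in>Obj C. \<forall>Y\<in>Obj C. small U (Hom C X Y))"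

definition isomorphisms :: "('o, 'm) cat \<Rightarrow> 'm set" where
  "isomorphisms C = {f \<in> Arr C. \<exists>g \<in> Hom C (Cod C f) (Dom C f).
     g \<cdot>\<^bsub>C\<^esub> f = Id C (Dom C f) \<and> f \<cdot>\<^bsub>C\<^esub> g = Id C (Cod C f)}"

definition monomorphisms :: "('o, 'm) cat \<Rightarrow> 'm set" where
  "monomorphisms C = {m \<in> Arr C. \<forall>W\<in>Obj C. \<forall>f\<in>Hom C W (Dom C m). \<forall>g\<in>Hom C W (Dom C m).
     m \<cdot>\<^bsub>C\<^esub> f = m \<cdot>\<^bsub>C\<^esub> g \<longrightarrow> f = g}"

definition epimorphisms :: "('o, 'm) cat \<Rightarrow> 'm set" where
  "epimorphisms C = {e \<in> Arr C. \<forall>Z\<in>Obj C. \<forall>f\<in>Hom C (Cod C e) Z. \<forall>g\<in>Hom C (Cod C e) Z.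
     f \<cdot>\<^bsub>C\<^esub> e = g \<cdot>\<^bsub>C\<^esub> e \<longrightarrow> f = g}"

definition is_pullback :: "('o, 'm) cat \<Rightarrow> 'm \<Rightarrow> 'm \<Rightarrow> 'm \<Rightarrow> 'm \<Rightarrow> bool" where
  "is_pullback C f g p q \<longleftrightarrow>
     f \<in> Arr C \<and> g \<in> Arr C \<and> p \<in> Arr C \<and> q \<in> Arr C \<and>
     Cod C f = Cod C g \<and> Dom C p = Dom C q \<and> Cod C p = Dom C f \<and> Cod C q = Dom C g \<and>
     f \<cdot>\<^bsub>C\<^esub> p = g \<cdot>\<^bsub>C\<^esub> q \<and>
     (\<forall>W\<in>Obj C. \<forall>a\<in>Hom C W (Dom C f). \<forall>b\<in>Hom C W (Dom C g).
        f \<cdot>\<^bsub>C\<^esub> a = g \<cdot>\<^bsub>C\<^esub> b \<longrightarrow>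
        (\<exists>!h. h \<in> Hom C W (Dom C p) \<and> p \<cdot>\<^bsub>C\<^esub> h = a \<and> q \<cdot>\<^bsub>C\<^esub> h = b))"

definition is_pushout :: "('o, 'm) cat \<Rightarrow> 'm \<Rightarrow> 'm \<Rightarrow> 'm \<Rightarrow> 'm \<Rightarrow> bool" where
  "is_pushout C f g p q \<longleftrightarrow>
     f \<in> Arr C \<and> g \<in> Arr C \<and> p \<in> Arr C \<and> q \<in> Arr C \<and>
     Dom C f = Dom C g \<and> Cod C p = Cod C q \<and> Dom C p = Cod C f \<and> Dom C q = Cod C g \<and>
     p \<cdot>\<^bsub>C\<^esub> f = q \<cdot>\<^bsub>C\<^esub> g \<and>
     (\<forall>Z\<in>Obj C. \<forall>a\<in>Hom C (Cod C f) Z. \<forall>b\<in>Hom C (Cod C g) Z.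
        a \<cdot>\<^bsub>C\<^esub> f = b \<cdot>\<^bsub>C\<^esub> g \<longrightarrow>
        (\<exists>!h. h \<in> Hom C (Cod C p) Z \<and> h \<cdot>\<^bsub>C\<^esub> p = a \<and> h \<cdot>\<^bsub>C\<^esub> q = b))"

definition is_coproduct ::
    "('o, 'm) cat \<Rightarrow> 'i set \<Rightarrow> ('i \<Rightarrow> 'o) \<Rightarrow> 'o \<Rightarrow> ('i \<Rightarrow> 'm) \<Rightarrow> bool" where
  "is_coproduct C I X Q \<iota> \<longleftrightarrow>
     Q \<in> Obj C \<and> (\<forall>i\<in>I. \<iota> i \<in> Hom C (X i) Q) \<and>
     (\<forall>Z\<in>Obj C. \<forall>f. (\<forall>i\<in>I. f i \<in> Hom C (X i) Z) \<longrightarrow>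
        (\<exists>!h. h \<in> Hom C Q Z \<and> (\<forall>i\<in>I. h \<cdot>\<^bsub>C\<^esub> \<iota> i = f i)))"

definition has_small_coproducts :: "'u itself \<Rightarrow> ('o, 'm) cat \<Rightarrow> bool" where
  "has_small_coproducts U C \<longleftrightarrow>
     (\<forall>(I :: 'u set) X. small U I \<and> (\<forall>i\<in>I. X i \<in> Obj C) \<longrightarrow> (\<exists>Q \<iota>. is_coproduct C I X Q \<iota>))"

definition subobject_equiv :: "('o, 'm) cat \<Rightarrow> 'o \<Rightarrow> ('m \<times> 'm) set" where
  "subobject_equiv C X =
     {(m, n). m \<in> monomorphisms C \<and> n \<in> monomorphisms C \<and> Cod C m = X \<and> Cod C n = X \<and>
        (\<exists>h \<in> isomorphisms C. Dom C h = Dom C m \<and> Cod C h = Dom C n \<and> n \<cdot>\<^bsub>C\<^esub> h = m)}"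

definition subobjects :: "('o, 'm) cat \<Rightarrow> 'o \<Rightarrow> 'm set set" where
  "subobjects C X = {m \<in> monomorphisms C. Cod C m = X} // subobject_equiv C X"

definition well_powered :: "'u itself \<Rightarrow> ('o, 'm) cat \<Rightarrow> bool" where
  "well_powered U C \<longleftrightarrow> (\<forall>X\<in>Obj C. small U (subobjects C X))"


section \<open>Functors and colimits\<close>

record ('o, 'm, 'p, 'n) cfunctor =
  OMap :: "'o \<Rightarrow> 'p"
  AMap :: "'m \<Rightarrow> 'n"

definition is_functor ::
    "('o, 'm) cat \<Rightarrow> ('p, 'n) cat \<Rightarrow> ('o, 'm, 'p, 'n) cfunctor \<Rightarrow> bool" where
  "is_functor C D T \<longleftrightarrow> category C \<and> category D \<and>
     (\<forall>X\<in>Obj C. OMap T X \<in> Obj D) \<and>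
     (\<forall>f\<in>Arr C. AMap T f \<in> Hom D (OMap T (Dom C f)) (OMap T (Cod C f))) \<and>
     (\<forall>X\<in>Obj C. AMap T (Id C X) = Id D (OMap T X)) \<and>
     (\<forall>f\<in>Arr C. \<forall>g\<in>Arr C. Dom C g = Cod C f \<longrightarrow>
        AMap T (g \<cdot>\<^bsub>C\<^esub> f) = AMap T g \<cdot>\<^bsub>D\<^esub> AMap T f)"

definition conservative ::
    "('o, 'm) cat \<Rightarrow> ('p, 'n) cat \<Rightarrow> ('o, 'm, 'p, 'n) cfunctor \<Rightarrow> bool" where
  "conservative C D T \<longleftrightarrow> (\<forall>f\<in>Arr C. AMap T f \<in> isomorphisms D \<longrightarrow> f \<in> isomorphisms C)"

definition is_nat_trans ::
    "('j, 'k) cat \<Rightarrow> ('o, 'm) cat \<Rightarrow> ('j, 'k, 'o, 'm) cfunctor \<Rightarrow> ('j, 'k, 'o, 'm) cfunctor \<Rightarrow>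
     ('j \<Rightarrow> 'm) \<Rightarrow> bool" where
  "is_nat_trans J C F G \<alpha> \<longleftrightarrow> is_functor J C F \<and> is_functor J C G \<and>
     (\<forall>j\<in>Obj J. \<alpha> j \<in> Hom C (OMap F j) (OMap G j)) \<and>
     (\<forall>k\<in>Arr J. AMap G k \<cdot>\<^bsub>C\<^esub> \<alpha> (Dom J k) = \<alpha> (Cod J k) \<cdot>\<^bsub>C\<^esub> AMap F k)"

definition is_cocone ::
    "('j, 'k) cat \<Rightarrow> ('o, 'm) cat \<Rightarrow> ('j, 'k, 'o, 'm) cfunctor \<Rightarrow> 'o \<Rightarrow> ('j \<Rightarrow> 'm) \<Rightarrow> bool" where
  "is_cocone J C F L \<kappa> \<longleftrightarrow> L \<in> Obj C \<and>
     (\<forall>j\<in>Obj J. \<kappa> j \<in> Hom C (OMap F j) L) \<and>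
     (\<forall>k\<in>Arr J. \<kappa> (Cod J k) \<cdot>\<^bsub>C\<^esub> AMap F k = \<kappa> (Dom J k))"

definition is_colimit ::
    "('j, 'k) cat \<Rightarrow> ('o, 'm) cat \<Rightarrow> ('j, 'k, 'o, 'm) cfunctor \<Rightarrow> 'o \<Rightarrow> ('j \<Rightarrow> 'm) \<Rightarrow> bool" where
  "is_colimit J C F L \<kappa> \<longleftrightarrow> is_cocone J C F L \<kappa> \<and>
     (\<forall>Z \<mu>. is_cocone J C F Z \<mu> \<longrightarrow>
        (\<exists>!h. h \<in> Hom C L Z \<and> (\<forall>j\<in>Obj J. h \<cdot>\<^bsub>C\<^esub> \<kappa> j = \<mu> j)))"

definition filtered :: "('j, 'k) cat \<Rightarrow> bool" where
  "filtered J \<longleftrightarrow> category J \<and> Obj J \<noteq> {} \<and>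
     (\<forall>i\<in>Obj J. \<forall>j\<in>Obj J. \<exists>k\<in>Obj J. Hom J i k \<noteq> {} \<and> Hom J j k \<noteq> {}) \<and>
     (\<forall>i\<in>Obj J. \<forall>j\<in>Obj J. \<forall>a\<in>Hom J i j. \<forall>b\<in>Hom J i j.
        \<exists>k\<in>Obj J. \<exists>c\<in>Hom J j k. c \<cdot>\<^bsub>J\<^esub> a = c \<cdot>\<^bsub>J\<^esub> b)"


section \<open>Abelian categories\<close>

definition zero_object :: "('o, 'm) cat \<Rightarrow> 'o \<Rightarrow> bool" where
  "zero_object C Z \<longleftrightarrow> Z \<in> Obj C \<and>
     (\<forall>X\<in>Obj C. (\<exists>!f. f \<in> Hom C X Z) \<and> (\<exists>!f. f \<in> Hom C Z X))"

definition zero_arrow :: "('o, 'm) cat \<Rightarrow> 'm \<Rightarrow> bool" where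
  "zero_arrow C f \<longleftrightarrow> f \<in> Arr C \<and>
     (\<exists>Z. zero_object C Z \<and> (\<exists>g\<in>Hom C (Dom C f) Z. \<exists>h\<in>Hom C Z (Cod C f). f = h \<cdot>\<^bsub>C\<^esub> g))"

definition is_kernel :: "('o, 'm) cat \<Rightarrow> 'm \<Rightarrow> 'm \<Rightarrow> bool" where
  "is_kernel C f k \<longleftrightarrow>
     f \<in> Arr C \<and> k \<in> Arr C \<and> Cod C k = Dom C f \<and> zero_arrow C (f \<cdot>\<^bsub>C\<^esub> k) \<and>
     (\<forall>a\<in>Arr C. Cod C a = Dom C f \<and> zero_arrow C (f \<cdot>\<^bsub>C\<^esub> a) \<longrightarrow>
        (\<exists>!h. h \<in> Hom C (Dom C a) (Dom C k) \<and> k \<cdot>\<^bsub>C\<^esub> h = a))"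

definition is_cokernel :: "('o, 'm) cat \<Rightarrow> 'm \<Rightarrow> 'm \<Rightarrow> bool" where
  "is_cokernel C f c \<longleftrightarrow>
     f \<in> Arr C \<and> c \<in> Arr C \<and> Dom C c = Cod C f \<and> zero_arrow C (c \<cdot>\<^bsub>C\<^esub> f) \<and>
     (\<forall>a\<in>Arr C. Dom C a = Cod C f \<and> zero_arrow C (a \<cdot>\<^bsub>C\<^esub> f) \<longrightarrow>
        (\<exists>!h. h \<in> Hom C (Cod C c) (Cod C a) \<and> h \<cdot>\<^bsub>C\<^esub> c = a))"

text \<open>The group structures on hom-sets are written multiplicatively, as in \<open>HOL-Algebra\<close>.\<close>

definition preadditive :: "('o, 'm) cat \<Rightarrow> ('o \<Rightarrow> 'o \<Rightarrow> 'm monoid) \<Rightarrow> bool" where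
  "preadditive C P \<longleftrightarrow> category C \<and>
     (\<forall>X\<in>Obj C. \<forall>Y\<in>Obj C. carrier (P X Y) = Hom C X Y \<and> comm_group (P X Y)) \<and>
     (\<forall>X\<in>Obj C. \<forall>Y\<in>Obj C. \<forall>Z\<in>Obj C. \<forall>f\<in>Hom C X Y. \<forall>g\<in>Hom C X Y. \<forall>h\<in>Hom C Y Z.
        h \<cdot>\<^bsub>C\<^esub> (f \<otimes>\<^bsub>P X Y\<^esub> g) = (h \<cdot>\<^bsub>C\<^esub> f) \<otimes>\<^bsub>P X Z\<^esub> (h \<cdot>\<^bsub>C\<^esub> g)) \<and>
     (\<forall>X\<in>Obj C. \<forall>Y\<in>Obj C. \<forall>Z\<in>Obj C. \<forall>f\<in>Hom C X Y. \<forall>g\<in>Hom C Y Z. \<forall>h\<in>Hom C Y Z.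
        (g \<otimes>\<^bsub>P Y Z\<^esub> h) \<cdot>\<^bsub>C\<^esub> f = (g \<cdot>\<^bsub>C\<^esub> f) \<otimes>\<^bsub>P X Z\<^esub> (h \<cdot>\<^bsub>C\<^esub> f))"

definition is_biproduct ::
    "('o, 'm) cat \<Rightarrow> ('o \<Rightarrow> 'o \<Rightarrow> 'm monoid) \<Rightarrow> 'o \<Rightarrow> 'o \<Rightarrow> 'o \<Rightarrow> 'm \<Rightarrow> 'm \<Rightarrow> 'm \<Rightarrow> 'm \<Rightarrow> bool" where
  "is_biproduct C P X Y B i j p q \<longleftrightarrow> B \<in> Obj C \<and>
     i \<in> Hom C X B \<and> j \<in> Hom C Y B \<and> p \<in> Hom C B X \<and> q \<in> Hom C B Y \<and>
     p \<cdot>\<^bsub>C\<^esub> i = Id C X \<and> q \<cdot>\<^bsub>C\<^esub> j = Id C Y \<and>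
     (i \<cdot>\<^bsub>C\<^esub> p) \<otimes>\<^bsub>P B B\<^esub> (j \<cdot>\<^bsub>C\<^esub> q) = Id C B"

definition abelian :: "('o, 'm) cat \<Rightarrow> bool" where
  "abelian C \<longleftrightarrow>
     (\<exists>P. preadditive C P \<and>
        (\<forall>X\<in>Obj C. \<forall>Y\<in>Obj C. \<exists>B i j p q. is_biproduct C P X Y B i j p q)) \<and>
     (\<exists>Z. zero_object C Z) \<and>
     (\<forall>f\<in>Arr C. \<exists>k. is_kernel C f k) \<and>
     (\<forall>f\<in>Arr C. \<exists>c. is_cokernel C f c) \<and>
     (\<forall>m\<in>monomorphisms C. \<exists>f. is_kernel C f m) \<and>
     (\<forall>e\<in>epimorphisms C. \<exists>f. is_cokernel C f e)"

definition short_exact :: "('o, 'm) cat \<Rightarrow> 'm \<Rightarrow> 'm \<Rightarrow> bool" where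
  "short_exact C f g \<longleftrightarrow> is_kernel C g f \<and> is_cokernel C f g"

text \<open>Every small category is isomorphic to one whose objects and arrows form small subsets of \<open>'u\<close>.\<close>

definition filtered_colimits_exact :: "'u itself \<Rightarrow> ('o, 'm) cat \<Rightarrow> bool" where
  "filtered_colimits_exact U C \<longleftrightarrow>
     (\<forall>(J :: ('u, 'u) cat) F G H \<alpha> \<beta> L M N \<kappa> \<mu> \<nu> a b.
        filtered J \<and> small U (Obj J) \<and> small U (Arr J) \<and>
        is_nat_trans J C F G \<alpha> \<and> is_nat_trans J C G H \<beta> \<and>
        (\<forall>j\<in>Obj J. short_exact C (\<alpha> j) (\<beta> j)) \<and>
        is_colimit J C F L \<kappa> \<and> is_colimit J C G M \<mu> \<and> is_colimit J C H N \<nu> \<and>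
        a \<in> Hom C L M \<and> (\<forall>j\<in>Obj J. a \<cdot>\<^bsub>C\<^esub> \<kappa> j = \<mu> j \<cdot>\<^bsub>C\<^esub> \<alpha> j) \<and>
        b \<in> Hom C M N \<and> (\<forall>j\<in>Obj J. b \<cdot>\<^bsub>C\<^esub> \<mu> j = \<nu> j \<cdot>\<^bsub>C\<^esub> \<beta> j)
        \<longrightarrow> short_exact C a b)"

definition is_generator :: "('o, 'm) cat \<Rightarrow> 'o \<Rightarrow> bool" where
  "is_generator C S \<longleftrightarrow> S \<in> Obj C \<and>
     (\<forall>X\<in>Obj C. \<forall>Y\<in>Obj C. \<forall>f\<in>Hom C X Y. \<forall>g\<in>Hom C X Y.
        f \<noteq> g \<longrightarrow> (\<exists>h\<in>Hom C S X. f \<cdot>\<^bsub>C\<^esub> h \<noteq> g \<cdot>\<^bsub>C\<^esub> h))"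

definition well_powered_abelian_with_coproducts :: "'u itself \<Rightarrow> ('o, 'm) cat \<Rightarrow> bool" where
  "well_powered_abelian_with_coproducts U A \<longleftrightarrow>
     locally_small U A \<and> abelian A \<and> well_powered U A \<and> has_small_coproducts U A"

definition grothendieck_abelian :: "'u itself \<Rightarrow> ('o, 'm) cat \<Rightarrow> bool" where
  "grothendieck_abelian U A \<longleftrightarrow>
     locally_small U A \<and> abelian A \<and> has_small_coproducts U A \<and>
     filtered_colimits_exact U A \<and> (\<exists>S. is_generator A S)"

definition nonzero_category :: "('o, 'm) cat \<Rightarrow> bool" where
  "nonzero_category C \<longleftrightarrow> (\<exists>X\<in>Obj C. \<not> zero_object C X)"


section \<open>Proper factorization systems and transfer functors\<close>

definition orthogonal :: "('o, 'm) cat \<Rightarrow> 'm \<Rightarrow> 'm \<Rightarrow> bool" where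
  "orthogonal C e m \<longleftrightarrow>
     (\<forall>u\<in>Hom C (Dom C e) (Dom C m). \<forall>v\<in>Hom C (Cod C e) (Cod C m).
        m \<cdot>\<^bsub>C\<^esub> u = v \<cdot>\<^bsub>C\<^esub> e \<longrightarrow>
        (\<exists>!d. d \<in> Hom C (Cod C e) (Dom C m) \<and> d \<cdot>\<^bsub>C\<^esub> e = u \<and> m \<cdot>\<^bsub>C\<^esub> d = v))"

definition comp_closed :: "('o, 'm) cat \<Rightarrow> 'm set \<Rightarrow> bool" where
  "comp_closed C K \<longleftrightarrow> (\<forall>f\<in>K. \<forall>g\<in>K. Dom C g = Cod C f \<longrightarrow> g \<cdot>\<^bsub>C\<^esub> f \<in> K)"

definition factorization_system :: "('o, 'm) cat \<Rightarrow> 'm set \<Rightarrow> 'm set \<Rightarrow> bool" where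
  "factorization_system C E M \<longleftrightarrow>
     E \<subseteq> Arr C \<and> M \<subseteq> Arr C \<and> isomorphisms C \<subseteq> E \<and> isomorphisms C \<subseteq> M \<and> comp_closed C E \<and> comp_closed C M \<and>
     (\<forall>f\<in>Arr C. \<exists>e\<in>E. \<exists>m\<in>M. Dom C m = Cod C e \<and> f = m \<cdot>\<^bsub>C\<^esub> e) \<and>
     (\<forall>e\<in>E. \<forall>m\<in>M. orthogonal C e m)"

definition proper_factorization_system :: "('o, 'm) cat \<Rightarrow> 'm set \<Rightarrow> 'm set \<Rightarrow> bool" where
  "proper_factorization_system C E M \<longleftrightarrow>
     factorization_system C E M \<and> E \<subseteq> epimorphisms C \<and> M \<subseteq> monomorphisms C"

text \<open>The standing assumptions on the source and the target of a transfer functor.\<close>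

definition factorized_category ::
    "'u itself \<Rightarrow> ('o, 'm) cat \<Rightarrow> 'm set \<Rightarrow> 'm set \<Rightarrow> bool" where
  "factorized_category U C E M \<longleftrightarrow>
     locally_small U C \<and> proper_factorization_system C E M \<and>
     (\<forall>m\<in>M. \<forall>n\<in>M. Cod C m = Cod C n \<longrightarrow> (\<exists>p q. is_pullback C m n p q)) \<and>
     (\<forall>d\<in>E. \<forall>e\<in>E. Dom C d = Dom C e \<longrightarrow> (\<exists>p q. is_pushout C d e p q))"

definition transfer_functor ::
    "'u itself \<Rightarrow> ('o, 'm) cat \<Rightarrow> 'm set \<Rightarrow> 'm set \<Rightarrow> ('p, 'n) cat \<Rightarrow> 'n set \<Rightarrow> 'n set \<Rightarrow>
     ('o, 'm, 'p, 'n) cfunctor \<Rightarrow> bool" where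
  "transfer_functor U C E M D E' M' T \<longleftrightarrow>
     factorized_category U C E M \<and> factorized_category U D E' M' \<and>
     is_functor C D T \<and> conservative C D T \<and>
     AMap T ` E \<subseteq> E' \<and> AMap T ` M \<subseteq> M' \<and>
     (\<forall>m\<in>M. \<forall>n\<in>M. \<forall>p q. is_pullback C m n p q \<longrightarrow>
        is_pullback D (AMap T m) (AMap T n) (AMap T p) (AMap T q)) \<and>
     (\<forall>d\<in>E. \<forall>e\<in>E. \<forall>p q. is_pushout C d e p q \<longrightarrow>
        is_pushout D (AMap T d) (AMap T e) (AMap T p) (AMap T q))"


section \<open>Noetherian forms\<close>

text \<open>\<open>dir F f\<close> and \<open>inv_im F f\<close> are the maps $f_!$ and $f^*$.\<close>

record ('o, 'm, 's) form =
  fib :: "'o \<Rightarrow> 's gorder"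
  dir :: "'m \<Rightarrow> 's \<Rightarrow> 's"
  inv_im :: "'m \<Rightarrow> 's \<Rightarrow> 's"

definition is_form :: "'u itself \<Rightarrow> ('o, 'm) cat \<Rightarrow> ('o, 'm, 's) form \<Rightarrow> bool" where
  "is_form U C F \<longleftrightarrow>
     (\<forall>X\<in>Obj C. bounded_lattice (fib F X) \<and> small U (carrier (fib F X))) \<and>
     (\<forall>X\<in>Obj C. \<forall>Y\<in>Obj C. \<forall>f\<in>Hom C X Y.
        dir F f \<in> carrier (fib F X) \<rightarrow> carrier (fib F Y) \<and>
        inv_im F f \<in> carrier (fib F Y) \<rightarrow> carrier (fib F X) \<and>
        isotone (fib F X) (fib F Y) (dir F f) \<and>
        isotone (fib F Y) (fib F X) (inv_im F f) \<and>
        (\<forall>S\<in>carrier (fib F X). \<forall>T\<in>carrier (fib F Y).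
           dir F f S \<sqsubseteq>\<^bsub>fib F Y\<^esub> T \<longleftrightarrow> S \<sqsubseteq>\<^bsub>fib F X\<^esub> inv_im F f T)) \<and>
     (\<forall>X\<in>Obj C. \<forall>Y\<in>Obj C. \<forall>Z\<in>Obj C. \<forall>f\<in>Hom C X Y. \<forall>g\<in>Hom C Y Z.
        (\<forall>S\<in>carrier (fib F X). dir F (g \<cdot>\<^bsub>C\<^esub> f) S = dir F g (dir F f S)) \<and>
        (\<forall>T\<in>carrier (fib F Z). inv_im F (g \<cdot>\<^bsub>C\<^esub> f) T = inv_im F f (inv_im F g T))) \<and>
     (\<forall>X\<in>Obj C. \<forall>S\<in>carrier (fib F X). dir F (Id C X) S = S \<and> inv_im F (Id C X) S = S)"

definition Im :: "('o, 'm) cat \<Rightarrow> ('o, 'm, 's) form \<Rightarrow> 'm \<Rightarrow> 's" where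
  "Im C F f = dir F f \<top>\<^bsub>fib F (Dom C f)\<^esub>"

definition Ker :: "('o, 'm) cat \<Rightarrow> ('o, 'm, 's) form \<Rightarrow> 'm \<Rightarrow> 's" where
  "Ker C F f = inv_im F f \<bottom>\<^bsub>fib F (Cod C f)\<^esub>"

definition conormal :: "('o, 'm) cat \<Rightarrow> ('o, 'm, 's) form \<Rightarrow> 'o \<Rightarrow> 's \<Rightarrow> bool" where
  "conormal C F X S \<longleftrightarrow> (\<exists>f\<in>Arr C. Cod C f = X \<and> Im C F f = S)"

definition normal :: "('o, 'm) cat \<Rightarrow> ('o, 'm, 's) form \<Rightarrow> 'o \<Rightarrow> 's \<Rightarrow> bool" where
  "normal C F X S \<longleftrightarrow> (\<exists>f\<in>Arr C. Dom C f = X \<and> Ker C F f = S)"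

definition is_embedding ::
    "('o, 'm) cat \<Rightarrow> ('o, 'm, 's) form \<Rightarrow> 'o \<Rightarrow> 's \<Rightarrow> 'm \<Rightarrow> bool" where
  "is_embedding C F X S \<iota> \<longleftrightarrow>
     conormal C F X S \<and> \<iota> \<in> Arr C \<and> Cod C \<iota> = X \<and> Im C F \<iota> = S \<and>
     (\<forall>f\<in>Arr C. Cod C f = X \<and> Im C F f \<sqsubseteq>\<^bsub>fib F X\<^esub> S \<longrightarrow>
        (\<exists>!h. h \<in> Hom C (Dom C f) (Dom C \<iota>) \<and> f = \<iota> \<cdot>\<^bsub>C\<^esub> h))"

definition is_quotient ::
    "('o, 'm) cat \<Rightarrow> ('o, 'm, 's) form \<Rightarrow> 'o \<Rightarrow> 's \<Rightarrow> 'm \<Rightarrow> bool" where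
  "is_quotient C F X K \<pi> \<longleftrightarrow>
     normal C F X K \<and> \<pi> \<in> Arr C \<and> Dom C \<pi> = X \<and> Ker C F \<pi> = K \<and>
     (\<forall>g\<in>Arr C. Dom C g = X \<and> K \<sqsubseteq>\<^bsub>fib F X\<^esub> Ker C F g \<longrightarrow>
        (\<exists>!h. h \<in> Hom C (Cod C \<pi>) (Cod C g) \<and> g = h \<cdot>\<^bsub>C\<^esub> \<pi>))"

definition noetherian :: "('o, 'm) cat \<Rightarrow> ('o, 'm, 's) form \<Rightarrow> bool" where
  "noetherian C F \<longleftrightarrow>
     (\<forall>X\<in>Obj C. \<forall>Y\<in>Obj C. \<forall>f\<in>Hom C X Y.
        (\<forall>S\<in>carrier (fib F X). inv_im F f (dir F f S) = S \<squnion>\<^bsub>fib F X\<^esub> Ker C F f) \<and>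
        (\<forall>T\<in>carrier (fib F Y). dir F f (inv_im F f T) = T \<sqinter>\<^bsub>fib F Y\<^esub> Im C F f)) \<and>
     (\<forall>f\<in>Arr C. \<exists>e m. Dom C m = Cod C e \<and> f = m \<cdot>\<^bsub>C\<^esub> e \<and>
        is_quotient C F (Dom C f) (Ker C F f) e \<and> is_embedding C F (Cod C f) (Im C F f) m) \<and>
     (\<forall>X\<in>Obj C. \<forall>S T. normal C F X S \<and> normal C F X T \<longrightarrow> normal C F X (S \<squnion>\<^bsub>fib F X\<^esub> T)) \<and>
     (\<forall>X\<in>Obj C. \<forall>S T. conormal C F X S \<and> conormal C F X T \<longrightarrow>
        conormal C F X (S \<sqinter>\<^bsub>fib F X\<^esub> T))"

definition form_quotients :: "('o, 'm) cat \<Rightarrow> ('o, 'm, 's) form \<Rightarrow> 'm set" where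
  "form_quotients C F = {\<pi>. \<exists>X\<in>Obj C. \<exists>K. is_quotient C F X K \<pi>}"

definition form_embeddings :: "('o, 'm) cat \<Rightarrow> ('o, 'm, 's) form \<Rightarrow> 'm set" where
  "form_embeddings C F = {\<iota>. \<exists>X\<in>Obj C. \<exists>S. is_embedding C F X S \<iota>}"

text \<open>As the fibres are small, it is no restriction that their elements are taken from \<open>'u\<close>.\<close>

definition has_noetherian_form_inducing ::
    "'u itself \<Rightarrow> ('o, 'm) cat \<Rightarrow> 'm set \<Rightarrow> 'm set \<Rightarrow> bool" where
  "has_noetherian_form_inducing U C E M \<longleftrightarrow>
     (\<exists>F :: ('o, 'm, 'u) form. is_form U C F \<and> noetherian C F \<and>
        form_quotients C F = E \<and> form_embeddings C F = M)"

text \<open>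
  HOL has no quantification over types inside a formula, so the types of objects \<open>'c\<close> and arrows
  \<open>'d\<close> of the tested categories are a parameter. A theorem that concludes
  \<open>universal_target U TYPE('c \<times> 'd) D E M\<close> with \<open>'c\<close> and \<open>'d\<close> schematic covers all categories.
\<close>

definition universal_target ::
    "'u itself \<Rightarrow> ('c \<times> 'd) itself \<Rightarrow> ('p, 'n) cat \<Rightarrow> 'n set \<Rightarrow> 'n set \<Rightarrow> bool" where
  "universal_target U V D E' M' \<longleftrightarrow>
     factorized_category U D E' M' \<and>
     (\<forall>(C :: ('c, 'd) cat) E M. factorized_category U C E M \<longrightarrow>
        (has_noetherian_form_inducing U C E M \<longleftrightarrow>
         (\<exists>T. transfer_functor U C E M D E' M' T)))"


section \<open>The category of sets and copower functors\<close>

type_synonym 'u set_arrow = "'u set \<times> ('u \<Rightarrow> 'u) \<times> 'u set"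

definition set_cat :: "('u set, 'u set_arrow) cat" where
  "set_cat =
     \<lparr> Obj = {X. small TYPE('u) X},
       Arr = {(X, f, Y). small TYPE('u) X \<and> small TYPE('u) Y \<and> f \<in> X \<rightarrow>\<^sub>E Y},
       Dom = (\<lambda>(X, f, Y). X),
       Cod = (\<lambda>(X, f, Y). Y),
       Id = (\<lambda>X. (X, \<lambda>x\<in>X. x, X)),
       Comp = (\<lambda>(Y, g, Z) (X, f, W). (X, compose X g f, Z)) \<rparr>"

definition surjections :: "'u set_arrow set" where
  "surjections = {(X, f, Y) \<in> Arr set_cat. f ` X = Y}"

definition injections :: "'u set_arrow set" where
  "injections = {(X, f, Y) \<in> Arr set_cat. inj_on f X}"

text \<open>
  \<open>Q X\<close> with injections \<open>\<iota> X x\<close> is meant to be a chosen coproduct of \<open>X\<close> copies of an object; the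
  arrow part is then the unique arrow with \<open>h \<cdot> \<iota> X x = \<iota> Y (f x)\<close>.
\<close>

definition is_copower_choice ::
    "('o, 'm) cat \<Rightarrow> 'o \<Rightarrow> ('u set \<Rightarrow> 'o) \<Rightarrow> ('u set \<Rightarrow> 'u \<Rightarrow> 'm) \<Rightarrow> bool" where
  "is_copower_choice A G Q \<iota> \<longleftrightarrow>
     (\<forall>X. small TYPE('u) X \<longrightarrow> is_coproduct A X (\<lambda>_. G) (Q X) (\<iota> X))"

definition copower_functor ::
    "('o, 'm) cat \<Rightarrow> ('u set \<Rightarrow> 'o) \<Rightarrow> ('u set \<Rightarrow> 'u \<Rightarrow> 'm) \<Rightarrow>
     ('u set, 'u set_arrow, 'o, 'm) cfunctor" where
  "copower_functor A Q \<iota> =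
     \<lparr> OMap = Q,
       AMap = (\<lambda>(X, f, Y). THE h. h \<in> Hom A (Q X) (Q Y) \<and>
                                  (\<forall>x\<in>X. h \<cdot>\<^bsub>A\<^esub> \<iota> X x = \<iota> Y (f x))) \<rparr>"

end

theory Submission
  imports Defs
begin

text \<open>
  For a noetherian form, sending \<open>X\<close> to its fibre and \<open>f\<close> to the direct image map is a transfer
  functor to sets: the fibre over an \<open>M\<close>-subobject is a principal ideal, the fibre over an
  \<open>E\<close>-quotient is a principal filter, and pullbacks and pushouts correspond to meets and joins of
  the generators. Composing with the copower functor \<open>H\<^sub>G\<close> gives a transfer functor to \<open>A\<close>.
  Conversely, a transfer functor \<open>T\<close> to \<open>A\<close> pulls back the lattices of subobjects of the objects
  \<open>T X\<close>; conservativity and preservation of pullbacks and pushouts make \<open>M\<close> and \<open>E\<close> the embeddings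
  and quotients of this form.

  The copower functor preserves pushouts because it is a left adjoint; it preserves pullbacks of
  injections because these are absolute in the category of sets and partial maps, to which it extends
  by zero arrows.
\<close>

section \<open>Small sets\<close>

text \<open>The obstacle on the converse side is (N1) for subobjects. The identity for
  \<open>f_! f^*\<close> rests on stability of epimorphisms under pullback along monomorphisms, and
  the identity for \<open>f^* f_!\<close> on the dual stability of monomorphisms. Both follow from
  self-dual axioms on kernels and cokernels, so half of the theory comes from the opposite category;
  addition serves to derive cancellation of arrows from cancellation of zero arrows.

  On the other side, direct images alone must reflect isomorphisms. A bijective \<open>f_!\<close>
  forces bottom kernel and top image, and by (N2) such an arrow is invertible. Pushouts of
  surjections are quotients by generated equivalence relations, which in general involve long
  zigzags; here (N1) and (N3) make two steps enough, joining first with one kernel and then with the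
  other.

  A nonzero \<open>G\<close> makes \<open>H_G\<close> conservative: projections onto single summands
  tell the coproduct injections apart. Well-poweredness makes the fibres small, and a generator
  provides it.\<close>

lemma small_card_le: "small U B \<Longrightarrow> |A| \<le>o |B| \<Longrightarrow> small U A"
  unfolding small_def by (metis ordLeq_ordLess_trans)

lemma small_image: "small U A \<Longrightarrow> small U (f ` A)"
  by (erule small_card_le) (rule card_of_image)

lemma small_subset: "small U B \<Longrightarrow> A \<subseteq> B \<Longrightarrow> small U A"
  by (erule small_card_le) (rule card_of_mono1)

lemma small_inj_on: "small U B \<Longrightarrow> inj_on f A \<Longrightarrow> f ` A \<subseteq> B \<Longrightarrow> small U A"
  by (erule small_card_le) (use card_of_ordLeq in blast)

lemma small_inj_on_image: "small U (f ` A) \<Longrightarrow> inj_on f A \<Longrightarrow> small U A"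
  by (rule small_inj_on) auto

text \<open>The bridge from arbitrary types to \<open>'u\<close>: the closure conditions of a
  universe speak of subsets of \<open>'u\<close>, so a small set over another type is first coded
  there.\<close>

lemma small_encode:
  assumes "small (U :: 'u itself) (A :: 'a set)"
  obtains \<phi> :: "'a \<Rightarrow> 'u" where "inj_on \<phi> A"
proof -
  have "|A| \<le>o |UNIV :: 'u set|"
    using assms unfolding small_def by (rule ordLess_imp_ordLeq)
  then show ?thesis using that unfolding card_of_ordLeq[symmetric] by blast
qed

lemma small_empty: "small U {}"
  unfolding small_def card_of_ordLess[symmetric] by auto

section \<open>Power sets, products and function spaces of small sets\<close>

context
  assumes univ: "grothendieck_universe TYPE('u)"
begin

lemma small_Pow:
  assumes "small TYPE('u) A"
  shows "small TYPE('u) (Pow A)"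
proof -
  obtain \<phi> :: "'a \<Rightarrow> 'u" where \<phi>: "inj_on \<phi> A" using small_encode[OF assms] .
  have "small TYPE('u) (Pow (\<phi> ` A))"
    using univ small_image[OF assms, of \<phi>] unfolding grothendieck_universe_def by blast
  moreover have "inj_on ((`) \<phi>) (Pow A)" using \<phi> by (rule inj_on_image_Pow)
  ultimately show ?thesis by (rule small_inj_on) auto
qed

text \<open>In a finite universe the complement of a point would be small, and so would its power
  set. But the whole universe injects into that power set: each other element goes to its singleton,
  and the removed point goes to the empty set.\<close>

lemma infinite_universe: "infinite (UNIV :: 'u set)"
proof
  assume fin: "finite (UNIV :: 'u set)"
  fix x :: 'u
  have "\<not> (\<exists>f. inj_on f (UNIV :: 'u set) \<and> f ` UNIV \<subseteq> UNIV - {x})"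
    using finite_UNIV_inj_surj[OF fin] by blast
  then have "small TYPE('u) (UNIV - {x})"
    unfolding small_def card_of_ordLess .
  then have "small TYPE('u) (Pow (UNIV - {x}))" by (rule small_Pow)
  moreover have "inj (\<lambda>y. {y} - {x})" by (auto intro!: injI)
  ultimately show False
    unfolding small_def card_of_ordLess[symmetric] by blast
qed

text \<open>Infinitude yields an injective pairing on \<open>'u\<close>. The coded product is then a
  small union of small rows, to which closure under unions applies.\<close>

lemma small_Times:
  assumes "small TYPE('u) A" "small TYPE('u) B"
  shows "small TYPE('u) (A \<times> B)"
proof -
  obtain \<phi> :: "'a \<Rightarrow> 'u" where \<phi>: "inj_on \<phi> A" using small_encode[OF assms(1)] .
  obtain \<psi> :: "'b \<Rightarrow> 'u" where \<psi>: "inj_on \<psi> B" using small_encode[OF assms(2)] .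
  have "|UNIV :: ('u \<times> 'u) set| \<le>o |UNIV :: 'u set|"
    using ordIso_imp_ordLeq[OF card_of_Times_same_infinite[OF infinite_universe]] by simp
  then obtain p :: "'u \<times> 'u \<Rightarrow> 'u" where p: "inj p"
    unfolding card_of_ordLeq[symmetric] by blast
  have "small TYPE('u) (\<Union>x\<in>\<phi> ` A. (\<lambda>y. p (x, y)) ` \<psi> ` B)"
    by (intro univ[unfolded grothendieck_universe_def, THEN conjunct2, rule_format] conjI ballI
        small_image assms)
  moreover have "inj_on (\<lambda>(a, b). p (\<phi> a, \<psi> b)) (A \<times> B)"
    by (rule inj_onI) (auto simp: inj_eq[OF p] inj_on_eq_iff[OF \<phi>] inj_on_eq_iff[OF \<psi>])
  ultimately show ?thesis by (rule small_inj_on) auto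
qed

lemma small_singleton: "small TYPE('u) {x}"
proof -
  have "small TYPE('u) (Pow ({} :: 'u set))" by (rule small_Pow[OF small_empty])
  then show ?thesis by (rule small_card_le) (simp add: card_of_singl_ordLeq)
qed

text \<open>Extensional functions are determined by their graphs, which lie in the power set of the
  product. This gives local smallness of \<open>set_cat\<close>.\<close>

lemma small_PiE:
  assumes "small TYPE('u) A" "small TYPE('u) B"
  shows "small TYPE('u) (A \<rightarrow>\<^sub>E B)"
proof -
  have "inj_on (\<lambda>f. {(x, f x) | x. x \<in> A}) (A \<rightarrow>\<^sub>E B)"
  proof (rule inj_onI)
    fix f g assume f: "f \<in> A \<rightarrow>\<^sub>E B" and g: "g \<in> A \<rightarrow>\<^sub>E B"
      and eq: "{(x, f x) | x. x \<in> A} = {(x, g x) | x. x \<in> A}"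
    have "f x = g x" if "x \<in> A" for x
      using eq that by blast
    then show "f = g" using f g by (rule PiE_ext[rotated 2])
  qed
  then show ?thesis
    by (rule small_inj_on[OF small_Pow[OF small_Times[OF assms]]]) (auto simp: PiE_iff)
qed

end

section \<open>Categories and duality\<close>

lemma in_Hom_iff: "f \<in> Hom C X Y \<longleftrightarrow> f \<in> Arr C \<and> Dom C f = X \<and> Cod C f = Y"
  unfolding Hom_def by auto

context category
begin

lemma arr_Comp: "f \<in> Arr C \<Longrightarrow> g \<in> Arr C \<Longrightarrow> Dom C g = Cod C f \<Longrightarrow> g \<cdot> f \<in> Arr C"
  and dom_Comp: "f \<in> Arr C \<Longrightarrow> g \<in> Arr C \<Longrightarrow> Dom C g = Cod C f \<Longrightarrow> Dom C (g \<cdot> f) = Dom C f"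
  and cod_Comp: "f \<in> Arr C \<Longrightarrow> g \<in> Arr C \<Longrightarrow> Dom C g = Cod C f \<Longrightarrow> Cod C (g \<cdot> f) = Cod C g"
  using Comp_in_Hom[of f "Dom C f" "Cod C f" g "Cod C g"] by (auto simp: in_Hom_iff)

lemma arr_Id: "X \<in> Obj C \<Longrightarrow> Id C X \<in> Arr C"
  and dom_Id: "X \<in> Obj C \<Longrightarrow> Dom C (Id C X) = X"
  and cod_Id: "X \<in> Obj C \<Longrightarrow> Cod C (Id C X) = X"
  using Id_in_Hom by (auto simp: in_Hom_iff)

lemma assoc:
  "f \<in> Arr C \<Longrightarrow> g \<in> Arr C \<Longrightarrow> h \<in> Arr C \<Longrightarrow> Dom C g = Cod C f \<Longrightarrow> Dom C h = Cod C g \<Longrightarrow>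
   (h \<cdot> g) \<cdot> f = h \<cdot> (g \<cdot> f)"
  by (rule Comp_assoc) (auto simp: in_Hom_iff)

lemma Comp_Id': "f \<in> Arr C \<Longrightarrow> Dom C f = X \<Longrightarrow> f \<cdot> Id C X = f"
  by (rule Comp_Id) (auto simp: in_Hom_iff)

lemma Id_Comp': "f \<in> Arr C \<Longrightarrow> Cod C f = Y \<Longrightarrow> Id C Y \<cdot> f = f"
  by (rule Id_Comp) (auto simp: in_Hom_iff)

lemmas cat_simps [simp] =
  arr_Comp dom_Comp cod_Comp arr_Id dom_Id cod_Id assoc Comp_Id' Id_Comp' Dom_in_Obj Cod_in_Obj

text \<open>The simplifier nests composites to the right, which hides \<open>f \<cdot> p\<close>
  inside \<open>f \<cdot> (p \<cdot> h)\<close>. This lemma and \<open>assoc_eq1\<close> precompose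
  a square or a triangle with \<open>h\<close>, so that it can be applied in the nested
  form.\<close>

lemma assoc_eq:
  assumes "f \<cdot> p = g \<cdot> q" "f \<in> Arr C" "p \<in> Arr C" "g \<in> Arr C" "q \<in> Arr C"
    "Dom C f = Cod C p" "Dom C g = Cod C q" "h \<in> Arr C" "Dom C p = Cod C h" "Dom C q = Cod C h"
  shows "f \<cdot> (p \<cdot> h) = g \<cdot> (q \<cdot> h)"
  using assms by (metis assoc)

lemma assoc_eq1:
  assumes "f \<cdot> p = g" "f \<in> Arr C" "p \<in> Arr C" "Dom C f = Cod C p" "h \<in> Arr C" "Dom C p = Cod C h"
  shows "f \<cdot> (p \<cdot> h) = g \<cdot> h"
  using assms by (metis assoc)

section \<open>Monomorphisms, isomorphisms and pullbacks\<close>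

lemma monoD:
  assumes "m \<in> monomorphisms C" "f \<in> Arr C" "g \<in> Arr C" "Dom C f = Dom C g"
    "Cod C f = Dom C m" "Cod C g = Dom C m" "m \<cdot> f = m \<cdot> g"
  shows "f = g"
proof -
  have "f \<in> Hom C (Dom C f) (Dom C m)" "g \<in> Hom C (Dom C f) (Dom C m)" "Dom C f \<in> Obj C"
    using assms(2-6) by (simp_all add: in_Hom_iff)
  then show ?thesis using assms(1,7) unfolding monomorphisms_def by blast
qed

lemma epiD:
  assumes "e \<in> epimorphisms C" "f \<in> Arr C" "g \<in> Arr C" "Cod C f = Cod C g"
    "Dom C f = Cod C e" "Dom C g = Cod C e" "f \<cdot> e = g \<cdot> e"
  shows "f = g"
proof -
  have "f \<in> Hom C (Cod C e) (Cod C f)" "g \<in> Hom C (Cod C e) (Cod C f)" "Cod C f \<in> Obj C"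
    using assms(2-6) by (simp_all add: in_Hom_iff)
  then show ?thesis using assms(1,7) unfolding epimorphisms_def by blast
qed

lemma monoI:
  assumes "m \<in> Arr C"
    "\<And>f g. f \<in> Arr C \<Longrightarrow> g \<in> Arr C \<Longrightarrow> Dom C f = Dom C g \<Longrightarrow> Cod C f = Dom C m \<Longrightarrow>
       Cod C g = Dom C m \<Longrightarrow> m \<cdot> f = m \<cdot> g \<Longrightarrow> f = g"
  shows "m \<in> monomorphisms C"
  using assms unfolding monomorphisms_def by (auto simp: in_Hom_iff)

lemma mono_arr: "m \<in> monomorphisms C \<Longrightarrow> m \<in> Arr C"
  and epi_arr: "e \<in> epimorphisms C \<Longrightarrow> e \<in> Arr C"
  and iso_arr: "f \<in> isomorphisms C \<Longrightarrow> f \<in> Arr C"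
  unfolding monomorphisms_def epimorphisms_def isomorphisms_def by auto

lemma isoE:
  assumes "f \<in> isomorphisms C"
  obtains g where "g \<in> Arr C" "Dom C g = Cod C f" "Cod C g = Dom C f"
    "g \<cdot> f = Id C (Dom C f)" "f \<cdot> g = Id C (Cod C f)"
  using assms unfolding isomorphisms_def by (auto simp: in_Hom_iff)

lemma isoI:
  assumes "f \<in> Arr C" "g \<in> Arr C" "Dom C g = Cod C f" "Cod C g = Dom C f"
    "g \<cdot> f = Id C (Dom C f)" "f \<cdot> g = Id C (Cod C f)"
  shows "f \<in> isomorphisms C"
  using assms unfolding isomorphisms_def by (auto simp: in_Hom_iff)

lemma split_mono:
  assumes "m \<in> Arr C" "r \<in> Arr C" "Dom C r = Cod C m" "r \<cdot> m = Id C (Dom C m)"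
  shows "m \<in> monomorphisms C"
proof (rule monoI)
  fix f g assume *: "f \<in> Arr C" "g \<in> Arr C" "Dom C f = Dom C g" "Cod C f = Dom C m"
    "Cod C g = Dom C m" "m \<cdot> f = m \<cdot> g"
  have "r \<cdot> (m \<cdot> f) = r \<cdot> (m \<cdot> g)" using * by simp
  moreover have "r \<cdot> (m \<cdot> h) = h" if "h \<in> Arr C" "Cod C h = Dom C m" for h
    using assoc_eq1[OF assms(4,2,1,3) that(1)] that by simp
  ultimately show "f = g" using * by metis
qed (rule assms)

lemma iso_mono: "f \<in> isomorphisms C \<Longrightarrow> f \<in> monomorphisms C"
  using split_mono[OF iso_arr] isoE[of f] by blast

lemma mono_Comp:
  assumes "m \<in> monomorphisms C" "n \<in> monomorphisms C" "Dom C n = Cod C m"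
  shows "n \<cdot> m \<in> monomorphisms C"
proof (rule monoI)
  note [simp] = mono_arr[OF assms(1)] mono_arr[OF assms(2)] assms(3)
  show "n \<cdot> m \<in> Arr C" by simp
  fix f g assume *: "f \<in> Arr C" "g \<in> Arr C" "Dom C f = Dom C g" "Cod C f = Dom C (n \<cdot> m)"
    "Cod C g = Dom C (n \<cdot> m)" "(n \<cdot> m) \<cdot> f = (n \<cdot> m) \<cdot> g"
  then have "m \<cdot> f = m \<cdot> g" by - (rule monoD[OF assms(2)], auto)
  then show "f = g" using * by - (rule monoD[OF assms(1)], auto)
qed

lemma mono_split_epi_iso:
  assumes m: "m \<in> monomorphisms C" and s: "s \<in> Arr C" "Dom C s = Cod C m" "Cod C s = Dom C m"
    "m \<cdot> s = Id C (Cod C m)"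
  shows "m \<in> isomorphisms C"
proof (rule isoI[of _ s])
  note [simp] = mono_arr[OF m] s
  have "m \<cdot> (s \<cdot> m) = m \<cdot> Id C (Dom C m)" by (subst assoc[symmetric]) simp_all
  then show "s \<cdot> m = Id C (Dom C m)" by - (rule monoD[OF m], auto)
qed (use s mono_arr[OF m] in auto)

lemma pullbackE:
  assumes "is_pullback C f g p q" "a \<in> Arr C" "b \<in> Arr C" "Dom C a = Dom C b"
    "Cod C a = Dom C f" "Cod C b = Dom C g" "f \<cdot> a = g \<cdot> b"
  obtains h where "h \<in> Arr C" "Dom C h = Dom C a" "Cod C h = Dom C p" "p \<cdot> h = a" "q \<cdot> h = b"
proof -
  have "\<exists>!h. h \<in> Hom C (Dom C a) (Dom C p) \<and> p \<cdot> h = a \<and> q \<cdot> h = b"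
  proof -
    have "a \<in> Hom C (Dom C a) (Dom C f)" "b \<in> Hom C (Dom C a) (Dom C g)"
      using assms(2-6) by (simp_all add: in_Hom_iff)
    then show ?thesis
      using assms(1,7) Dom_in_Obj[OF assms(2)] unfolding is_pullback_def by blast
  qed
  then show ?thesis using that by (auto simp: in_Hom_iff)
qed

lemma pullback_arrs:
  assumes "is_pullback C f g p q"
  shows "f \<in> Arr C" "g \<in> Arr C" "p \<in> Arr C" "q \<in> Arr C" "Cod C f = Cod C g" "Dom C q = Dom C p"
    "Cod C p = Dom C f" "Cod C q = Dom C g"
  using assms unfolding is_pullback_def by auto

lemma pullback_comm: "is_pullback C f g p q \<Longrightarrow> f \<cdot> p = g \<cdot> q"
  unfolding is_pullback_def by blast

lemma pullback_ext:
  assumes "is_pullback C f g p q" "h \<in> Arr C" "k \<in> Arr C" "Dom C h = Dom C k"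
    "Cod C h = Dom C p" "Cod C k = Dom C p" "p \<cdot> h = p \<cdot> k" "q \<cdot> h = q \<cdot> k"
  shows "h = k"
proof -
  note [simp] = pullback_arrs[OF assms(1)] assms(2-6)
  obtain l where "\<And>k. k \<in> Hom C (Dom C k) (Dom C p) \<and> Dom C k = Dom C h \<and> p \<cdot> k = p \<cdot> h \<and> q \<cdot> k = q \<cdot> h \<Longrightarrow> k = l"
  proof -
    have "f \<cdot> (p \<cdot> h) = g \<cdot> (q \<cdot> h)"
      using pullback_comm[OF assms(1)] by (rule assoc_eq) simp_all
    moreover have "p \<cdot> h \<in> Hom C (Dom C h) (Dom C f)" "q \<cdot> h \<in> Hom C (Dom C h) (Dom C g)"
      by (simp_all add: in_Hom_iff)
    ultimately have "\<exists>!l. l \<in> Hom C (Dom C h) (Dom C p) \<and> p \<cdot> l = p \<cdot> h \<and> q \<cdot> l = q \<cdot> h"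
      using assms(1) Dom_in_Obj[OF assms(2)] unfolding is_pullback_def by blast
    then show ?thesis using that by metis
  qed
  from this[of h] this[of k] show ?thesis using assms(7,8) by (simp add: in_Hom_iff)
qed

lemma pullback_mono:
  assumes pb: "is_pullback C f n p q" and n: "n \<in> monomorphisms C"
  shows "p \<in> monomorphisms C"
proof (rule monoI)
  note [simp] = pullback_arrs[OF pb]
  show "p \<in> Arr C" by simp
  fix h k assume *: "h \<in> Arr C" "k \<in> Arr C" "Dom C h = Dom C k" "Cod C h = Dom C p"
    "Cod C k = Dom C p" "p \<cdot> h = p \<cdot> k"
  have "n \<cdot> (q \<cdot> h) = f \<cdot> (p \<cdot> h)" "n \<cdot> (q \<cdot> k) = f \<cdot> (p \<cdot> k)"
    using * assoc_eq[OF pullback_comm[OF pb], of h] assoc_eq[OF pullback_comm[OF pb], of k] by simp_all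
  then have "q \<cdot> h = q \<cdot> k" using * by - (rule monoD[OF n], auto)
  then show "h = k" using * by - (rule pullback_ext[OF pb], auto)
qed

text \<open>Turns an order relation between subobjects into invertibility, which a conservative
  functor can reflect. The identity and \<open>u\<close> form a cone, its mediating arrow is a
  section of \<open>p\<close>, and \<open>p\<close> is monic.\<close>

lemma pullback_le_iso:
  assumes pb: "is_pullback C m n p q" and n: "n \<in> monomorphisms C"
    and u: "u \<in> Arr C" "Dom C u = Dom C m" "Cod C u = Dom C n" "n \<cdot> u = m"
  shows "p \<in> isomorphisms C"
proof -
  note [simp] = pullback_arrs[OF pb] u(1-3)
  obtain h where h: "h \<in> Arr C" "Dom C h = Dom C m" "Cod C h = Dom C p" "p \<cdot> h = Id C (Dom C m)"
  proof (rule pullbackE[OF pb, of "Id C (Dom C m)" u])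
    show "m \<cdot> Id C (Dom C m) = n \<cdot> u" using u(4) by simp
  qed (use that in simp_all)
  show ?thesis by (rule mono_split_epi_iso[OF pullback_mono[OF pb n], of h]) (use h in auto)
qed

end

text \<open>The duality is strict, with the same objects and arrows. Hence a theorem instantiated at
  \<open>op_cat C\<close> simplifies to its dual stated in \<open>C\<close>, and every dual half
  below is obtained in this way.\<close>

definition op_cat :: "('o, 'm) cat \<Rightarrow> ('o, 'm) cat" where
  "op_cat C = \<lparr> Obj = Obj C, Arr = Arr C, Dom = Cod C, Cod = Dom C, Id = Id C,
                Comp = (\<lambda>f g. g \<cdot>\<^bsub>C\<^esub> f) \<rparr>"

lemma op_simps [simp]:
  "Obj (op_cat C) = Obj C" "Arr (op_cat C) = Arr C" "Dom (op_cat C) = Cod C"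
  "Cod (op_cat C) = Dom C" "Id (op_cat C) = Id C" "f \<cdot>\<^bsub>op_cat C\<^esub> g = g \<cdot>\<^bsub>C\<^esub> f"
  "Hom (op_cat C) X Y = Hom C Y X"
  by (auto simp: op_cat_def Hom_def)

lemma op_classes [simp]:
  "monomorphisms (op_cat C) = epimorphisms C" "epimorphisms (op_cat C) = monomorphisms C"
  "isomorphisms (op_cat C) = isomorphisms C"
  "zero_object (op_cat C) Z = zero_object C Z"
  "zero_arrow (op_cat C) f = zero_arrow C f"
  "is_kernel (op_cat C) f k = is_cokernel C f k"
  "is_cokernel (op_cat C) f k = is_kernel C f k"
proof -
  show *: "zero_object (op_cat C) Z = zero_object C Z" for Z
    unfolding zero_object_def by auto
  show **: "zero_arrow (op_cat C) f = zero_arrow C f" for f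
    unfolding zero_arrow_def * by auto
  show "is_kernel (op_cat C) f k = is_cokernel C f k" "is_cokernel (op_cat C) f k = is_kernel C f k"
    unfolding is_kernel_def is_cokernel_def ** by auto
  show "isomorphisms (op_cat C) = isomorphisms C"
    unfolding isomorphisms_def by auto
qed (auto simp: monomorphisms_def epimorphisms_def)

lemma op_pullback [simp]:
  "is_pullback (op_cat C) f g p q = is_pushout C f g p q"
  "is_pushout (op_cat C) f g p q = is_pullback C f g p q"
  unfolding is_pullback_def is_pushout_def by auto

lemma category_op: "category C \<Longrightarrow> category (op_cat C)"
  unfolding category_def by (auto simp: Hom_def)

context category
begin

lemmas pushoutE = category.pullbackE[OF category_op[OF category_axioms], simplified]
  and pushout_arrs = category.pullback_arrs[OF category_op[OF category_axioms], simplified]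
  and pushout_comm = category.pullback_comm[OF category_op[OF category_axioms], simplified]
  and pushout_ext = category.pullback_ext[OF category_op[OF category_axioms], simplified]
  and pushout_le_iso = category.pullback_le_iso[OF category_op[OF category_axioms], simplified]
  and epiI = category.monoI[OF category_op[OF category_axioms], simplified]
  and split_epi = category.split_mono[OF category_op[OF category_axioms], simplified]
  and iso_epi = category.iso_mono[OF category_op[OF category_axioms], simplified]
  and epi_Comp = category.mono_Comp[OF category_op[OF category_axioms], simplified]
  and epi_split_mono_iso = category.mono_split_epi_iso[OF category_op[OF category_axioms], simplified]

lemma iso_Comp:
  assumes "f \<in> isomorphisms C" "g \<in> isomorphisms C" "Dom C g = Cod C f"
  shows "g \<cdot> f \<in> isomorphisms C"
proof -
  note [simp] = iso_arr[OF assms(1)] iso_arr[OF assms(2)] assms(3)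
  obtain f' where f' [simp]: "f' \<in> Arr C" "Dom C f' = Cod C f" "Cod C f' = Dom C f"
    "f' \<cdot> f = Id C (Dom C f)" "f \<cdot> f' = Id C (Cod C f)" using isoE[OF assms(1)] .
  obtain g' where g' [simp]: "g' \<in> Arr C" "Dom C g' = Cod C g" "Cod C g' = Dom C g"
    "g' \<cdot> g = Id C (Dom C g)" "g \<cdot> g' = Id C (Cod C g)" using isoE[OF assms(2)] .
  show ?thesis
    by (rule isoI[of _ "f' \<cdot> g'"])
      (simp_all add: assoc_eq1[of g' g "Id C (Dom C g)" f] assoc_eq1[of f f' "Id C (Cod C f)" g'])
qed

end

section \<open>Exact categories\<close>

context category
begin

section \<open>Zero arrows, kernels and cokernels\<close>

lemma zero_arrowE:
  assumes "zero_arrow C f"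
  obtains Z g h where "zero_object C Z" "f \<in> Arr C" "g \<in> Arr C" "h \<in> Arr C" "Dom C g = Dom C f"
    "Cod C g = Z" "Dom C h = Z" "Cod C h = Cod C f" "f = h \<cdot> g"
  using assms unfolding zero_arrow_def by (auto simp: in_Hom_iff)

lemma zero_arrowI:
  assumes "zero_object C Z" "g \<in> Arr C" "h \<in> Arr C" "Cod C g = Z" "Dom C h = Z"
  shows "zero_arrow C (h \<cdot> g)"
  unfolding zero_arrow_def
  by (rule conjI, use assms in simp, rule exI[of _ Z], intro conjI assms,
      rule bexI[of _ g], rule bexI[of _ h]) (use assms in \<open>auto simp: in_Hom_iff\<close>)

lemma zero_Comp:
  assumes "zero_arrow C g" "f \<in> Arr C" "Dom C g = Cod C f"
  shows "zero_arrow C (g \<cdot> f)"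
  using assms(1)
proof (rule zero_arrowE)
  fix Z k h assume *: "zero_object C Z" "k \<in> Arr C" "h \<in> Arr C" "Dom C k = Dom C g"
    "Cod C k = Z" "Dom C h = Z" "g = h \<cdot> k"
  have "zero_arrow C (h \<cdot> (k \<cdot> f))" by (rule zero_arrowI[OF *(1)]) (use * assms in simp_all)
  then show ?thesis using * assms by simp
qed

lemma Comp_zero:
  assumes "zero_arrow C f" "g \<in> Arr C" "Dom C g = Cod C f"
  shows "zero_arrow C (g \<cdot> f)"
  using category.zero_Comp[OF category_op[OF category_axioms], of f g] assms by simp

lemma zero_objectD:
  assumes "zero_object C Z" "f \<in> Arr C" "g \<in> Arr C"
  shows "Dom C f = Z \<Longrightarrow> Dom C g = Z \<Longrightarrow> Cod C f = Cod C g \<Longrightarrow> f = g"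
    and "Cod C f = Z \<Longrightarrow> Cod C g = Z \<Longrightarrow> Dom C f = Dom C g \<Longrightarrow> f = g"
proof -
  assume *: "Dom C f = Z" "Dom C g = Z" "Cod C f = Cod C g"
  then have "f \<in> Hom C Z (Cod C f)" "g \<in> Hom C Z (Cod C f)" "Cod C f \<in> Obj C"
    using assms by (auto simp: in_Hom_iff)
  then show "f = g" using assms(1) unfolding zero_object_def by blast
next
  assume *: "Cod C f = Z" "Cod C g = Z" "Dom C f = Dom C g"
  then have "f \<in> Hom C (Dom C f) Z" "g \<in> Hom C (Dom C f) Z" "Dom C f \<in> Obj C"
    using assms by (auto simp: in_Hom_iff)
  then show "f = g" using assms(1) unfolding zero_object_def by blast
qed

lemma zero_object_arr:
  assumes "zero_object C Z" "X \<in> Obj C"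
  obtains f g where "f \<in> Arr C" "Dom C f = Z" "Cod C f = X" "g \<in> Arr C" "Dom C g = X" "Cod C g = Z"
  using assms unfolding zero_object_def by (force simp: in_Hom_iff)

text \<open>The two arrows may factor through different zero objects. An arrow \<open>u\<close>
  between these objects matches the two factorizations, because arrows into and out of a zero object
  are unique.\<close>

lemma zero_eq:
  assumes "zero_arrow C f" "zero_arrow C g" "Dom C f = Dom C g" "Cod C f = Cod C g"
  shows "f = g"
  using assms(1)
proof (rule zero_arrowE)
  fix Z a b assume *: "zero_object C Z" "a \<in> Arr C" "b \<in> Arr C" "Dom C a = Dom C f"
    "Cod C a = Z" "Dom C b = Z" "Cod C b = Cod C f" "f = b \<cdot> a"
  from assms(2) show ?thesis
  proof (rule zero_arrowE)
    fix Z' a' b' assume **: "zero_object C Z'" "a' \<in> Arr C" "b' \<in> Arr C" "Dom C a' = Dom C g"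
      "Cod C a' = Z'" "Dom C b' = Z'" "Cod C b' = Cod C g" "g = b' \<cdot> a'"
    obtain u where u: "u \<in> Arr C" "Dom C u = Z" "Cod C u = Z'"
      using zero_object_arr[OF *(1), of Z'] **(2,5) Cod_in_Obj[OF **(2)] by metis
    have "u \<cdot> a = a'" by (rule zero_objectD(2)[OF **(1)]) (use * ** u assms in simp_all)
    moreover have "b' \<cdot> u = b" by (rule zero_objectD(1)[OF *(1)]) (use * ** u assms in simp_all)
    ultimately show "f = g" using * ** u assoc[of a u b'] by metis
  qed
qed

lemma zero_arrow_ex:
  assumes "zero_object C Z" "X \<in> Obj C" "Y \<in> Obj C"
  obtains f where "zero_arrow C f" "f \<in> Arr C" "Dom C f = X" "Cod C f = Y"
proof -
  obtain g where "g \<in> Arr C" "Dom C g = X" "Cod C g = Z"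
    using zero_object_arr[OF assms(1,2)] by metis
  moreover obtain h where "h \<in> Arr C" "Dom C h = Z" "Cod C h = Y"
    using zero_object_arr[OF assms(1,3)] by metis
  ultimately show ?thesis using zero_arrowI[OF assms(1), of g h] that[of "h \<cdot> g"] by simp
qed

text \<open>If the identity is zero, every arrow into or out of \<open>X\<close> is zero and hence
  unique. This is the form in which \<open>G\<close> being nonzero is used.\<close>

lemma zero_Id_iff:
  assumes "zero_object C Z" "X \<in> Obj C"
  shows "zero_arrow C (Id C X) \<longleftrightarrow> zero_object C X"
proof
  assume id: "zero_arrow C (Id C X)"
  have *: "zero_arrow C f" if "f \<in> Arr C" "Dom C f = X \<or> Cod C f = X" for f
    using that zero_Comp[OF id, of f] Comp_zero[OF id, of f] assms by auto
  show "zero_object C X"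
    unfolding zero_object_def
  proof (intro conjI ballI)
    fix Y assume Y: "Y \<in> Obj C"
    obtain f where "f \<in> Arr C" "Dom C f = X" "Cod C f = Y"
      using zero_arrow_ex[OF assms Y] by metis
    then show "\<exists>!f. f \<in> Hom C X Y"
      by (intro ex1I[of _ f]) (auto simp: in_Hom_iff intro!: zero_eq *)
    obtain f where "f \<in> Arr C" "Dom C f = Y" "Cod C f = X"
      using zero_arrow_ex[OF assms(1) Y assms(2)] by metis
    then show "\<exists>!f. f \<in> Hom C Y X"
      by (intro ex1I[of _ f]) (auto simp: in_Hom_iff intro!: zero_eq *)
  qed (rule assms)
next
  assume "zero_object C X"
  then have "zero_arrow C (Id C X \<cdot> Id C X)"
    by (rule zero_arrowI) (use assms in simp_all)
  then show "zero_arrow C (Id C X)" using assms by simp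
qed

lemma kernel_arrs:
  assumes "is_kernel C f k"
  shows "f \<in> Arr C" "k \<in> Arr C" "Cod C k = Dom C f"
  using assms unfolding is_kernel_def by auto

lemma kernel_zero: "is_kernel C f k \<Longrightarrow> zero_arrow C (f \<cdot> k)"
  unfolding is_kernel_def by auto

lemma kernelE:
  assumes "is_kernel C f k" "a \<in> Arr C" "Cod C a = Dom C f" "zero_arrow C (f \<cdot> a)"
  obtains h where "h \<in> Arr C" "Dom C h = Dom C a" "Cod C h = Dom C k" "k \<cdot> h = a"
proof -
  have "\<exists>!h. h \<in> Hom C (Dom C a) (Dom C k) \<and> k \<cdot> h = a"
    using assms unfolding is_kernel_def by blast
  then show ?thesis using that by (auto simp: in_Hom_iff)
qed

lemma kernel_mono:
  assumes "is_kernel C f k"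
  shows "k \<in> monomorphisms C"
proof (rule monoI)
  note [simp] = kernel_arrs[OF assms]
  show "k \<in> Arr C" by simp
  fix g h assume *: "g \<in> Arr C" "h \<in> Arr C" "Dom C g = Dom C h" "Cod C g = Dom C k"
    "Cod C h = Dom C k" "k \<cdot> g = k \<cdot> h"
  have "zero_arrow C ((f \<cdot> k) \<cdot> h)"
    by (rule zero_Comp[OF kernel_zero[OF assms]]) (use * in simp_all)
  then have "k \<cdot> h \<in> Arr C" "Cod C (k \<cdot> h) = Dom C f" "zero_arrow C (f \<cdot> (k \<cdot> h))"
    using * by simp_all
  then have "\<exists>!u. u \<in> Hom C (Dom C (k \<cdot> h)) (Dom C k) \<and> k \<cdot> u = k \<cdot> h"
    using assms unfolding is_kernel_def by blast
  then show "g = h" using * by (auto simp: in_Hom_iff)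
qed

lemma kernel_cong:
  assumes "is_kernel C f k" "f' \<in> Arr C" "Dom C f' = Dom C f"
    "\<And>a. a \<in> Arr C \<Longrightarrow> Cod C a = Dom C f \<Longrightarrow> zero_arrow C (f' \<cdot> a) \<longleftrightarrow> zero_arrow C (f \<cdot> a)"
  shows "is_kernel C f' k"
proof -
  note k = kernel_arrs[OF assms(1)]
  have "zero_arrow C (f' \<cdot> k)" using assms(4)[OF k(2,3)] kernel_zero[OF assms(1)] by simp
  then show ?thesis
    using assms unfolding is_kernel_def by (metis (mono_tags, lifting))
qed

lemmas cokernel_arrs = category.kernel_arrs[OF category_op[OF category_axioms], simplified]
  and cokernel_zero = category.kernel_zero[OF category_op[OF category_axioms], simplified]
  and cokernelE = category.kernelE[OF category_op[OF category_axioms], simplified]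
  and cokernel_epi = category.kernel_mono[OF category_op[OF category_axioms], simplified]

end

text \<open>
  The self-dual part of the axioms of an abelian category that suffices for subobjects; the group
  structure on the hom-sets enters only through the last two conditions.
\<close>

locale puppe_exact = category +
  assumes zero_object_ex: "\<exists>Z. zero_object C Z"
    and kernel_ex: "f \<in> Arr C \<Longrightarrow> \<exists>k. is_kernel C f k"
    and cokernel_ex: "f \<in> Arr C \<Longrightarrow> \<exists>c. is_cokernel C f c"
    and mono_is_kernel: "m \<in> monomorphisms C \<Longrightarrow> \<exists>f. is_kernel C f m"
    and epi_is_cokernel: "e \<in> epimorphisms C \<Longrightarrow> \<exists>f. is_cokernel C f e"
    and mono_if_zero_cancel: "m \<in> Arr C \<Longrightarrow>
      (\<And>a. a \<in> Arr C \<Longrightarrow> Cod C a = Dom C m \<Longrightarrow> zero_arrow C (m \<cdot> a) \<Longrightarrow> zero_arrow C a) \<Longrightarrow>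
      m \<in> monomorphisms C"
    and epi_if_zero_cancel: "e \<in> Arr C \<Longrightarrow>
      (\<And>a. a \<in> Arr C \<Longrightarrow> Dom C a = Cod C e \<Longrightarrow> zero_arrow C (a \<cdot> e) \<Longrightarrow> zero_arrow C a) \<Longrightarrow>
      e \<in> epimorphisms C"

lemma puppe_exact_op: "puppe_exact C \<Longrightarrow> puppe_exact (op_cat C)"
  unfolding puppe_exact_def puppe_exact_axioms_def by (auto intro: category_op)

text \<open>If \<open>m\<close> equalizes \<open>f\<close> and \<open>g\<close>, it annihilates
  their difference. What has to be bridged is that zero arrows, defined through zero objects, are
  the neutral elements of the hom-groups.\<close>

lemma preadditive_mono_if_zero_cancel:
  assumes "preadditive C P" and Z: "zero_object C Z" and m: "m \<in> Arr C"
    and zero: "\<And>a. a \<in> Arr C \<Longrightarrow> Cod C a = Dom C m \<Longrightarrow> zero_arrow C (m \<cdot>\<^bsub>C\<^esub> a) \<Longrightarrow> zero_arrow C a"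
  shows "m \<in> monomorphisms C"
proof -
  interpret category C using assms(1) unfolding preadditive_def by blast
  have grp: "carrier (P X Y) = Hom C X Y" "comm_group (P X Y)" if "X \<in> Obj C" "Y \<in> Obj C" for X Y
    using assms(1) that unfolding preadditive_def by blast+
  have distl: "h \<cdot>\<^bsub>C\<^esub> (f \<otimes>\<^bsub>P X Y\<^esub> g) = (h \<cdot>\<^bsub>C\<^esub> f) \<otimes>\<^bsub>P X W\<^esub> (h \<cdot>\<^bsub>C\<^esub> g)"
    if "X \<in> Obj C" "Y \<in> Obj C" "W \<in> Obj C" "f \<in> Hom C X Y" "g \<in> Hom C X Y" "h \<in> Hom C Y W"
    for X Y W f g h
    using assms(1) that unfolding preadditive_def by blast
  have distr: "(g \<otimes>\<^bsub>P Y W\<^esub> h) \<cdot>\<^bsub>C\<^esub> f = (g \<cdot>\<^bsub>C\<^esub> f) \<otimes>\<^bsub>P X W\<^esub> (h \<cdot>\<^bsub>C\<^esub> f)"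
    if "X \<in> Obj C" "Y \<in> Obj C" "W \<in> Obj C" "f \<in> Hom C X Y" "g \<in> Hom C Y W" "h \<in> Hom C Y W"
    for X Y W f g h
    using assms(1) that unfolding preadditive_def by blast
  \<comment> \<open>Only one arrow goes from \<open>X\<close> into the zero object, so adding
    \<open>f\<close> to itself gives \<open>f\<close>. Composition with \<open>g\<close> makes
    \<open>g \<cdot> f\<close> idempotent in its group, hence neutral.\<close>
  have one: "zero_arrow C \<one>\<^bsub>P X Y\<^esub>" if XY: "X \<in> Obj C" "Y \<in> Obj C" for X Y
  proof -
    obtain f where f: "f \<in> Arr C" "Dom C f = X" "Cod C f = Z" using zero_object_arr[OF Z XY(1)] by metis
    obtain g where g: "g \<in> Arr C" "Dom C g = Z" "Cod C g = Y" using zero_object_arr[OF Z XY(2)] by metis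
    have ZO: "Z \<in> Obj C" using Z unfolding zero_object_def by blast
    interpret XZ: comm_group "P X Z" using grp XY ZO by blast
    interpret XYg: comm_group "P X Y" using grp XY by blast
    have fg: "f \<in> Hom C X Z" "g \<in> Hom C Z Y" using f g by (auto simp: in_Hom_iff)
    have "f \<otimes>\<^bsub>P X Z\<^esub> f \<in> Hom C X Z" using XZ.m_closed fg grp XY ZO by simp
    then have "f \<otimes>\<^bsub>P X Z\<^esub> f = f"
      by (intro zero_objectD(2)[OF Z]) (use f in \<open>simp_all add: in_Hom_iff\<close>)
    then have "g \<cdot>\<^bsub>C\<^esub> f = (g \<cdot>\<^bsub>C\<^esub> f) \<otimes>\<^bsub>P X Y\<^esub> (g \<cdot>\<^bsub>C\<^esub> f)"
      using distl[OF XY(1) ZO XY(2) fg(1,1,2)] by simp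
    moreover have "g \<cdot>\<^bsub>C\<^esub> f \<in> carrier (P X Y)" using grp XY f g by (auto simp: in_Hom_iff)
    ultimately have "g \<cdot>\<^bsub>C\<^esub> f = \<one>\<^bsub>P X Y\<^esub>" by (metis XYg.l_cancel_one')
    then show ?thesis using zero_arrowI[OF Z, of f g] f g by simp
  qed
  show ?thesis
  proof (rule monoI[OF m])
    fix f g assume *: "f \<in> Arr C" "g \<in> Arr C" "Dom C f = Dom C g" "Cod C f = Dom C m"
      "Cod C g = Dom C m" "m \<cdot>\<^bsub>C\<^esub> f = m \<cdot>\<^bsub>C\<^esub> g"
    let ?X = "Dom C f" and ?Y = "Dom C m" and ?W = "Cod C m"
    have O: "?X \<in> Obj C" "?Y \<in> Obj C" "?W \<in> Obj C" using * m by auto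
    interpret XY: comm_group "P ?X ?Y" using grp O by blast
    interpret XW: comm_group "P ?X ?W" using grp O by blast
    have fg: "f \<in> carrier (P ?X ?Y)" "g \<in> carrier (P ?X ?Y)"
      using grp O * by (auto simp: in_Hom_iff)
    \<comment> \<open>The difference of \<open>f\<close> and \<open>g\<close>, in multiplicative
      notation.\<close>
    define d where "d = f \<otimes>\<^bsub>P ?X ?Y\<^esub> inv\<^bsub>P ?X ?Y\<^esub> g"
    have d: "d \<in> carrier (P ?X ?Y)" using fg unfolding d_def by simp
    have mH: "m \<in> Hom C ?Y ?W" using m by (simp add: in_Hom_iff)
    have H: "x \<in> Hom C ?X ?Y" if "x \<in> carrier (P ?X ?Y)" for x using that grp O by blast
    have mg: "m \<cdot>\<^bsub>C\<^esub> g \<in> carrier (P ?X ?W)" using * m grp O by (auto simp: in_Hom_iff)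
    have "f = d \<otimes>\<^bsub>P ?X ?Y\<^esub> g" using fg unfolding d_def by (simp add: XY.m_assoc)
    then have "m \<cdot>\<^bsub>C\<^esub> g = (m \<cdot>\<^bsub>C\<^esub> d) \<otimes>\<^bsub>P ?X ?W\<^esub> (m \<cdot>\<^bsub>C\<^esub> g)"
      using distl[OF O H[OF d] H[OF fg(2)] mH] *(6) by metis
    moreover have "m \<cdot>\<^bsub>C\<^esub> d \<in> carrier (P ?X ?W)"
      using H[OF d] m grp O by (auto simp: in_Hom_iff)
    ultimately have "m \<cdot>\<^bsub>C\<^esub> d = \<one>\<^bsub>P ?X ?W\<^esub>" using mg by (metis XW.r_cancel_one')
    then have "zero_arrow C d" using zero[of d] one[OF O(1,3)] H[OF d] by (auto simp: in_Hom_iff)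
    then have "d = \<one>\<^bsub>P ?X ?Y\<^esub>"
      by (rule zero_eq[OF _ one[OF O(1,2)]]) (use H[OF d] H[OF XY.one_closed] in \<open>auto simp: in_Hom_iff\<close>)
    then show "f = g" using fg \<open>f = d \<otimes>\<^bsub>P ?X ?Y\<^esub> g\<close> by simp
  qed
qed

lemma preadditive_op: "preadditive C P \<Longrightarrow> preadditive (op_cat C) (\<lambda>X Y. P Y X)"
  unfolding preadditive_def by (simp add: category_op)

lemma abelian_puppe_exact:
  assumes "abelian C"
  shows "puppe_exact C"
proof -
  obtain P Z where P: "preadditive C P" and Z: "zero_object C Z"
    using assms unfolding abelian_def by blast
  have "m \<in> monomorphisms C" if "m \<in> Arr C"
    "\<And>a. a \<in> Arr C \<Longrightarrow> Cod C a = Dom C m \<Longrightarrow> zero_arrow C (m \<cdot>\<^bsub>C\<^esub> a) \<Longrightarrow> zero_arrow C a" for m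
    using preadditive_mono_if_zero_cancel[OF P Z that] .
  moreover have "m \<in> epimorphisms C" if "m \<in> Arr C"
    "\<And>a. a \<in> Arr C \<Longrightarrow> Dom C a = Cod C m \<Longrightarrow> zero_arrow C (a \<cdot>\<^bsub>C\<^esub> m) \<Longrightarrow> zero_arrow C a" for m
    using preadditive_mono_if_zero_cancel[OF preadditive_op[OF P], of Z m] Z that by simp
  moreover have "category C" using P unfolding preadditive_def by blast
  ultimately show ?thesis
    using assms unfolding abelian_def puppe_exact_def puppe_exact_axioms_def by blast
qed

section \<open>Factorization, orthogonality and stability of epimorphisms\<close>

context puppe_exact
begin

lemma mono_zero:
  assumes "m \<in> monomorphisms C" "a \<in> Arr C" "Cod C a = Dom C m" "zero_arrow C (m \<cdot> a)"
  shows "zero_arrow C a"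
proof -
  note [simp] = mono_arr[OF assms(1)]
  obtain Z where Z: "zero_object C Z" using zero_object_ex by blast
  obtain z where z: "zero_arrow C z" "z \<in> Arr C" "Dom C z = Dom C a" "Cod C z = Cod C a"
    using zero_arrow_ex[OF Z Dom_in_Obj Cod_in_Obj] assms by metis
  have "m \<cdot> a = m \<cdot> z"
    by (rule zero_eq[OF assms(4) Comp_zero]) (use assms z in simp_all)
  then have "a = z" by - (rule monoD[OF assms(1)], use assms z in simp_all)
  then show ?thesis using z by simp
qed

text \<open>\<open>m\<close> is a kernel of some \<open>f\<close>, and \<open>f\<close> factors
  through the cokernel \<open>c\<close>. So \<open>c\<close> annihilates no more than
  \<open>f\<close> does; conversely an arrow annihilated by \<open>f\<close> factors through
  \<open>m\<close>, which \<open>c\<close> annihilates.\<close>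

lemma mono_kernel_of_cokernel:
  assumes m: "m \<in> monomorphisms C" and c: "is_cokernel C m c"
  shows "is_kernel C c m"
proof -
  obtain f where f: "is_kernel C f m" using mono_is_kernel[OF m] by blast
  note [simp] = kernel_arrs[OF f] cokernel_arrs[OF c]
  obtain h where h: "h \<in> Arr C" "Dom C h = Cod C c" "Cod C h = Cod C f" "h \<cdot> c = f"
    using cokernelE[OF c kernel_arrs(1)[OF f] _ kernel_zero[OF f]] by auto
  show ?thesis
  proof (rule kernel_cong[OF f])
    fix a assume a: "a \<in> Arr C" "Cod C a = Dom C f"
    show "zero_arrow C (c \<cdot> a) \<longleftrightarrow> zero_arrow C (f \<cdot> a)"
    proof
      assume "zero_arrow C (c \<cdot> a)"
      then have "zero_arrow C (h \<cdot> (c \<cdot> a))" by (rule Comp_zero) (use a h in simp_all)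
      moreover have "h \<cdot> (c \<cdot> a) = f \<cdot> a"
        by (rule assoc_eq1[OF h(4)]) (use a h(1-3) in simp_all)
      ultimately show "zero_arrow C (f \<cdot> a)" by simp
    next
      assume "zero_arrow C (f \<cdot> a)"
      then obtain b where b: "b \<in> Arr C" "Dom C b = Dom C a" "Cod C b = Dom C m" "m \<cdot> b = a"
        using kernelE[OF f a] by metis
      have "zero_arrow C ((c \<cdot> m) \<cdot> b)"
        by (rule zero_Comp[OF cokernel_zero[OF c]]) (use b in simp_all)
      then show "zero_arrow C (c \<cdot> a)" using b by simp
    qed
  qed simp_all
qed

lemmas epi_zero = puppe_exact.mono_zero[OF puppe_exact_op[OF puppe_exact_axioms], simplified]
  and epi_cokernel_of_kernel =
    puppe_exact.mono_kernel_of_cokernel[OF puppe_exact_op[OF puppe_exact_axioms], simplified]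

text \<open>\<open>m\<close> is the kernel of the cokernel \<open>c\<close> of \<open>f\<close>. To
  see that \<open>e\<close> is epic, let \<open>t\<close> annihilate \<open>e\<close> and let
  \<open>k\<close> be the kernel of \<open>t\<close>. Then \<open>f\<close> factors through
  \<open>m \<cdot> k\<close>, a kernel of some \<open>g\<close>. As \<open>g\<close> annihilates
  \<open>f\<close>, it factors through \<open>c\<close> and so annihilates \<open>m\<close>. Hence
  \<open>m\<close> factors through \<open>m \<cdot> k\<close>, which splits \<open>k\<close> and
  makes \<open>t\<close> zero.\<close>

lemma factorE:
  assumes "f \<in> Arr C"
  obtains e m where "e \<in> epimorphisms C" "m \<in> monomorphisms C" "e \<in> Arr C" "m \<in> Arr C"
    "Dom C e = Dom C f" "Dom C m = Cod C e" "Cod C m = Cod C f" "m \<cdot> e = f"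
proof -
  obtain c where c: "is_cokernel C f c" using cokernel_ex[OF assms] by blast
  obtain m where m: "is_kernel C c m" using kernel_ex cokernel_arrs[OF c] by blast
  note [simp] = cokernel_arrs[OF c] kernel_arrs[OF m]
  obtain e where e [simp]: "e \<in> Arr C" "Dom C e = Dom C f" "Cod C e = Dom C m" and me: "m \<cdot> e = f"
    using kernelE[OF m assms _ cokernel_zero[OF c]] by auto
  have "e \<in> epimorphisms C"
  proof (rule epi_if_zero_cancel)
    fix t assume t [simp]: "t \<in> Arr C" "Dom C t = Cod C e" and te: "zero_arrow C (t \<cdot> e)"
    obtain k where k: "is_kernel C t k" using kernel_ex[OF t(1)] by blast
    note [simp] = kernel_arrs[OF k]
    obtain e' where e' [simp]: "e' \<in> Arr C" "Dom C e' = Dom C e" "Cod C e' = Dom C k"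
      and ke: "k \<cdot> e' = e"
      using kernelE[OF k _ _ te] by auto
    have mk: "m \<cdot> k \<in> monomorphisms C"
      by (intro mono_Comp kernel_mono[OF k] kernel_mono[OF m]) simp
    then obtain g where g: "is_kernel C g (m \<cdot> k)" using mono_is_kernel by blast
    note [simp] = kernel_arrs(1)[OF g] kernel_arrs(3)[OF g, simplified, symmetric]
    have "zero_arrow C ((g \<cdot> (m \<cdot> k)) \<cdot> e')"
      by (rule zero_Comp[OF kernel_zero[OF g]]) simp_all
    then have "zero_arrow C (g \<cdot> f)" by (simp add: ke me)
    then obtain g' where g' [simp]: "g' \<in> Arr C" "Dom C g' = Cod C c" "Cod C g' = Cod C g"
      and gc: "g' \<cdot> c = g"
      using cokernelE[OF c, of g] by auto
    have "zero_arrow C (g' \<cdot> (c \<cdot> m))"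
      by (rule Comp_zero[OF kernel_zero[OF m]]) simp_all
    then have "zero_arrow C (g \<cdot> m)" by (simp add: assoc_eq1[OF gc])
    then obtain l where l [simp]: "l \<in> Arr C" "Dom C l = Dom C m" "Cod C l = Dom C k"
      and ml: "(m \<cdot> k) \<cdot> l = m"
      using kernelE[OF g, of m] by auto
    have "k \<cdot> l = Id C (Dom C m)"
      by (rule monoD[OF kernel_mono[OF m]]) (use ml in simp_all)
    moreover have "zero_arrow C ((t \<cdot> k) \<cdot> l)"
      by (rule zero_Comp[OF kernel_zero[OF k]]) simp_all
    ultimately show "zero_arrow C t" by simp
  qed simp
  then show ?thesis using that kernel_mono[OF m] me by simp
qed

text \<open>The epimorphism \<open>e\<close> is the cokernel of its kernel \<open>k\<close>. By the
  square, \<open>m \<cdot> (u \<cdot> k)\<close> is zero; \<open>m\<close> is monic, so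
  \<open>u\<close> annihilates \<open>k\<close> and factors through \<open>e\<close>.\<close>

lemma orthogonal_epi_mono:
  assumes e: "e \<in> epimorphisms C" and m: "m \<in> monomorphisms C"
  shows "orthogonal C e m"
  unfolding orthogonal_def
proof (intro ballI impI)
  note [simp] = epi_arr[OF e] mono_arr[OF m]
  fix u v assume u: "u \<in> Hom C (Dom C e) (Dom C m)" and v: "v \<in> Hom C (Cod C e) (Cod C m)"
    and sq: "m \<cdot> u = v \<cdot> e"
  have [simp]: "u \<in> Arr C" "Dom C u = Dom C e" "Cod C u = Dom C m"
    "v \<in> Arr C" "Dom C v = Cod C e" "Cod C v = Cod C m"
    using u v by (auto simp: in_Hom_iff)
  obtain k where k: "is_kernel C e k" using kernel_ex[OF epi_arr[OF e]] by blast
  note [simp] = kernel_arrs[OF k]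
  have "zero_arrow C (v \<cdot> (e \<cdot> k))"
    by (rule Comp_zero[OF kernel_zero[OF k]]) simp_all
  then have "zero_arrow C (m \<cdot> (u \<cdot> k))" by (simp add: assoc_eq[OF sq])
  then have "zero_arrow C (u \<cdot> k)" by - (rule mono_zero[OF m], simp_all)
  then obtain d where d [simp]: "d \<in> Arr C" "Dom C d = Cod C e" "Cod C d = Dom C m" and de: "d \<cdot> e = u"
    using cokernelE[OF epi_cokernel_of_kernel[OF e k], of u] by auto
  have "m \<cdot> d = v" by (rule epiD[OF e]) (use de sq in simp_all)
  then show "\<exists>!d. d \<in> Hom C (Cod C e) (Dom C m) \<and> d \<cdot> e = u \<and> m \<cdot> d = v"
    by (intro ex1I[of _ d]) (use de in \<open>auto simp: in_Hom_iff intro!: monoD[OF m]\<close>)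
qed

lemma proper_factorization_system_epi_mono:
  "proper_factorization_system C (epimorphisms C) (monomorphisms C)"
  unfolding proper_factorization_system_def factorization_system_def comp_closed_def
proof (intro conjI ballI impI subset_refl subsetI)
  fix f assume "f \<in> Arr C"
  then show "\<exists>e\<in>epimorphisms C. \<exists>m\<in>monomorphisms C. Dom C m = Cod C e \<and> f = m \<cdot> e"
    by (rule factorE) metis
qed (auto intro: epi_arr mono_arr iso_epi iso_mono epi_Comp mono_Comp orthogonal_epi_mono)

text \<open>Since \<open>n\<close> is the kernel of \<open>c\<close>, an arrow
  \<open>f \<cdot> a\<close> factors through \<open>n\<close> exactly when \<open>c\<close>
  annihilates it. The description of \<open>p\<close> as a kernel is kept for the stability of
  epimorphisms.\<close>

lemma pullback_along_mono_ex:
  assumes n: "n \<in> monomorphisms C" and f: "f \<in> Arr C" "Cod C f = Cod C n"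
    and c: "is_cokernel C n c"
  shows "\<exists>p q. is_pullback C f n p q \<and> is_kernel C (c \<cdot> f) p"
proof -
  note [simp] = f mono_arr[OF n] cokernel_arrs[OF c]
  have nc: "is_kernel C c n" using mono_kernel_of_cokernel[OF n c] .
  obtain p where p: "is_kernel C (c \<cdot> f) p" using kernel_ex[of "c \<cdot> f"] by auto
  note [simp] = kernel_arrs(2,3)[OF p, simplified]
  obtain q where q [simp]: "q \<in> Arr C" "Dom C q = Dom C p" "Cod C q = Dom C n" and nq: "n \<cdot> q = f \<cdot> p"
    using kernelE[OF nc, of "f \<cdot> p"] kernel_zero[OF p] by auto
  have "\<exists>!h. h \<in> Hom C W (Dom C p) \<and> p \<cdot> h = a \<and> q \<cdot> h = b"
    if a: "a \<in> Hom C W (Dom C f)" and b: "b \<in> Hom C W (Dom C n)" and ab: "f \<cdot> a = n \<cdot> b" for W a b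
  proof -
    have [simp]: "a \<in> Arr C" "Dom C a = W" "Cod C a = Dom C f"
      "b \<in> Arr C" "Dom C b = W" "Cod C b = Dom C n" using a b by (auto simp: in_Hom_iff)
    have "zero_arrow C ((c \<cdot> n) \<cdot> b)" by (rule zero_Comp[OF cokernel_zero[OF c]]) simp_all
    then have "zero_arrow C ((c \<cdot> f) \<cdot> a)" by (simp add: ab)
    then obtain h where h [simp]: "h \<in> Arr C" "Dom C h = W" "Cod C h = Dom C p" and ph: "p \<cdot> h = a"
      using kernelE[OF p, of a] by auto
    have "q \<cdot> h = b"
      by (rule monoD[OF n]) (simp_all add: assoc_eq[OF nq] ph ab)
    then show ?thesis
      by (intro ex1I[of _ h]) (use ph in \<open>auto simp: in_Hom_iff intro!: monoD[OF kernel_mono[OF p]]\<close>)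
  qed
  then have "is_pullback C f n p q"
    unfolding is_pullback_def using nq by simp
  then show ?thesis using p by blast
qed

lemma pullback_ex:
  assumes "n \<in> monomorphisms C" "f \<in> Arr C" "Cod C f = Cod C n"
  shows "\<exists>p q. is_pullback C f n p q"
  using pullback_along_mono_ex[OF assms] cokernel_ex[OF mono_arr[OF assms(1)]] by blast

lemmas pushout_ex = puppe_exact.pullback_ex[OF puppe_exact_op[OF puppe_exact_axioms], simplified]

text \<open>Let \<open>m\<close> be the image of \<open>q\<close>; the aim is that \<open>n\<close>
  factors through \<open>n \<cdot> m\<close>, that is, that the cokernel \<open>d\<close> of
  \<open>n \<cdot> m\<close> annihilates \<open>n\<close>. The epimorphism
  \<open>c \<cdot> e\<close> has kernel \<open>p\<close>, so it is the cokernel of \<open>p\<close>.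
  As \<open>d \<cdot> e\<close> annihilates \<open>p\<close>, it factors through
  \<open>c \<cdot> e\<close>; cancelling \<open>e\<close> shows that \<open>d\<close> factors
  through \<open>c\<close>, which annihilates \<open>n\<close>.\<close>

lemma pullback_epi_along_mono:
  assumes e: "e \<in> epimorphisms C" and n: "n \<in> monomorphisms C" and "Cod C e = Cod C n"
  obtains p q where "p \<in> Arr C" "q \<in> epimorphisms C" "Cod C p = Dom C e" "Cod C q = Dom C n"
    "Dom C p = Dom C q" "e \<cdot> p = n \<cdot> q"
proof -
  note [simp] = epi_arr[OF e] mono_arr[OF n] assms(3)
  obtain c where c: "is_cokernel C n c" using cokernel_ex[OF mono_arr[OF n]] by blast
  note [simp] = cokernel_arrs[OF c]
  obtain p q where pb: "is_pullback C e n p q" and p: "is_kernel C (c \<cdot> e) p"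
    using pullback_along_mono_ex[OF n _ _ c, of e] by auto
  note [simp] = pullback_arrs[OF pb]
  note sq = pullback_comm[OF pb]
  have "q \<in> Arr C" by simp
  then obtain q' m where q' [simp]: "q' \<in> epimorphisms C" "q' \<in> Arr C" "Dom C q' = Dom C q"
    and m: "m \<in> monomorphisms C" and m' [simp]: "m \<in> Arr C" "Dom C m = Cod C q'" "Cod C m = Cod C q"
    and mq: "m \<cdot> q' = q"
    by (rule factorE)
  have nm: "n \<cdot> m \<in> monomorphisms C" by (intro mono_Comp n m) simp
  obtain d where d: "is_cokernel C (n \<cdot> m) d" using cokernel_ex[of "n \<cdot> m"] by auto
  note [simp] = cokernel_arrs(2,3)[OF d, simplified]
  have "zero_arrow C ((d \<cdot> (n \<cdot> m)) \<cdot> q')"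
    by (rule zero_Comp[OF cokernel_zero[OF d]]) simp_all
  then have "zero_arrow C ((d \<cdot> e) \<cdot> p)" by (simp add: mq sq)
  moreover have "is_cokernel C p (c \<cdot> e)"
    by (rule epi_cokernel_of_kernel[OF epi_Comp p]) (use e cokernel_epi[OF c] in simp_all)
  ultimately obtain u where u [simp]: "u \<in> Arr C" "Dom C u = Cod C c" "Cod C u = Cod C d"
    and ue: "u \<cdot> (c \<cdot> e) = d \<cdot> e"
    using cokernelE[of p "c \<cdot> e" "d \<cdot> e"] by auto
  have uc: "u \<cdot> c = d" by (rule epiD[OF e]) (use ue in simp_all)
  have "zero_arrow C (u \<cdot> (c \<cdot> n))" by (rule Comp_zero[OF cokernel_zero[OF c]]) simp_all
  then have "zero_arrow C (d \<cdot> n)" by (simp add: assoc_eq1[OF uc])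
  then obtain w where w [simp]: "w \<in> Arr C" "Dom C w = Dom C n" "Cod C w = Dom C m"
    and nw: "(n \<cdot> m) \<cdot> w = n"
    using kernelE[OF mono_kernel_of_cokernel[OF nm d], of n] by auto
  have "m \<cdot> w = Id C (Dom C n)" by (rule monoD[OF n]) (use nw in simp_all)
  then have "m \<in> isomorphisms C" by (intro mono_split_epi_iso[OF m, of w]) simp_all
  then have "q \<in> epimorphisms C" using epi_Comp[of m q'] iso_epi[of m] mq by simp
  then show ?thesis by - (rule that[of p q], use sq in simp_all)
qed

lemmas pushout_mono_along_epi =
  puppe_exact.pullback_epi_along_mono[OF puppe_exact_op[OF puppe_exact_axioms], simplified]

end

section \<open>Subobjects as annihilator sieves\<close>

text \<open>
  A subobject is represented by the sieve of all arrows that factor through it; in an exact category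
  this is the set of arrows annihilated by its cokernel. Sieves are canonical, so that the fibres
  are honest posets under inclusion and inverse images are strictly functorial.
\<close>

definition arrows_into :: "('o, 'm) cat \<Rightarrow> 'o \<Rightarrow> 'm set" where
  "arrows_into C X = {f \<in> Arr C. Cod C f = X}"

definition annihilator :: "('o, 'm) cat \<Rightarrow> 'm \<Rightarrow> 'm set" where
  "annihilator C c = {f \<in> arrows_into C (Dom C c). zero_arrow C (c \<cdot>\<^bsub>C\<^esub> f)}"

definition sieve :: "('o, 'm) cat \<Rightarrow> 'm \<Rightarrow> 'm set" where
  "sieve C m = (\<lambda>h. m \<cdot>\<^bsub>C\<^esub> h) ` arrows_into C (Dom C m)"

definition clusters :: "('o, 'm) cat \<Rightarrow> 'o \<Rightarrow> 'm set set" where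
  "clusters C X = annihilator C ` {c \<in> Arr C. Dom C c = X}"

text \<open>The double annihilator, the closure operator of the Galois connection between arrows
  into \<open>X\<close> and arrows out of \<open>X\<close>. It yields images and joins without a
  choice of cokernels or pushouts.\<close>

definition hull :: "('o, 'm) cat \<Rightarrow> 'o \<Rightarrow> 'm set \<Rightarrow> 'm set" where
  "hull C X A = {g \<in> arrows_into C X. \<forall>t\<in>Arr C. Dom C t = X \<longrightarrow>
     (\<forall>s\<in>A. zero_arrow C (t \<cdot>\<^bsub>C\<^esub> s)) \<longrightarrow> zero_arrow C (t \<cdot>\<^bsub>C\<^esub> g)}"

definition direct_image :: "('o, 'm) cat \<Rightarrow> 'm \<Rightarrow> 'm set \<Rightarrow> 'm set" where
  "direct_image C f S = hull C (Cod C f) ((\<lambda>s. f \<cdot>\<^bsub>C\<^esub> s) ` S)"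

definition inverse_image :: "('o, 'm) cat \<Rightarrow> 'm \<Rightarrow> 'm set \<Rightarrow> 'm set" where
  "inverse_image C f T = {g \<in> arrows_into C (Dom C f). f \<cdot>\<^bsub>C\<^esub> g \<in> T}"

lemma arrows_into_iff: "f \<in> arrows_into C X \<longleftrightarrow> f \<in> Arr C \<and> Cod C f = X"
  by (simp add: arrows_into_def)

context puppe_exact
begin

section \<open>Clusters as annihilators and as sieves\<close>

lemma annihilator_iff:
  "g \<in> annihilator C c \<longleftrightarrow> g \<in> Arr C \<and> Cod C g = Dom C c \<and> zero_arrow C (c \<cdot> g)"
  by (auto simp: annihilator_def arrows_into_iff)

lemma sieve_iff:
  "g \<in> sieve C m \<longleftrightarrow> (\<exists>h. h \<in> Arr C \<and> Cod C h = Dom C m \<and> g = m \<cdot> h)"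
  by (auto simp: sieve_def arrows_into_iff)

lemma annihilator_in_clusters: "c \<in> Arr C \<Longrightarrow> Dom C c = X \<Longrightarrow> annihilator C c \<in> clusters C X"
  by (auto simp: clusters_def)

lemma clusters_into: "S \<in> clusters C X \<Longrightarrow> g \<in> S \<Longrightarrow> g \<in> Arr C \<and> Cod C g = X"
  by (auto simp: clusters_def annihilator_iff)

lemma clusters_subset: "S \<in> clusters C X \<Longrightarrow> S \<subseteq> arrows_into C X"
  using clusters_into by (auto simp: arrows_into_iff)

lemma annihilator_mono_Comp:
  assumes m: "m \<in> monomorphisms C" and e: "e \<in> Arr C" "Dom C m = Cod C e"
  shows "annihilator C (m \<cdot> e) = annihilator C e"
proof -
  have "zero_arrow C (m \<cdot> (e \<cdot> g)) \<longleftrightarrow> zero_arrow C (e \<cdot> g)"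
    if "g \<in> Arr C" "Cod C g = Dom C e" for g
    using that e mono_arr[OF m] mono_zero[OF m, of "e \<cdot> g"] Comp_zero[of "e \<cdot> g" m] by auto
  then show ?thesis
    using e mono_arr[OF m] by (auto simp: annihilator_iff)
qed

lemma clusters_epiE:
  assumes "S \<in> clusters C X"
  obtains c where "c \<in> epimorphisms C" "c \<in> Arr C" "Dom C c = X" "S = annihilator C c"
proof -
  obtain c where c: "c \<in> Arr C" "Dom C c = X" "S = annihilator C c"
    using assms by (auto simp: clusters_def)
  obtain e m where "e \<in> epimorphisms C" "m \<in> monomorphisms C" "e \<in> Arr C" "Dom C e = Dom C c"
    "Dom C m = Cod C e" "m \<cdot> e = c"
    using factorE[OF c(1)] by metis
  then show ?thesis using that annihilator_mono_Comp[of m e] c by metis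
qed

text \<open>Translates between the two descriptions of a cluster: annihilators of epimorphisms suit
  joins and pushouts, sieves of monomorphisms suit meets and pullbacks.\<close>

lemma sieve_kernel:
  assumes k: "is_kernel C c k"
  shows "sieve C k = annihilator C c"
proof (intro Set.set_eqI iffI)
  note [simp] = kernel_arrs[OF k]
  fix g
  {
    assume "g \<in> sieve C k"
    then obtain h where h: "h \<in> Arr C" "Cod C h = Dom C k" "g = k \<cdot> h" by (auto simp: sieve_iff)
    have "zero_arrow C ((c \<cdot> k) \<cdot> h)" by (rule zero_Comp[OF kernel_zero[OF k]]) (use h in simp_all)
    then show "g \<in> annihilator C c" using h by (simp add: annihilator_iff)
  next
    assume "g \<in> annihilator C c"
    then show "g \<in> sieve C k" using kernelE[OF k, of g] by (auto simp: annihilator_iff sieve_iff)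
  }
qed

lemma sieve_mono:
  assumes "m \<in> monomorphisms C"
  obtains c where "is_cokernel C m c" "is_kernel C c m" "c \<in> Arr C" "Dom C c = Cod C m"
    "sieve C m = annihilator C c"
proof -
  obtain c where c: "is_cokernel C m c" using cokernel_ex[OF mono_arr[OF assms]] by blast
  show ?thesis
    using that[OF c] mono_kernel_of_cokernel[OF assms c] sieve_kernel cokernel_arrs[OF c] by blast
qed

lemma sieve_in_clusters: "m \<in> monomorphisms C \<Longrightarrow> Cod C m = X \<Longrightarrow> sieve C m \<in> clusters C X"
  by (erule sieve_mono) (simp add: annihilator_in_clusters)

lemma clusters_monoE:
  assumes "S \<in> clusters C X"
  obtains m where "m \<in> monomorphisms C" "m \<in> Arr C" "Cod C m = X" "S = sieve C m"
proof -
  obtain c where c: "c \<in> Arr C" "Dom C c = X" "S = annihilator C c"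
    using assms by (auto simp: clusters_def)
  obtain k where k: "is_kernel C c k" using kernel_ex[OF c(1)] by blast
  show ?thesis
    using that[OF kernel_mono[OF k]] kernel_arrs[OF k] sieve_kernel[OF k] c by simp
qed

lemma self_in_sieve: "m \<in> Arr C \<Longrightarrow> m \<in> sieve C m"
  by (auto simp: sieve_iff intro!: exI[of _ "Id C (Dom C m)"])

text \<open>The Yoneda argument: inclusion is tested on \<open>m\<close>, the generic element of its
  own sieve.\<close>

lemma sieve_le:
  assumes "m \<in> Arr C" "sieve C m \<subseteq> sieve C n" "n \<in> Arr C"
  obtains u where "u \<in> Arr C" "Dom C u = Dom C m" "Cod C u = Dom C n" "n \<cdot> u = m"
proof -
  have "m \<in> sieve C n" using assms self_in_sieve by blast
  then obtain u where "u \<in> Arr C" "Cod C u = Dom C n" "n \<cdot> u = m" by (auto simp: sieve_iff)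
  then show ?thesis using that[of u] dom_Comp[of u n] assms by simp
qed

text \<open>Inclusion is tested on the kernel of \<open>c\<close>: it is annihilated by
  \<open>t\<close>, and the epimorphism \<open>c\<close> is its cokernel.\<close>

lemma annihilator_le:
  assumes c: "c \<in> epimorphisms C" and t: "t \<in> Arr C" "Dom C t = Dom C c"
    and le: "annihilator C c \<subseteq> annihilator C t"
  obtains u where "u \<in> Arr C" "Dom C u = Cod C c" "Cod C u = Cod C t" "u \<cdot> c = t"
proof -
  obtain k where k: "is_kernel C c k" using kernel_ex[OF epi_arr[OF c]] by blast
  have "k \<in> annihilator C c" using kernel_arrs[OF k] kernel_zero[OF k] by (simp add: annihilator_iff)
  then have "zero_arrow C (t \<cdot> k)" using le by (auto simp: annihilator_iff)
  then show ?thesis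
    using cokernelE[OF epi_cokernel_of_kernel[OF c k], of t] kernel_arrs[OF k] t that by metis
qed

section \<open>Hulls, direct images and inverse images\<close>

lemma hull_le:
  assumes "A \<subseteq> T" "T \<in> clusters C X"
  shows "hull C X A \<subseteq> T"
proof -
  obtain c where c: "c \<in> Arr C" "Dom C c = X" "T = annihilator C c"
    using assms by (auto simp: clusters_def)
  have "\<forall>s\<in>A. zero_arrow C (c \<cdot> s)" using assms(1) c by (auto simp: annihilator_iff)
  then show ?thesis using c by (auto simp: hull_def arrows_into_iff annihilator_iff)
qed

lemma hull_increasing: "A \<subseteq> arrows_into C X \<Longrightarrow> A \<subseteq> hull C X A"
  unfolding hull_def by blast

text \<open>Replaces \<open>A\<close> by a single arrow \<open>a\<close> that is annihilated by the
  same arrows; through the cokernel of \<open>a\<close> the hull is seen to be a cluster.\<close>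

lemma hull_eq_annihilator:
  assumes c: "is_cokernel C a c" and X: "Cod C a = X"
    and A: "\<And>t. t \<in> Arr C \<Longrightarrow> Dom C t = X \<Longrightarrow> (\<forall>s\<in>A. zero_arrow C (t \<cdot> s)) \<longleftrightarrow> zero_arrow C (t \<cdot> a)"
  shows "hull C X A = annihilator C c"
proof (intro Set.set_eqI iffI)
  note [simp] = cokernel_arrs[OF c] X
  fix g
  {
    assume "g \<in> hull C X A"
    then show "g \<in> annihilator C c"
      using A[of c] cokernel_zero[OF c] by (auto simp: hull_def annihilator_iff arrows_into_iff)
  next
    assume g: "g \<in> annihilator C c"
    show "g \<in> hull C X A"
      unfolding hull_def
    proof (intro CollectI conjI ballI impI)
      show "g \<in> arrows_into C X" using g by (simp add: annihilator_iff arrows_into_iff)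
      fix t assume t: "t \<in> Arr C" "Dom C t = X" "\<forall>s\<in>A. zero_arrow C (t \<cdot> s)"
      then have "zero_arrow C (t \<cdot> a)" using A by blast
      then obtain u where u: "u \<in> Arr C" "Dom C u = Cod C c" "Cod C u = Cod C t" "u \<cdot> c = t"
        using cokernelE[OF c, of t] t by auto
      have "zero_arrow C (u \<cdot> (c \<cdot> g))"
        by (rule Comp_zero) (use g u in \<open>auto simp: annihilator_iff\<close>)
      then show "zero_arrow C (t \<cdot> g)"
        using assoc_eq1[OF u(4), of g] u g by (simp add: annihilator_iff)
    qed
  }
qed

lemma arrows_into_eq_sieve:
  assumes "X \<in> Obj C"
  shows "arrows_into C X = sieve C (Id C X)"
  using assms by (force simp: sieve_iff arrows_into_iff)

lemma arrows_into_in_clusters: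
  assumes "X \<in> Obj C"
  shows "arrows_into C X \<in> clusters C X"
proof -
  have "Id C X \<in> monomorphisms C"
    by (rule split_mono[of _ "Id C X"]) (use assms in simp_all)
  then show ?thesis using assms sieve_in_clusters[of "Id C X"] by (simp add: arrows_into_eq_sieve)
qed

text \<open>An identity annihilates exactly the zero arrows, which therefore form the bottom
  cluster.\<close>

lemma annihilator_Id_le:
  assumes "T \<in> clusters C X" "X \<in> Obj C"
  shows "annihilator C (Id C X) \<subseteq> T"
proof -
  obtain c where c: "c \<in> Arr C" "Dom C c = X" "T = annihilator C c"
    using assms by (auto simp: clusters_def)
  then show ?thesis using assms Comp_zero by (auto simp: annihilator_iff)
qed

lemma direct_image_sieve:
  assumes "f \<in> Arr C" "m \<in> Arr C" "Cod C m = Dom C f" "is_cokernel C (f \<cdot> m) c"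
  shows "direct_image C f (sieve C m) = annihilator C c"
  unfolding direct_image_def
proof (rule hull_eq_annihilator[OF assms(4)])
  fix t assume t: "t \<in> Arr C" "Dom C t = Cod C f"
  show "(\<forall>s\<in>(\<cdot>) f ` sieve C m. zero_arrow C (t \<cdot> s)) \<longleftrightarrow> zero_arrow C (t \<cdot> (f \<cdot> m))"
  proof
    assume "\<forall>s\<in>(\<cdot>) f ` sieve C m. zero_arrow C (t \<cdot> s)"
    then show "zero_arrow C (t \<cdot> (f \<cdot> m))" using self_in_sieve[OF assms(2)] by blast
  next
    assume z: "zero_arrow C (t \<cdot> (f \<cdot> m))"
    show "\<forall>s\<in>(\<cdot>) f ` sieve C m. zero_arrow C (t \<cdot> s)"
    proof
      fix s assume "s \<in> (\<cdot>) f ` sieve C m"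
      then obtain h where h: "h \<in> Arr C" "Cod C h = Dom C m" "s = f \<cdot> (m \<cdot> h)"
        by (auto simp: sieve_iff)
      have "zero_arrow C ((t \<cdot> (f \<cdot> m)) \<cdot> h)" by (rule zero_Comp[OF z]) (use assms t h in simp_all)
      then show "zero_arrow C (t \<cdot> s)" using assms t h by simp
    qed
  qed
qed (use assms in simp)

lemma direct_image_in_clusters:
  assumes "f \<in> Arr C" "S \<in> clusters C (Dom C f)"
  shows "direct_image C f S \<in> clusters C (Cod C f)"
proof -
  obtain m where m: "m \<in> Arr C" "Cod C m = Dom C f" "S = sieve C m"
    using clusters_monoE[OF assms(2)] by metis
  obtain c where c: "is_cokernel C (f \<cdot> m) c" using cokernel_ex[of "f \<cdot> m"] m assms by auto
  show ?thesis
    using direct_image_sieve[OF assms(1) m(1,2) c] cokernel_arrs[OF c] m assms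
    by (simp add: annihilator_in_clusters)
qed

text \<open>An arrow that annihilates \<open>m \<cdot> e\<close> annihilates \<open>m\<close>, as
  \<open>e\<close> is epic. So the image cluster of an arrow is the subobject in its epi-mono
  factorization.\<close>

lemma direct_image_arrows_into:
  assumes m: "m \<in> monomorphisms C" and e: "e \<in> epimorphisms C" and me: "Dom C m = Cod C e"
  shows "direct_image C (m \<cdot> e) (arrows_into C (Dom C e)) = sieve C m"
proof -
  note [simp] = mono_arr[OF m] epi_arr[OF e] me
  obtain c where c: "is_cokernel C m c" "sieve C m = annihilator C c"
    using sieve_mono[OF m] by metis
  have "hull C (Cod C (m \<cdot> e)) ((\<cdot>) (m \<cdot> e) ` arrows_into C (Dom C e)) = annihilator C c"
  proof (rule hull_eq_annihilator[OF c(1)])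
    fix t assume t: "t \<in> Arr C" "Dom C t = Cod C (m \<cdot> e)"
    show "(\<forall>s\<in>(\<cdot>) (m \<cdot> e) ` arrows_into C (Dom C e). zero_arrow C (t \<cdot> s)) \<longleftrightarrow> zero_arrow C (t \<cdot> m)"
    proof
      assume *: "\<forall>s\<in>(\<cdot>) (m \<cdot> e) ` arrows_into C (Dom C e). zero_arrow C (t \<cdot> s)"
      have "Id C (Dom C e) \<in> arrows_into C (Dom C e)" by (simp add: arrows_into_iff)
      then have "zero_arrow C (t \<cdot> ((m \<cdot> e) \<cdot> Id C (Dom C e)))" using * by blast
      then have "zero_arrow C ((t \<cdot> m) \<cdot> e)" using t by simp
      then show "zero_arrow C (t \<cdot> m)" by - (rule epi_zero[OF e], use t in simp_all)
    next
      assume z: "zero_arrow C (t \<cdot> m)"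
      have "zero_arrow C (t \<cdot> ((m \<cdot> e) \<cdot> h))" if h: "h \<in> Arr C" "Cod C h = Dom C e" for h
        using zero_Comp[OF z, of "e \<cdot> h"] h t by simp
      then show "\<forall>s\<in>(\<cdot>) (m \<cdot> e) ` arrows_into C (Dom C e). zero_arrow C (t \<cdot> s)"
        by (auto simp: arrows_into_iff)
    qed
  qed simp
  then show ?thesis using c(2) by (simp add: direct_image_def)
qed

lemma inverse_image_annihilator:
  assumes "f \<in> Arr C" "c \<in> Arr C" "Dom C c = Cod C f"
  shows "inverse_image C f (annihilator C c) = annihilator C (c \<cdot> f)"
  using assms by (auto simp: inverse_image_def annihilator_iff arrows_into_iff)

lemma inverse_image_in_clusters:
  assumes "f \<in> Arr C" "T \<in> clusters C (Cod C f)"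
  shows "inverse_image C f T \<in> clusters C (Dom C f)"
proof -
  obtain c where c: "c \<in> Arr C" "Dom C c = Cod C f" "T = annihilator C c"
    using assms by (auto simp: clusters_def)
  then show ?thesis using assms inverse_image_annihilator by (simp add: annihilator_in_clusters)
qed

lemma inverse_image_annihilator_Id:
  assumes "f \<in> Arr C"
  shows "inverse_image C f (annihilator C (Id C (Cod C f))) = annihilator C f"
  using assms by (simp add: inverse_image_annihilator)

lemma direct_image_inverse_adjoint:
  assumes f: "f \<in> Arr C" and S: "S \<in> clusters C (Dom C f)" and T: "T \<in> clusters C (Cod C f)"
  shows "direct_image C f S \<subseteq> T \<longleftrightarrow> S \<subseteq> inverse_image C f T"
proof -
  have "(\<cdot>) f ` S \<subseteq> arrows_into C (Cod C f)"
    using clusters_into[OF S] f by (auto simp: arrows_into_iff)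
  then have "direct_image C f S \<subseteq> T \<longleftrightarrow> (\<cdot>) f ` S \<subseteq> T"
    unfolding direct_image_def using hull_le[OF _ T] hull_increasing by blast
  then show ?thesis
    using clusters_into[OF S] by (auto simp: inverse_image_def arrows_into_iff)
qed

lemma direct_image_mono: "S \<subseteq> S' \<Longrightarrow> direct_image C f S \<subseteq> direct_image C f S'"
  unfolding direct_image_def hull_def by blast

lemma inverse_image_mono: "T \<subseteq> T' \<Longrightarrow> inverse_image C f T \<subseteq> inverse_image C f T'"
  unfolding inverse_image_def by blast

lemma inverse_image_Comp:
  assumes "f \<in> Arr C" "g \<in> Arr C" "Dom C g = Cod C f"
  shows "inverse_image C (g \<cdot> f) T = inverse_image C f (inverse_image C g T)"
  using assms by (auto simp: inverse_image_def arrows_into_iff)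

lemma inverse_image_Id:
  assumes "X \<in> Obj C" "T \<in> clusters C X"
  shows "inverse_image C (Id C X) T = T"
proof (rule Set.set_eqI)
  fix g
  show "g \<in> inverse_image C (Id C X) T \<longleftrightarrow> g \<in> T"
  proof (cases "g \<in> Arr C \<and> Cod C g = X")
    case True
    then show ?thesis using assms(1) by (simp add: inverse_image_def arrows_into_iff)
  next
    case False
    then show ?thesis
      using clusters_into[OF assms(2), of g] assms(1) by (auto simp: inverse_image_def arrows_into_iff)
  qed
qed

text \<open>Uniqueness of left adjoints: inverse images are strictly functorial, so both sides lie
  below the same clusters. This avoids composing hulls.\<close>

lemma direct_image_Comp:
  assumes fg: "f \<in> Arr C" "g \<in> Arr C" "Dom C g = Cod C f" and S: "S \<in> clusters C (Dom C f)"
  shows "direct_image C (g \<cdot> f) S = direct_image C g (direct_image C f S)"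
proof -
  have "direct_image C (g \<cdot> f) S \<subseteq> T \<longleftrightarrow> direct_image C g (direct_image C f S) \<subseteq> T" if "T \<in> clusters C (Cod C g)" for T
    using fg S that direct_image_inverse_adjoint[of "g \<cdot> f" S T] direct_image_inverse_adjoint[of f S "inverse_image C g T"]
      direct_image_inverse_adjoint[of g "direct_image C f S" T] direct_image_in_clusters[of f S] inverse_image_in_clusters[of g T]
    by (simp add: inverse_image_Comp)
  moreover have "direct_image C (g \<cdot> f) S \<in> clusters C (Cod C g)"
    using direct_image_in_clusters[of "g \<cdot> f" S] fg S by simp
  moreover have "direct_image C g (direct_image C f S) \<in> clusters C (Cod C g)"
    using direct_image_in_clusters[of g "direct_image C f S"] direct_image_in_clusters[of f S] fg S by simp
  ultimately show ?thesis by (metis subset_antisym subset_refl)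
qed

lemma direct_image_Id:
  assumes X: "X \<in> Obj C" and S: "S \<in> clusters C X"
  shows "direct_image C (Id C X) S = S"
proof -
  have "direct_image C (Id C X) S \<subseteq> T \<longleftrightarrow> S \<subseteq> T" if "T \<in> clusters C X" for T
    using direct_image_inverse_adjoint[of "Id C X" S T] X S that by (simp add: inverse_image_Id)
  then show ?thesis
    using direct_image_in_clusters[of "Id C X" S] X S by (metis arr_Id cod_Id dom_Id subset_antisym subset_refl)
qed

section \<open>Meets by pullbacks, joins by pushouts, and the modular law\<close>

lemma sieve_pullback:
  assumes pb: "is_pullback C m n p q"
  shows "sieve C m \<inter> sieve C n = sieve C (m \<cdot> p)"
proof (intro Set.set_eqI iffI)
  note [simp] = pullback_arrs[OF pb]
  fix g
  {
    assume "g \<in> sieve C m \<inter> sieve C n"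
    then obtain a b where a: "a \<in> Arr C" "Cod C a = Dom C m" "g = m \<cdot> a"
      and b: "b \<in> Arr C" "Cod C b = Dom C n" "g = n \<cdot> b" by (auto simp: sieve_iff)
    have "Dom C g = Dom C a" unfolding a(3) by (rule dom_Comp) (use a in simp_all)
    moreover have "Dom C g = Dom C b" unfolding b(3) by (rule dom_Comp) (use b in simp_all)
    ultimately have d: "Dom C a = Dom C b" by simp
    obtain h where "h \<in> Arr C" "Cod C h = Dom C p" "p \<cdot> h = a"
      using pullbackE[OF pb a(1) b(1) d a(2) b(2)] a(3) b(3) by metis
    then have "h \<in> Arr C" "Cod C h = Dom C (m \<cdot> p)" "g = (m \<cdot> p) \<cdot> h" using a by simp_all
    then show "g \<in> sieve C (m \<cdot> p)" unfolding sieve_iff by blast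
  next
    assume "g \<in> sieve C (m \<cdot> p)"
    then obtain h where h: "h \<in> Arr C" "Cod C h = Dom C p" "g = m \<cdot> (p \<cdot> h)" by (auto simp: sieve_iff)
    then have "g = n \<cdot> (q \<cdot> h)" using assoc_eq[OF pullback_comm[OF pb], of h] by simp
    moreover have "p \<cdot> h \<in> Arr C" "Cod C (p \<cdot> h) = Dom C m" "q \<cdot> h \<in> Arr C" "Cod C (q \<cdot> h) = Dom C n"
      using h by simp_all
    ultimately show "g \<in> sieve C m \<inter> sieve C n"
      unfolding sieve_iff Int_iff using h(3) by blast
  }
qed

text \<open>An arrow \<open>t\<close> that annihilates both clusters factors through
  \<open>c\<close> and through \<open>d\<close>, hence through the pushout. So it annihilates
  whatever \<open>p \<cdot> c\<close> annihilates.\<close>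

lemma annihilator_pushout:
  assumes c: "c \<in> epimorphisms C" and d: "d \<in> epimorphisms C" and po: "is_pushout C c d p q"
  shows "hull C (Dom C c) (annihilator C c \<union> annihilator C d) = annihilator C (p \<cdot> c)"
proof
  note [simp] = pushout_arrs[OF po]
  note sq = pushout_comm[OF po]
  have "annihilator C c \<subseteq> annihilator C (p \<cdot> c)"
    using Comp_zero[of "c \<cdot> g" p for g] by (auto simp: annihilator_iff)
  moreover have "annihilator C d \<subseteq> annihilator C (q \<cdot> d)"
    using Comp_zero[of "d \<cdot> g" q for g] by (auto simp: annihilator_iff)
  ultimately show "hull C (Dom C c) (annihilator C c \<union> annihilator C d) \<subseteq> annihilator C (p \<cdot> c)"
    by (intro hull_le annihilator_in_clusters) (use sq in auto)
  show "annihilator C (p \<cdot> c) \<subseteq> hull C (Dom C c) (annihilator C c \<union> annihilator C d)"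
  proof
    fix g assume g: "g \<in> annihilator C (p \<cdot> c)"
    then have g' [simp]: "g \<in> Arr C" "Cod C g = Dom C c" by (simp_all add: annihilator_iff)
    show "g \<in> hull C (Dom C c) (annihilator C c \<union> annihilator C d)"
      unfolding hull_def
    proof (intro CollectI conjI ballI impI)
      fix t assume t [simp]: "t \<in> Arr C" "Dom C t = Dom C c"
        and z: "\<forall>s\<in>annihilator C c \<union> annihilator C d. zero_arrow C (t \<cdot> s)"
      have le: "annihilator C c \<subseteq> annihilator C t" "annihilator C d \<subseteq> annihilator C t"
        using z by (auto simp: annihilator_iff)
      obtain u where u [simp]: "u \<in> Arr C" "Dom C u = Cod C c" "Cod C u = Cod C t" "u \<cdot> c = t"
        using annihilator_le[OF c _ _ le(1)] by auto
      obtain v where v [simp]: "v \<in> Arr C" "Dom C v = Cod C d" "Cod C v = Cod C t" "v \<cdot> d = t"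
        using annihilator_le[OF d _ _ le(2)] by auto
      obtain w where w [simp]: "w \<in> Arr C" "Dom C w = Cod C p" "Cod C w = Cod C t"
        and wp: "w \<cdot> p = u"
        using pushoutE[OF po, of u v] by auto
      have "zero_arrow C (w \<cdot> ((p \<cdot> c) \<cdot> g))"
        by (rule Comp_zero) (use g in \<open>auto simp: annihilator_iff\<close>)
      moreover have "w \<cdot> ((p \<cdot> c) \<cdot> g) = t \<cdot> g"
        using assoc_eq1[OF wp, of "c \<cdot> g"] assoc_eq1[OF u(4), of g] by simp
      ultimately show "zero_arrow C (t \<cdot> g)" by simp
    qed (simp add: arrows_into_iff)
  qed
qed

lemma Int_in_clusters:
  assumes "S \<in> clusters C X" "T \<in> clusters C X"
  shows "S \<inter> T \<in> clusters C X"
proof -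
  obtain m where m: "m \<in> monomorphisms C" "m \<in> Arr C" "Cod C m = X" "S = sieve C m"
    using clusters_monoE[OF assms(1)] .
  obtain n where n: "n \<in> monomorphisms C" "n \<in> Arr C" "Cod C n = X" "T = sieve C n"
    using clusters_monoE[OF assms(2)] .
  obtain p q where pb: "is_pullback C m n p q" using pullback_ex[OF n(1) m(2)] m n by auto
  have "m \<cdot> p \<in> monomorphisms C"
    using pullback_mono[OF pb n(1)] pullback_arrs[OF pb] by (intro mono_Comp m) simp_all
  then show ?thesis
    using sieve_pullback[OF pb] pullback_arrs[OF pb] m n by (simp add: sieve_in_clusters)
qed

lemma hull_Un_in_clusters:
  assumes "S \<in> clusters C X" "T \<in> clusters C X"
  shows "hull C X (S \<union> T) \<in> clusters C X"
proof -
  obtain c where c: "c \<in> epimorphisms C" "c \<in> Arr C" "Dom C c = X" "S = annihilator C c"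
    using clusters_epiE[OF assms(1)] .
  obtain d where d: "d \<in> epimorphisms C" "d \<in> Arr C" "Dom C d = X" "T = annihilator C d"
    using clusters_epiE[OF assms(2)] .
  obtain p q where po: "is_pushout C c d p q" using pushout_ex[OF d(1) c(2)] c d by auto
  show ?thesis
    using annihilator_pushout[OF c(1) d(1) po] pushout_arrs[OF po] c d
    by (simp add: annihilator_in_clusters)
qed

text \<open>Stability of epimorphisms under pullback along monomorphisms gives the modular law.\<close>

lemma direct_image_inverse:
  assumes f: "f \<in> Arr C" and T: "T \<in> clusters C (Cod C f)"
  shows "direct_image C f (inverse_image C f T) = T \<inter> direct_image C f (arrows_into C (Dom C f))"
proof
  have PT: "inverse_image C f T \<in> clusters C (Dom C f)" by (rule inverse_image_in_clusters[OF f T])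
  show "direct_image C f (inverse_image C f T) \<subseteq> T \<inter> direct_image C f (arrows_into C (Dom C f))"
    using direct_image_inverse_adjoint[OF f PT T] direct_image_mono[OF clusters_subset[OF PT], of f] by blast
next
  obtain e m where e: "e \<in> epimorphisms C" and m: "m \<in> monomorphisms C"
    and em [simp]: "e \<in> Arr C" "m \<in> Arr C" "Dom C e = Dom C f" "Dom C m = Cod C e" "Cod C m = Cod C f"
    and me: "m \<cdot> e = f"
    using factorE[OF f] .
  obtain c where c [simp]: "c \<in> Arr C" "Dom C c = Cod C f" and Tc: "T = annihilator C c"
    using T by (auto simp: clusters_def)
  show "T \<inter> direct_image C f (arrows_into C (Dom C f)) \<subseteq> direct_image C f (inverse_image C f T)"
  proof
    fix g assume g: "g \<in> T \<inter> direct_image C f (arrows_into C (Dom C f))"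
    then have "g \<in> sieve C m" using direct_image_arrows_into[OF m e] me by simp
    then obtain h where h [simp]: "h \<in> Arr C" "Cod C h = Dom C m" and gh: "g = m \<cdot> h"
      by (auto simp: sieve_iff)
    \<comment> \<open>The lift \<open>h\<close> of \<open>g\<close> is replaced by its image
      \<open>k\<close>. Pulling \<open>k\<close> back along \<open>e\<close> gives \<open>p\<close>
      in \<open>inverse_image C f T\<close> with
      \<open>f \<cdot> p = m \<cdot> (k \<cdot> q)\<close>. As \<open>q\<close> is epic, an arrow
      annihilating \<open>f \<cdot> p\<close> annihilates \<open>m \<cdot> k\<close> and hence
      \<open>g\<close>.\<close>
    obtain j k where j: "j \<in> epimorphisms C" and k: "k \<in> monomorphisms C"
      and jk [simp]: "j \<in> Arr C" "k \<in> Arr C" "Dom C j = Dom C h" "Dom C k = Cod C j" "Cod C k = Cod C h"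
      and kj: "k \<cdot> j = h"
      using factorE[OF h(1)] .
    have "Cod C e = Cod C k" by simp
    then obtain p q where [simp]: "p \<in> Arr C" and q: "q \<in> epimorphisms C"
      and [simp]: "Cod C p = Dom C e" "Cod C q = Dom C k" "Dom C p = Dom C q"
      and sq: "e \<cdot> p = k \<cdot> q"
      by (rule pullback_epi_along_mono[OF e k])
    have [simp]: "q \<in> Arr C" by (rule epi_arr[OF q])
    have "zero_arrow C ((c \<cdot> (m \<cdot> k)) \<cdot> j)"
      using g by (simp add: Tc annihilator_iff gh kj)
    then have z: "zero_arrow C (c \<cdot> (m \<cdot> k))" by - (rule epi_zero[OF j], simp_all)
    have fp: "f \<cdot> p = m \<cdot> (k \<cdot> q)"
      using assoc_eq1[OF me, of p] sq by simp
    have p: "p \<in> inverse_image C f T"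
      using zero_Comp[OF z, of q] f by (simp add: inverse_image_def arrows_into_iff Tc annihilator_iff fp)
    show "g \<in> direct_image C f (inverse_image C f T)"
      unfolding direct_image_def hull_def
    proof (intro CollectI conjI ballI impI)
      fix t assume t [simp]: "t \<in> Arr C" "Dom C t = Cod C f"
        and z: "\<forall>s\<in>(\<cdot>) f ` inverse_image C f T. zero_arrow C (t \<cdot> s)"
      have "zero_arrow C ((t \<cdot> (m \<cdot> k)) \<cdot> q)" using z p fp by force
      then have "zero_arrow C (t \<cdot> (m \<cdot> k))" by - (rule epi_zero[OF q], simp_all)
      then have "zero_arrow C ((t \<cdot> (m \<cdot> k)) \<cdot> j)" by (rule zero_Comp) simp_all
      then show "zero_arrow C (t \<cdot> g)" by (simp add: gh kj)
    qed (simp add: arrows_into_iff gh)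
  qed
qed

text \<open>The dual stability, of monomorphisms under pushout along epimorphisms. An arrow
  \<open>t\<close> that annihilates \<open>S\<close> and the kernel of \<open>f\<close> factors as
  \<open>k \<cdot> (j \<cdot> e)\<close>. Pushing \<open>m\<close> out along \<open>j\<close> gives
  \<open>p\<close> on the codomain of \<open>f\<close> and a monic \<open>q\<close> with
  \<open>p \<cdot> f = q \<cdot> (j \<cdot> e)\<close>. Then \<open>p\<close> annihilates the image
  of \<open>S\<close>, hence \<open>f \<cdot> g\<close>; so \<open>j \<cdot> (e \<cdot> g)\<close>
  is zero, and \<open>t\<close> annihilates \<open>g\<close>.\<close>

lemma inverse_image_direct:
  assumes f: "f \<in> Arr C" and S: "S \<in> clusters C (Dom C f)"
  shows "inverse_image C f (direct_image C f S) = hull C (Dom C f) (S \<union> annihilator C f)"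
proof
  have I: "direct_image C f S \<in> clusters C (Cod C f)" by (rule direct_image_in_clusters[OF f S])
  have "annihilator C f \<subseteq> inverse_image C f (direct_image C f S)"
    using inverse_image_mono[OF annihilator_Id_le[OF I], of f] inverse_image_annihilator_Id[OF f] f by simp
  moreover have "S \<subseteq> inverse_image C f (direct_image C f S)"
    using direct_image_inverse_adjoint[OF f S I] by blast
  ultimately show "hull C (Dom C f) (S \<union> annihilator C f) \<subseteq> inverse_image C f (direct_image C f S)"
    by (intro hull_le inverse_image_in_clusters f I) blast
next
  obtain e m where e: "e \<in> epimorphisms C" and m: "m \<in> monomorphisms C"
    and em [simp]: "e \<in> Arr C" "m \<in> Arr C" "Dom C e = Dom C f" "Dom C m = Cod C e" "Cod C m = Cod C f"
    and me: "m \<cdot> e = f"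
    using factorE[OF f] .
  show "inverse_image C f (direct_image C f S) \<subseteq> hull C (Dom C f) (S \<union> annihilator C f)"
  proof
    fix g assume g: "g \<in> inverse_image C f (direct_image C f S)"
    then have [simp]: "g \<in> Arr C" "Cod C g = Dom C f" by (simp_all add: inverse_image_def arrows_into_iff)
    show "g \<in> hull C (Dom C f) (S \<union> annihilator C f)"
      unfolding hull_def
    proof (intro CollectI conjI ballI impI)
      fix t assume t [simp]: "t \<in> Arr C" "Dom C t = Dom C f"
        and z: "\<forall>s\<in>S \<union> annihilator C f. zero_arrow C (t \<cdot> s)"
      have "annihilator C e \<subseteq> annihilator C t"
        using z annihilator_mono_Comp[OF m, of e] by (auto simp: me annihilator_iff)
      moreover have "Dom C t = Dom C e" by simp
      ultimately obtain t' where t' [simp]: "t' \<in> Arr C" "Dom C t' = Cod C e" "Cod C t' = Cod C t"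
        and te: "t' \<cdot> e = t"
        using annihilator_le[OF e t(1)] by metis
      obtain j k where j: "j \<in> epimorphisms C" and k: "k \<in> monomorphisms C"
        and jk [simp]: "j \<in> Arr C" "k \<in> Arr C" "Dom C j = Dom C t'" "Dom C k = Cod C j" "Cod C k = Cod C t'"
        and kj: "k \<cdot> j = t'"
        using factorE[OF t'(1)] .
      have "Dom C m = Dom C j" by simp
      then obtain p q where [simp]: "p \<in> Arr C" and q: "q \<in> monomorphisms C"
        and [simp]: "Dom C p = Cod C m" "Dom C q = Cod C j" "Cod C p = Cod C q"
        and sq: "p \<cdot> m = q \<cdot> j"
        by (rule pushout_mono_along_epi[OF m j])
      have [simp]: "q \<in> Arr C" by (rule mono_arr[OF q])
      have t_eq: "t \<cdot> s = k \<cdot> (j \<cdot> (e \<cdot> s))" if "s \<in> Arr C" "Cod C s = Dom C f" for s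
        using assoc_eq1[OF te, of s] assoc_eq1[OF kj, of "e \<cdot> s"] that by simp
      have pf_eq: "p \<cdot> (f \<cdot> s) = q \<cdot> (j \<cdot> (e \<cdot> s))" if "s \<in> Arr C" "Cod C s = Dom C f" for s
        using assoc_eq1[OF me, of s] assoc_eq[OF sq, of "e \<cdot> s"] that by simp
      have "zero_arrow C (p \<cdot> (f \<cdot> s))" if s: "s \<in> S" for s
      proof -
        have [simp]: "s \<in> Arr C" "Cod C s = Dom C f" using clusters_into[OF S s] by auto
        have "zero_arrow C (t \<cdot> s)" using z s by blast
        then have "zero_arrow C (k \<cdot> (j \<cdot> (e \<cdot> s)))" using t_eq[of s] by simp
        then have "zero_arrow C (j \<cdot> (e \<cdot> s))" by - (rule mono_zero[OF k], simp_all)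
        then show ?thesis using pf_eq[of s] Comp_zero[of "j \<cdot> (e \<cdot> s)" q] by simp
      qed
      then have "zero_arrow C (p \<cdot> (f \<cdot> g))"
        using g by (auto simp: inverse_image_def direct_image_def hull_def)
      then have "zero_arrow C (j \<cdot> (e \<cdot> g))"
        by - (rule mono_zero[OF q], use pf_eq[of g] in simp_all)
      then have "zero_arrow C (k \<cdot> (j \<cdot> (e \<cdot> g)))" by (rule Comp_zero) simp_all
      then show "zero_arrow C (t \<cdot> g)" using t_eq[of g] by simp
    qed (simp add: arrows_into_iff)
  qed
qed

end

section \<open>The form induced by a transfer functor\<close>

text \<open>A form has its fibres in \<open>'u\<close>, whereas clusters are sets of arrows. The
  inclusion order is therefore transported along a code.\<close>

definition encoded_poset :: "('a set \<Rightarrow> 'u) \<Rightarrow> 'a set set \<Rightarrow> 'u gorder" where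
  "encoded_poset \<phi> K = \<lparr> carrier = \<phi> ` K, eq = (=),
     le = (\<lambda>a b. inv_into K \<phi> a \<subseteq> inv_into K \<phi> b) \<rparr>"

text \<open>Meets are intersections, but a union of clusters need not be a cluster, hence the
  separate join \<open>j\<close>, later instantiated by the hull of the union.\<close>

locale encoded_lattice =
  fixes \<phi> :: "'a set \<Rightarrow> 'u" and K :: "'a set set" and j :: "'a set \<Rightarrow> 'a set \<Rightarrow> 'a set"
    and t b :: "'a set"
  assumes inj: "inj_on \<phi> K"
    and Int_closed: "S \<in> K \<Longrightarrow> T \<in> K \<Longrightarrow> S \<inter> T \<in> K"
    and J_closed: "S \<in> K \<Longrightarrow> T \<in> K \<Longrightarrow> j S T \<in> K"
    and join_upper: "S \<in> K \<Longrightarrow> T \<in> K \<Longrightarrow> S \<union> T \<subseteq> j S T"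
    and join_least: "S \<in> K \<Longrightarrow> T \<in> K \<Longrightarrow> R \<in> K \<Longrightarrow> S \<union> T \<subseteq> R \<Longrightarrow> j S T \<subseteq> R"
    and top_in: "t \<in> K" and top_greatest: "S \<in> K \<Longrightarrow> S \<subseteq> t"
    and bot_in: "b \<in> K" and bot_least: "S \<in> K \<Longrightarrow> b \<subseteq> S"
begin

abbreviation L :: "'u gorder" where "L \<equiv> encoded_poset \<phi> K"

lemma carrier_L: "carrier L = \<phi> ` K"
  by (simp add: encoded_poset_def)

lemma decode: "S \<in> K \<Longrightarrow> inv_into K \<phi> (\<phi> S) = S"
  using inj by simp

lemma le_iff: "S \<in> K \<Longrightarrow> T \<in> K \<Longrightarrow> \<phi> S \<sqsubseteq>\<^bsub>L\<^esub> \<phi> T \<longleftrightarrow> S \<subseteq> T"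
  by (simp add: encoded_poset_def inj)

lemma carrierE:
  assumes "x \<in> carrier L"
  obtains S where "S \<in> K" "x = \<phi> S"
  using assms by (auto simp: carrier_L)

lemma partial_order: "partial_order L"
proof unfold_locales
  show "(.=\<^bsub>L\<^esub>) = (=)" by (simp add: encoded_poset_def)
  fix x y assume "x \<sqsubseteq>\<^bsub>L\<^esub> y" "y \<sqsubseteq>\<^bsub>L\<^esub> x" "x \<in> carrier L" "y \<in> carrier L"
  then show "x .=\<^bsub>L\<^esub> y" by (auto simp: encoded_poset_def inj)
qed (auto simp: encoded_poset_def)

lemma bounded_lattice: "bounded_lattice L"
proof -
  interpret partial_order L by (rule partial_order)
  show ?thesis
  proof unfold_locales
    show "\<exists>x. least L x (carrier L)"
      by (rule exI[of _ "\<phi> b"])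
        (auto simp: least_def carrier_L le_iff bot_in bot_least)
    show "\<exists>x. greatest L x (carrier L)"
      by (rule exI[of _ "\<phi> t"])
        (auto simp: greatest_def carrier_L le_iff top_in top_greatest)
  next
    fix x y assume xy: "x \<in> carrier L" "y \<in> carrier L"
    obtain S where S: "S \<in> K" "x = \<phi> S" using carrierE[OF xy(1)] .
    obtain T where T: "T \<in> K" "y = \<phi> T" using carrierE[OF xy(2)] .
    show "\<exists>s. least L s (Upper L {x, y})"
      by (rule exI[of _ "\<phi> (j S T)"], rule least_UpperI)
        (use S T J_closed join_upper join_least in
          \<open>auto simp: Upper_def carrier_L le_iff\<close>)
    show "\<exists>s. greatest L s (Lower L {x, y})"
      by (rule exI[of _ "\<phi> (S \<inter> T)"], rule greatest_LowerI)
        (use S T Int_closed in \<open>auto simp: Lower_def carrier_L le_iff\<close>)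
  qed
qed

lemma top_eq: "\<top>\<^bsub>L\<^esub> = \<phi> t"
  by (rule bounded_lattice.top_eq[OF bounded_lattice, symmetric])
    (auto simp: carrier_L le_iff top_in top_greatest)

lemma bottom_eq: "\<bottom>\<^bsub>L\<^esub> = \<phi> b"
  by (rule bounded_lattice.bottom_eq[OF bounded_lattice, symmetric])
    (auto simp: carrier_L le_iff bot_in bot_least)

lemma join_eq:
  assumes S: "S \<in> K" and T: "T \<in> K"
  shows "\<phi> S \<squnion>\<^bsub>L\<^esub> \<phi> T = \<phi> (j S T)"
proof -
  interpret bounded_lattice L by (rule bounded_lattice)
  have c: "\<phi> S \<in> carrier L" "\<phi> T \<in> carrier L" "\<phi> (j S T) \<in> carrier L"
    using S T J_closed by (auto simp: carrier_L)
  obtain R where R: "R \<in> K" "\<phi> S \<squnion>\<^bsub>L\<^esub> \<phi> T = \<phi> R"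
    using carrierE[OF join_closed[OF c(1,2)]] .
  have "S \<subseteq> R" "T \<subseteq> R"
    using join_left[OF c(1,2)] join_right[OF c(1,2)] S T R by (simp_all add: le_iff)
  moreover have "R \<subseteq> j S T"
    using join_le[of "\<phi> S" "\<phi> (j S T)" "\<phi> T"] c join_upper[OF S T] S T R J_closed[OF S T]
    by (simp add: le_iff)
  ultimately show ?thesis using join_least[OF S T R(1)] R by auto
qed

lemma meet_eq:
  assumes S: "S \<in> K" and T: "T \<in> K"
  shows "\<phi> S \<sqinter>\<^bsub>L\<^esub> \<phi> T = \<phi> (S \<inter> T)"
proof -
  interpret bounded_lattice L by (rule bounded_lattice)
  have c: "\<phi> S \<in> carrier L" "\<phi> T \<in> carrier L" "\<phi> (S \<inter> T) \<in> carrier L"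
    using S T Int_closed by (auto simp: carrier_L)
  obtain R where R: "R \<in> K" "\<phi> S \<sqinter>\<^bsub>L\<^esub> \<phi> T = \<phi> R"
    using carrierE[OF meet_closed[OF c(1,2)]] .
  have "R \<subseteq> S" "R \<subseteq> T"
    using meet_left[OF c(1,2)] meet_right[OF c(1,2)] S T R by (simp_all add: le_iff)
  moreover have "S \<inter> T \<subseteq> R"
    using meet_le[of "\<phi> (S \<inter> T)" "\<phi> S" "\<phi> T"] c S T R Int_closed[OF S T]
    by (simp add: le_iff)
  ultimately have "R = S \<inter> T" by blast
  then show ?thesis using R by simp
qed

end

section \<open>Factorization systems and transfer functors into an exact category\<close>

locale factorized =
  fixes U :: "'u itself" and C :: "('o, 'm) cat" (structure) and E M :: "'m set"
  assumes fact: "factorized_category U C E M"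
begin

sublocale category C
  using fact unfolding factorized_category_def locally_small_def by blast

lemma pfs: "proper_factorization_system C E M"
  using fact unfolding factorized_category_def by blast

lemma E_epi: "e \<in> E \<Longrightarrow> e \<in> epimorphisms C" and M_mono: "m \<in> M \<Longrightarrow> m \<in> monomorphisms C"
  using pfs unfolding proper_factorization_system_def by auto

lemma E_arr [simp]: "e \<in> E \<Longrightarrow> e \<in> Arr C" and M_arr [simp]: "m \<in> M \<Longrightarrow> m \<in> Arr C"
  using E_epi epi_arr M_mono mono_arr by auto

lemma iso_in_EM: "f \<in> isomorphisms C \<Longrightarrow> f \<in> E" "f \<in> isomorphisms C \<Longrightarrow> f \<in> M"
  and comp_EM: "d \<in> E \<Longrightarrow> e \<in> E \<Longrightarrow> Dom C e = Cod C d \<Longrightarrow> e \<cdot> d \<in> E"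
    "m \<in> M \<Longrightarrow> n \<in> M \<Longrightarrow> Dom C n = Cod C m \<Longrightarrow> n \<cdot> m \<in> M"
  using pfs unfolding proper_factorization_system_def factorization_system_def comp_closed_def by auto

lemma EM_factorE:
  assumes "f \<in> Arr C"
  obtains e m where "e \<in> E" "m \<in> M" "e \<in> Arr C" "m \<in> Arr C" "Dom C e = Dom C f" "Dom C m = Cod C e"
    "Cod C m = Cod C f" "m \<cdot> e = f"
proof -
  obtain e m where em: "e \<in> E" "m \<in> M" "Dom C m = Cod C e" "m \<cdot> e = f"
    using assms pfs unfolding proper_factorization_system_def factorization_system_def by metis
  then have "Dom C f = Dom C e" "Cod C f = Cod C m"
    using dom_Comp[of e m] cod_Comp[of e m] by auto
  then show ?thesis using that em by simp
qed

lemma liftE: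
  assumes "e \<in> E" "m \<in> M" "u \<in> Arr C" "v \<in> Arr C" "Dom C u = Dom C e" "Cod C u = Dom C m"
    "Dom C v = Cod C e" "Cod C v = Cod C m" "m \<cdot> u = v \<cdot> e"
  obtains d where "d \<in> Arr C" "Dom C d = Cod C e" "Cod C d = Dom C m" "d \<cdot> e = u" "m \<cdot> d = v"
proof -
  have "orthogonal C e m"
    using pfs assms unfolding proper_factorization_system_def factorization_system_def by blast
  moreover have "u \<in> Hom C (Dom C e) (Dom C m)" "v \<in> Hom C (Cod C e) (Cod C m)"
    using assms by (auto simp: in_Hom_iff)
  ultimately have "\<exists>!d. d \<in> Hom C (Cod C e) (Dom C m) \<and> d \<cdot> e = u \<and> m \<cdot> d = v"
    using assms(9) unfolding orthogonal_def by blast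
  then show ?thesis using that by (auto simp: in_Hom_iff)
qed

end

text \<open>Well-poweredness enters as \<open>small_clusters\<close>, the shape in which the fibres
  use it; \<open>small_clusters_iff\<close> connects it with subobjects.\<close>

locale transfer_to_exact =
  fixes U :: "'u itself" and C :: "('o, 'm) cat" (structure) and E M :: "'m set"
    and A :: "('p, 'n) cat" and T :: "('o, 'm, 'p, 'n) cfunctor"
  assumes transfer: "transfer_functor U C E M A (epimorphisms A) (monomorphisms A) T"
    and exact: "puppe_exact A"
    and small_clusters: "X \<in> Obj A \<Longrightarrow> small U (clusters A X)"
begin

sublocale A: puppe_exact A by (rule exact)

lemma is_func: "is_functor C A T"
  and cons: "conservative C A T"
  and TE: "AMap T ` E \<subseteq> epimorphisms A" and TM: "AMap T ` M \<subseteq> monomorphisms A"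
  using transfer unfolding transfer_functor_def by auto

lemma T_pullback:
  "m \<in> M \<Longrightarrow> n \<in> M \<Longrightarrow> is_pullback C m n p q \<Longrightarrow>
    is_pullback A (AMap T m) (AMap T n) (AMap T p) (AMap T q)"
  and T_pushout:
  "d \<in> E \<Longrightarrow> e \<in> E \<Longrightarrow> is_pushout C d e p q \<Longrightarrow>
    is_pushout A (AMap T d) (AMap T e) (AMap T p) (AMap T q)"
  using transfer unfolding transfer_functor_def by auto

sublocale C: factorized U C E M
  using transfer unfolding transfer_functor_def by unfold_locales blast

lemma T_simps [simp]:
  "X \<in> Obj C \<Longrightarrow> OMap T X \<in> Obj A"
  "f \<in> Arr C \<Longrightarrow> AMap T f \<in> Arr A"
  "f \<in> Arr C \<Longrightarrow> Dom A (AMap T f) = OMap T (Dom C f)"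
  "f \<in> Arr C \<Longrightarrow> Cod A (AMap T f) = OMap T (Cod C f)"
  "X \<in> Obj C \<Longrightarrow> AMap T (Id C X) = Id A (OMap T X)"
  "f \<in> Arr C \<Longrightarrow> g \<in> Arr C \<Longrightarrow> Dom C g = Cod C f \<Longrightarrow>
     AMap T (g \<cdot> f) = AMap T g \<cdot>\<^bsub>A\<^esub> AMap T f"
  using is_func unfolding is_functor_def by (auto simp: in_Hom_iff)

lemma T_E: "e \<in> E \<Longrightarrow> AMap T e \<in> epimorphisms A" and T_M: "m \<in> M \<Longrightarrow> AMap T m \<in> monomorphisms A"
  using TE TM by auto

text \<open>
  Comparisons between subobjects of \<open>T X\<close> that come from \<open>M\<close> lift along \<open>T\<close>: the projection of the
  pullback of the two becomes invertible in \<open>A\<close>.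
\<close>

lemma M_le_reflect:
  assumes mn: "m \<in> M" "n \<in> M" "Cod C m = Cod C n"
    and u: "u \<in> Arr A" "Dom A u = OMap T (Dom C m)" "Cod A u = OMap T (Dom C n)"
      "AMap T n \<cdot>\<^bsub>A\<^esub> u = AMap T m"
  obtains v where "v \<in> Arr C" "Dom C v = Dom C m" "Cod C v = Dom C n" "n \<cdot> v = m"
proof -
  obtain p q where pb: "is_pullback C m n p q"
    using C.fact mn unfolding factorized_category_def by blast
  note [simp] = mn C.pullback_arrs[OF pb]
  have "AMap T p \<in> isomorphisms A"
    by (rule A.pullback_le_iso[OF T_pullback[OF mn(1,2) pb] T_M[OF mn(2)]]) (use u in simp_all)
  then have "p \<in> isomorphisms C" using cons unfolding conservative_def by simp
  then obtain r where [simp]: "r \<in> Arr C" "Dom C r = Dom C m" "Cod C r = Dom C p"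
    and pr: "p \<cdot> r = Id C (Dom C m)"
    by (rule C.isoE) simp
  have "n \<cdot> (q \<cdot> r) = m"
    using C.assoc_eq[OF C.pullback_comm[OF pb], of r] by (simp add: pr)
  then show ?thesis by - (rule that[of "q \<cdot> r"], simp_all)
qed

lemma E_le_reflect:
  assumes de: "d \<in> E" "e \<in> E" "Dom C d = Dom C e"
    and u: "u \<in> Arr A" "Cod A u = OMap T (Cod C d)" "Dom A u = OMap T (Cod C e)"
      "u \<cdot>\<^bsub>A\<^esub> AMap T e = AMap T d"
  obtains v where "v \<in> Arr C" "Cod C v = Cod C d" "Dom C v = Cod C e" "v \<cdot> e = d"
proof -
  obtain p q where po: "is_pushout C d e p q"
    using C.fact de unfolding factorized_category_def by blast
  note [simp] = de C.pushout_arrs[OF po]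
  have "AMap T p \<in> isomorphisms A"
    by (rule A.pushout_le_iso[OF T_pushout[OF de(1,2) po] T_E[OF de(2)]]) (use u in simp_all)
  then have "p \<in> isomorphisms C" using cons unfolding conservative_def by simp
  then obtain r where [simp]: "r \<in> Arr C" "Cod C r = Cod C d" "Dom C r = Cod C p"
    and rp: "r \<cdot> p = Id C (Cod C d)"
    by (rule C.isoE) simp
  have "r \<cdot> (q \<cdot> e) = d"
    using C.assoc_eq1[OF rp, of d] C.pushout_comm[OF po] by simp
  then show ?thesis by - (rule that[of "r \<cdot> q"], simp_all)
qed

section \<open>The subobject form coded in the universe\<close>

definition enc :: "'o \<Rightarrow> 'n set \<Rightarrow> 'u" where
  "enc X = (SOME \<phi>. inj_on \<phi> (clusters A (OMap T X)))"

definition dec :: "'o \<Rightarrow> 'u \<Rightarrow> 'n set" where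
  "dec X = inv_into (clusters A (OMap T X)) (enc X)"

definition F :: "('o, 'm, 'u) form" where
  "F = \<lparr> fib = (\<lambda>X. encoded_poset (enc X) (clusters A (OMap T X))),
         dir = (\<lambda>f a. enc (Cod C f) (direct_image A (AMap T f) (dec (Dom C f) a))),
         inv_im = (\<lambda>f a. enc (Dom C f) (inverse_image A (AMap T f) (dec (Cod C f) a))) \<rparr>"

lemma enc_inj:
  assumes "X \<in> Obj C"
  shows "inj_on (enc X) (clusters A (OMap T X))"
proof -
  obtain \<phi> :: "'n set \<Rightarrow> 'u" where "inj_on \<phi> (clusters A (OMap T X))"
    using small_encode[OF small_clusters[OF T_simps(1)[OF assms]]] .
  then show ?thesis unfolding enc_def by (rule someI[where P = "\<lambda>\<phi>. inj_on \<phi> (clusters A (OMap T X))"])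
qed

lemma fibre:
  "X \<in> Obj C \<Longrightarrow> encoded_lattice (enc X) (clusters A (OMap T X))
     (\<lambda>S S'. hull A (OMap T X) (S \<union> S')) (arrows_into A (OMap T X))
     (annihilator A (Id A (OMap T X)))"
proof unfold_locales
  assume X: "X \<in> Obj C"
  show "inj_on (enc X) (clusters A (OMap T X))" by (rule enc_inj[OF X])
  show "arrows_into A (OMap T X) \<in> clusters A (OMap T X)"
    using X by (simp add: A.arrows_into_in_clusters)
  show "annihilator A (Id A (OMap T X)) \<in> clusters A (OMap T X)"
    using X by (simp add: A.annihilator_in_clusters)
  fix S assume S: "S \<in> clusters A (OMap T X)"
  show "S \<subseteq> arrows_into A (OMap T X)" by (rule A.clusters_subset[OF S])
  show "annihilator A (Id A (OMap T X)) \<subseteq> S" using A.annihilator_Id_le[OF S] X by simp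
  fix S' assume S': "S' \<in> clusters A (OMap T X)"
  show "S \<inter> S' \<in> clusters A (OMap T X)" by (rule A.Int_in_clusters[OF S S'])
  show "hull A (OMap T X) (S \<union> S') \<in> clusters A (OMap T X)" by (rule A.hull_Un_in_clusters[OF S S'])
  show "S \<union> S' \<subseteq> hull A (OMap T X) (S \<union> S')"
    using A.clusters_subset[OF S] A.clusters_subset[OF S'] by (intro A.hull_increasing) blast
  show "hull A (OMap T X) (S \<union> S') \<subseteq> R" if "R \<in> clusters A (OMap T X)" "S \<union> S' \<subseteq> R" for R
    by (rule A.hull_le[OF that(2,1)])
qed

lemma fib_F: "fib F X = encoded_poset (enc X) (clusters A (OMap T X))"
  by (simp add: F_def)

lemmas fib_carrier = encoded_lattice.carrier_L[OF fibre, folded fib_F]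
  and fib_le = encoded_lattice.le_iff[OF fibre, folded fib_F]
  and fib_join = encoded_lattice.join_eq[OF fibre, folded fib_F]
  and fib_meet = encoded_lattice.meet_eq[OF fibre, folded fib_F]
  and fib_top = encoded_lattice.top_eq[OF fibre, folded fib_F]
  and fib_bottom = encoded_lattice.bottom_eq[OF fibre, folded fib_F]
  and fib_lattice = encoded_lattice.bounded_lattice[OF fibre, folded fib_F]

lemma dec_enc: "X \<in> Obj C \<Longrightarrow> S \<in> clusters A (OMap T X) \<Longrightarrow> dec X (enc X S) = S"
  unfolding dec_def by (rule encoded_lattice.decode[OF fibre])

lemma dir_F: "f \<in> Arr C \<Longrightarrow> S \<in> clusters A (OMap T (Dom C f)) \<Longrightarrow>
    dir F f (enc (Dom C f) S) = enc (Cod C f) (direct_image A (AMap T f) S)"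
  by (simp add: F_def dec_enc)

lemma inv_im_F: "f \<in> Arr C \<Longrightarrow> S \<in> clusters A (OMap T (Cod C f)) \<Longrightarrow>
    inv_im F f (enc (Cod C f) S) = enc (Dom C f) (inverse_image A (AMap T f) S)"
  by (simp add: F_def dec_enc)

lemma T_image: "f \<in> Arr C \<Longrightarrow> S \<in> clusters A (OMap T (Dom C f)) \<Longrightarrow>
    direct_image A (AMap T f) S \<in> clusters A (OMap T (Cod C f))"
  using A.direct_image_in_clusters[of "AMap T f" S] by simp

lemma T_preimage: "f \<in> Arr C \<Longrightarrow> S \<in> clusters A (OMap T (Cod C f)) \<Longrightarrow>
    inverse_image A (AMap T f) S \<in> clusters A (OMap T (Dom C f))"
  using A.inverse_image_in_clusters[of "AMap T f" S] by simp

lemma T_annihilator: "f \<in> Arr C \<Longrightarrow> annihilator A (AMap T f) \<in> clusters A (OMap T (Dom C f))"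
  by (simp add: A.annihilator_in_clusters)

lemma Ker_F: "f \<in> Arr C \<Longrightarrow> Ker C F f = enc (Dom C f) (annihilator A (AMap T f))"
  using A.inverse_image_annihilator_Id[of "AMap T f"]
  by (simp add: Ker_def fib_bottom inv_im_F A.annihilator_in_clusters)

lemma Im_F: "f \<in> Arr C \<Longrightarrow>
    Im C F f = enc (Cod C f) (direct_image A (AMap T f) (arrows_into A (OMap T (Dom C f))))"
  by (simp add: Im_def fib_top dir_F A.arrows_into_in_clusters)

section \<open>Images, kernels and the axioms of a form\<close>

lemma Im_factor:
  assumes "e \<in> E" "m \<in> M" "Dom C m = Cod C e"
  shows "Im C F (m \<cdot> e) = enc (Cod C m) (sieve A (AMap T m))"
  using A.direct_image_arrows_into[OF T_M[OF assms(2)] T_E[OF assms(1)]] assms by (simp add: Im_F)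

lemma Id_E: "X \<in> Obj C \<Longrightarrow> Id C X \<in> E"
proof -
  assume X: "X \<in> Obj C"
  have "Id C X \<in> isomorphisms C" by (rule C.isoI[of _ "Id C X"]) (use X in simp_all)
  then show ?thesis
    using C.pfs unfolding proper_factorization_system_def factorization_system_def by blast
qed

lemma Im_M: "m \<in> M \<Longrightarrow> Im C F m = enc (Cod C m) (sieve A (AMap T m))"
  using Im_factor[of "Id C (Dom C m)" m] by (simp add: Id_E)

lemma Ker_factor:
  assumes "e \<in> E" "m \<in> M" "Dom C m = Cod C e"
  shows "Ker C F (m \<cdot> e) = Ker C F e"
  using A.annihilator_mono_Comp[OF T_M[OF assms(2)], of "AMap T e"] assms by (simp add: Ker_F)

lemma is_form_F: "is_form U C F"
  unfolding is_form_def
proof (intro conjI ballI)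
  fix X assume X: "X \<in> Obj C"
  show "bounded_lattice (fib F X)" by (rule fib_lattice[OF X])
  show "small U (carrier (fib F X))"
    unfolding fib_carrier[OF X] by (rule small_image) (use X in \<open>simp add: small_clusters\<close>)
  fix S assume "S \<in> carrier (fib F X)"
  then obtain S' where S': "S' \<in> clusters A (OMap T X)" "S = enc X S'"
    using fib_carrier[OF X] by auto
  show "dir F (Id C X) S = S" "inv_im F (Id C X) S = S"
    using dir_F[of "Id C X" S'] inv_im_F[of "Id C X" S'] X S'
    by (simp_all add: A.direct_image_Id A.inverse_image_Id)
next
  fix X Y f assume X: "X \<in> Obj C" and Y: "Y \<in> Obj C" and f: "f \<in> Hom C X Y"
  have [simp]: "f \<in> Arr C" "Dom C f = X" "Cod C f = Y" using f by (auto simp: in_Hom_iff)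
  have d: "dir F f (enc X S) = enc Y (direct_image A (AMap T f) S)"
    "direct_image A (AMap T f) S \<in> clusters A (OMap T Y)" if "S \<in> clusters A (OMap T X)" for S
    using dir_F[of f S] T_image[of f S] that by simp_all
  have i: "inv_im F f (enc Y S) = enc X (inverse_image A (AMap T f) S)"
    "inverse_image A (AMap T f) S \<in> clusters A (OMap T X)" if "S \<in> clusters A (OMap T Y)" for S
    using inv_im_F[of f S] T_preimage[of f S] that by simp_all
  show "dir F f \<in> carrier (fib F X) \<rightarrow> carrier (fib F Y)"
    "inv_im F f \<in> carrier (fib F Y) \<rightarrow> carrier (fib F X)"
    using X Y d i by (auto simp: fib_carrier)
  have po: "weak_partial_order (fib F X)" "weak_partial_order (fib F Y)"
    using fib_lattice[OF X] fib_lattice[OF Y]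
    by (auto dest!: bounded_lattice.axioms(1) simp: lattice_def upper_semilattice_def partial_order_def)
  show "isotone (fib F X) (fib F Y) (dir F f)"
    by (rule isotoneI[OF po]) (use X Y d A.direct_image_mono in \<open>auto simp: fib_carrier fib_le\<close>)
  show "isotone (fib F Y) (fib F X) (inv_im F f)"
    by (rule isotoneI[OF po(2,1)]) (use X Y i A.inverse_image_mono in \<open>auto simp: fib_carrier fib_le\<close>)
  fix S R assume "S \<in> carrier (fib F X)" "R \<in> carrier (fib F Y)"
  then obtain S' R' where S': "S' \<in> clusters A (OMap T X)" "S = enc X S'"
    and R': "R' \<in> clusters A (OMap T Y)" "R = enc Y R'"
    using X Y by (auto simp: fib_carrier)
  show "dir F f S \<sqsubseteq>\<^bsub>fib F Y\<^esub> R \<longleftrightarrow> S \<sqsubseteq>\<^bsub>fib F X\<^esub> inv_im F f R"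
    using X Y S' R' d i A.direct_image_inverse_adjoint[of "AMap T f" S' R'] by (simp add: fib_le)
next
  fix X Y Z f g assume XYZ: "X \<in> Obj C" "Y \<in> Obj C" "Z \<in> Obj C"
    and f: "f \<in> Hom C X Y" and g: "g \<in> Hom C Y Z"
  have [simp]: "f \<in> Arr C" "Dom C f = X" "Cod C f = Y" "g \<in> Arr C" "Dom C g = Y" "Cod C g = Z"
    using f g by (auto simp: in_Hom_iff)
  {
    fix S assume "S \<in> carrier (fib F X)"
    then obtain S' where S': "S' \<in> clusters A (OMap T X)" "S = enc X S'"
      using XYZ by (auto simp: fib_carrier)
    then show "dir F (g \<cdot> f) S = dir F g (dir F f S)"
      using dir_F[of "g \<cdot> f" S'] dir_F[of f S'] dir_F[of g "direct_image A (AMap T f) S'"] T_image[of f S']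
      by (simp add: A.direct_image_Comp)
  next
    fix S assume "S \<in> carrier (fib F Z)"
    then obtain S' where S': "S' \<in> clusters A (OMap T Z)" "S = enc Z S'"
      using XYZ by (auto simp: fib_carrier)
    then show "inv_im F (g \<cdot> f) S = inv_im F f (inv_im F g S)"
      using inv_im_F[of "g \<cdot> f" S'] inv_im_F[of g S'] inv_im_F[of f "inverse_image A (AMap T g) S'"]
        T_preimage[of g S']
      by (simp add: A.inverse_image_Comp)
  }
qed

text \<open>Write \<open>g = m \<cdot> d\<close> with \<open>d\<close> in \<open>E\<close>; then
  \<open>g\<close> and \<open>d\<close> have the same kernel. Inclusion of annihilators means that
  \<open>T d\<close> factors through \<open>T e\<close> in \<open>A\<close>, and
  \<open>E_le_reflect\<close> brings this factorization back to \<open>C\<close>.\<close>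

lemma E_quotient:
  assumes e: "e \<in> E"
  shows "is_quotient C F (Dom C e) (Ker C F e) e"
  unfolding is_quotient_def
proof (intro conjI ballI impI)
  show "normal C F (Dom C e) (Ker C F e)" unfolding normal_def using e by auto
  fix g assume g [simp]: "g \<in> Arr C"
    and le: "Dom C g = Dom C e \<and> Ker C F e \<sqsubseteq>\<^bsub>fib F (Dom C e)\<^esub> Ker C F g"
  then have Dg [simp]: "Dom C g = Dom C e" by blast
  obtain d m where d: "d \<in> E" and m: "m \<in> M" and dm [simp]: "d \<in> Arr C" "m \<in> Arr C"
    "Dom C d = Dom C g" "Dom C m = Cod C d" "Cod C m = Cod C g" and md: "m \<cdot> d = g"
    using C.EM_factorE[OF g] .
  have [simp]: "e \<in> Arr C" using e by simp
  have "enc (Dom C e) (annihilator A (AMap T e)) \<sqsubseteq>\<^bsub>fib F (Dom C e)\<^esub>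
      enc (Dom C e) (annihilator A (AMap T d))"
    using le Ker_factor[OF d m dm(4)] by (simp add: md Ker_F)
  then have "annihilator A (AMap T e) \<subseteq> annihilator A (AMap T d)"
    using T_annihilator[of e] T_annihilator[of d] by (simp add: fib_le)
  then obtain u where "u \<in> Arr A" "Dom A u = Cod A (AMap T e)" "Cod A u = Cod A (AMap T d)"
    "u \<cdot>\<^bsub>A\<^esub> AMap T e = AMap T d"
    using A.annihilator_le[OF T_E[OF e], of "AMap T d"] by auto
  then obtain v where v [simp]: "v \<in> Arr C" "Cod C v = Cod C d" "Dom C v = Cod C e"
    and ve: "v \<cdot> e = d"
    using E_le_reflect[OF d e, of u] by auto
  show "\<exists>!h. h \<in> Hom C (Cod C e) (Cod C g) \<and> g = h \<cdot> e"
  proof (rule ex1I[of _ "m \<cdot> v"])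
    show "m \<cdot> v \<in> Hom C (Cod C e) (Cod C g) \<and> g = (m \<cdot> v) \<cdot> e"
      by (simp add: in_Hom_iff ve md)
    fix h assume "h \<in> Hom C (Cod C e) (Cod C g) \<and> g = h \<cdot> e"
    then have h: "h \<in> Arr C" "Dom C h = Cod C e" "Cod C h = Cod C g" "h \<cdot> e = g"
      unfolding in_Hom_iff by metis+
    show "h = m \<cdot> v"
      by (rule C.epiD[OF C.E_epi[OF e]]) (use h md ve in simp_all)
  qed
qed (use e in simp_all)

text \<open>Dually, the \<open>M\<close>-part \<open>n\<close> of \<open>g\<close> carries its
  image, inclusion of sieves is a factorization in \<open>A\<close>, and \<open>M_le_reflect\<close>
  lifts it.\<close>

lemma M_embedding:
  assumes m: "m \<in> M"
  shows "is_embedding C F (Cod C m) (Im C F m) m"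
  unfolding is_embedding_def
proof (intro conjI ballI impI)
  show "conormal C F (Cod C m) (Im C F m)" unfolding conormal_def using m by auto
  fix g assume g [simp]: "g \<in> Arr C"
    and le: "Cod C g = Cod C m \<and> Im C F g \<sqsubseteq>\<^bsub>fib F (Cod C m)\<^esub> Im C F m"
  then have Cg [simp]: "Cod C g = Cod C m" by blast
  obtain e n where e: "e \<in> E" and n: "n \<in> M" and en [simp]: "e \<in> Arr C" "n \<in> Arr C"
    "Dom C e = Dom C g" "Dom C n = Cod C e" "Cod C n = Cod C g" and ne: "n \<cdot> e = g"
    using C.EM_factorE[OF g] .
  have [simp]: "m \<in> Arr C" using m by simp
  have "enc (Cod C m) (sieve A (AMap T n)) \<sqsubseteq>\<^bsub>fib F (Cod C m)\<^esub> enc (Cod C m) (sieve A (AMap T m))"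
    using le Im_factor[OF e n en(4)] by (simp add: ne Im_M m)
  then have "sieve A (AMap T n) \<subseteq> sieve A (AMap T m)"
    using A.sieve_in_clusters[OF T_M[OF m]] A.sieve_in_clusters[OF T_M[OF n]] by (simp add: fib_le)
  then obtain u where "u \<in> Arr A" "Dom A u = Dom A (AMap T n)" "Cod A u = Dom A (AMap T m)"
    "AMap T m \<cdot>\<^bsub>A\<^esub> u = AMap T n"
    using A.sieve_le[of "AMap T n" "AMap T m"] by auto
  then obtain v where v [simp]: "v \<in> Arr C" "Dom C v = Dom C n" "Cod C v = Dom C m"
    and mv: "m \<cdot> v = n"
    using M_le_reflect[OF n m, of u] by auto
  show "\<exists>!h. h \<in> Hom C (Dom C g) (Dom C m) \<and> g = m \<cdot> h"
  proof (rule ex1I[of _ "v \<cdot> e"])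
    show "v \<cdot> e \<in> Hom C (Dom C g) (Dom C m) \<and> g = m \<cdot> (v \<cdot> e)"
      using C.assoc_eq1[OF mv, of e] by (simp add: in_Hom_iff ne)
    fix h assume "h \<in> Hom C (Dom C g) (Dom C m) \<and> g = m \<cdot> h"
    then have h: "h \<in> Arr C" "Dom C h = Dom C g" "Cod C h = Dom C m" "m \<cdot> h = g"
      unfolding in_Hom_iff by metis+
    show "h = v \<cdot> e"
      by (rule C.monoD[OF C.M_mono[OF m]]) (use h C.assoc_eq1[OF mv, of e] ne in simp_all)
  qed
qed (use m in simp_all)

text \<open>(N1) is the modular law for clusters in \<open>A\<close>, and (N2) is the given
  factorization system. For (N3), normal clusters are kernels of arrows in \<open>E\<close> and
  conormal ones are images of arrows in \<open>M\<close>; \<open>T\<close> preserves the pushout or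
  pullback that computes their join or meet.\<close>

lemma noetherian_F: "noetherian C F"
  unfolding noetherian_def
proof (intro conjI ballI allI impI)
  fix X Y f assume X: "X \<in> Obj C" and Y: "Y \<in> Obj C" and f: "f \<in> Hom C X Y"
  have [simp]: "f \<in> Arr C" "Dom C f = X" "Cod C f = Y" using f by (auto simp: in_Hom_iff)
  {
    fix S assume "S \<in> carrier (fib F X)"
    then obtain S' where S': "S' \<in> clusters A (OMap T X)" "S = enc X S'"
      using X by (auto simp: fib_carrier)
    then show "inv_im F f (dir F f S) = S \<squnion>\<^bsub>fib F X\<^esub> Ker C F f"
      using X dir_F[of f S'] inv_im_F[of f "direct_image A (AMap T f) S'"] T_image[of f S']
        T_annihilator[of f] A.inverse_image_direct[of "AMap T f" S']
      by (simp add: Ker_F fib_join)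
  next
    fix S assume "S \<in> carrier (fib F Y)"
    then obtain S' where S': "S' \<in> clusters A (OMap T Y)" "S = enc Y S'"
      using Y by (auto simp: fib_carrier)
    then show "dir F f (inv_im F f S) = S \<sqinter>\<^bsub>fib F Y\<^esub> Im C F f"
      using X Y inv_im_F[of f S'] dir_F[of f "inverse_image A (AMap T f) S'"] T_preimage[of f S']
        T_image[of f "arrows_into A (OMap T X)"] A.direct_image_inverse[of "AMap T f" S']
      by (simp add: Im_F fib_meet A.arrows_into_in_clusters)
  }
next
  fix f assume f: "f \<in> Arr C"
  obtain e m where em: "e \<in> E" "m \<in> M" "Dom C e = Dom C f" "Dom C m = Cod C e"
    "Cod C m = Cod C f" "m \<cdot> e = f"
    using C.EM_factorE[OF f] by metis
  have "Ker C F f = Ker C F e" "Im C F f = Im C F m"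
    using Ker_factor[OF em(1,2,4)] Im_factor[OF em(1,2,4)] Im_M[OF em(2)] em by simp_all
  then show "\<exists>e m. Dom C m = Cod C e \<and> f = m \<cdot> e \<and> is_quotient C F (Dom C f) (Ker C F f) e \<and>
      is_embedding C F (Cod C f) (Im C F f) m"
    using E_quotient[OF em(1)] M_embedding[OF em(2)] em by metis
next
  fix X S R assume X: "X \<in> Obj C" and "normal C F X S \<and> normal C F X R"
  then obtain f g where fg: "f \<in> Arr C" "Dom C f = X" "S = Ker C F f"
    "g \<in> Arr C" "Dom C g = X" "R = Ker C F g" unfolding normal_def by auto
  have "\<exists>e\<in>E. Dom C e = X \<and> Ker C F h = Ker C F e" if h: "h \<in> Arr C" "Dom C h = X" for h
  proof -
    obtain e m where "e \<in> E" "m \<in> M" "Dom C e = Dom C h" "Dom C m = Cod C e" "m \<cdot> e = h"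
      using C.EM_factorE[OF h(1)] by metis
    then show ?thesis using Ker_factor h by metis
  qed
  then obtain d e where d: "d \<in> E" "Dom C d = X" "S = Ker C F d"
    and e: "e \<in> E" "Dom C e = X" "R = Ker C F e" using fg by metis
  obtain p q where po: "is_pushout C d e p q"
    using C.fact d e unfolding factorized_category_def by metis
  note [simp] = C.pushout_arrs[OF po]
  have "S \<squnion>\<^bsub>fib F X\<^esub> R = Ker C F (p \<cdot> d)"
    using A.annihilator_pushout[OF T_E[OF d(1)] T_E[OF e(1)] T_pushout[OF d(1) e(1) po]]
      X d e T_annihilator[of d] T_annihilator[of e]
    by (simp add: Ker_F fib_join)
  then show "normal C F X (S \<squnion>\<^bsub>fib F X\<^esub> R)"
    unfolding normal_def using d by (intro bexI[of _ "p \<cdot> d"]) simp_all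
next
  fix X S R assume X: "X \<in> Obj C" and "conormal C F X S \<and> conormal C F X R"
  then obtain f g where fg: "f \<in> Arr C" "Cod C f = X" "S = Im C F f"
    "g \<in> Arr C" "Cod C g = X" "R = Im C F g" unfolding conormal_def by auto
  have "\<exists>m\<in>M. Cod C m = X \<and> Im C F h = Im C F m" if h: "h \<in> Arr C" "Cod C h = X" for h
  proof -
    obtain e m where "e \<in> E" "m \<in> M" "Cod C m = Cod C h" "Dom C m = Cod C e" "m \<cdot> e = h"
      using C.EM_factorE[OF h(1)] by metis
    then show ?thesis using Im_factor Im_M h by metis
  qed
  then obtain m n where m: "m \<in> M" "Cod C m = X" "S = Im C F m"
    and n: "n \<in> M" "Cod C n = X" "R = Im C F n" using fg by metis
  obtain p q where pb: "is_pullback C m n p q"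
    using C.fact m n unfolding factorized_category_def by metis
  note [simp] = C.pullback_arrs[OF pb]
  have Tpb: "is_pullback A (AMap T m) (AMap T n) (AMap T p) (AMap T q)"
    by (rule T_pullback[OF m(1) n(1) pb])
  \<comment> \<open>\<open>Im_M\<close> speaks of arrows in \<open>M\<close>, and membership of
    \<open>m \<cdot> p\<close> has not been established. Its image is instead computed in
    \<open>A\<close>, where \<open>T p\<close> is monic as a pullback projection.\<close>
  have "AMap T (m \<cdot> p) \<in> monomorphisms A"
    using A.mono_Comp[OF A.pullback_mono[OF Tpb T_M[OF n(1)]] T_M[OF m(1)]] by simp
  then have "Im C F (m \<cdot> p) = enc X (sieve A (AMap T (m \<cdot> p)))"
    using A.direct_image_arrows_into[of "AMap T (m \<cdot> p)" "Id A (OMap T (Dom C p))"] m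
      A.split_epi[of "Id A (OMap T (Dom C p))" "Id A (OMap T (Dom C p))"]
    by (simp add: Im_F)
  then have "S \<sqinter>\<^bsub>fib F X\<^esub> R = Im C F (m \<cdot> p)"
    using A.sieve_pullback[OF Tpb] X m n A.sieve_in_clusters[OF T_M[OF m(1)], of "OMap T X"]
      A.sieve_in_clusters[OF T_M[OF n(1)], of "OMap T X"]
    by (simp add: Im_M fib_meet)
  then show "conormal C F X (S \<sqinter>\<^bsub>fib F X\<^esub> R)"
    unfolding conormal_def using m by (intro bexI[of _ "m \<cdot> p"]) simp_all
qed

text \<open>In the factorization \<open>m \<cdot> e\<close> of a quotient \<pi>, the arrows
  \<open>e\<close> and \<pi> have the same kernel. So \<open>e\<close> factors through \<pi> by some
  \<open>h\<close>, which is inverse to \<open>m\<close>: on one side because \<open>e\<close> is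
  epic, on the other by uniqueness in the universal property of \<pi>. Closure of \<open>E\<close>
  under composition with isomorphisms finishes the argument.\<close>

lemma form_quotients_F: "form_quotients C F = E"
proof (intro Set.equalityI subsetI)
  fix e assume "e \<in> E"
  then show "e \<in> form_quotients C F"
    unfolding form_quotients_def using E_quotient by (auto intro!: bexI[of _ "Dom C e"])
next
  fix \<pi> assume "\<pi> \<in> form_quotients C F"
  then obtain X K where q: "is_quotient C F X K \<pi>" unfolding form_quotients_def by blast
  then have \<pi> [simp]: "\<pi> \<in> Arr C" and DX: "Dom C \<pi> = X" "Ker C F \<pi> = K"
    unfolding is_quotient_def by auto
  obtain e m where e: "e \<in> E" and m: "m \<in> M" and em [simp]: "e \<in> Arr C" "m \<in> Arr C"
    "Dom C e = Dom C \<pi>" "Dom C m = Cod C e" "Cod C m = Cod C \<pi>" and me: "m \<cdot> e = \<pi>"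
    using C.EM_factorE[OF \<pi>] .
  have K: "Ker C F e = K" using Ker_factor[OF e m em(4)] by (simp add: me DX)
  have "K \<sqsubseteq>\<^bsub>fib F X\<^esub> K"
    using fib_le[of X "annihilator A (AMap T e)" "annihilator A (AMap T e)"] T_annihilator[of e]
      C.Dom_in_Obj[OF \<pi>] by (simp add: DX flip: K, simp add: Ker_F DX)
  then obtain h where h: "h \<in> Hom C (Cod C \<pi>) (Cod C e)" and e_eq: "h \<cdot> \<pi> = e"
    using q K DX em(1,3) unfolding is_quotient_def by metis
  have [simp]: "h \<in> Arr C" "Dom C h = Cod C \<pi>" "Cod C h = Cod C e"
    using h by (auto simp: in_Hom_iff)
  have "(h \<cdot> m) \<cdot> e = Id C (Cod C e) \<cdot> e"
    using e_eq by (simp add: me)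
  then have hm: "h \<cdot> m = Id C (Cod C e)"
    by - (rule C.epiD[OF C.E_epi[OF e]], simp_all)
  have "\<exists>!g. g \<in> Hom C (Cod C \<pi>) (Cod C \<pi>) \<and> \<pi> = g \<cdot> \<pi>"
    using q \<open>K \<sqsubseteq>\<^bsub>fib F X\<^esub> K\<close> DX \<pi> unfolding is_quotient_def by metis
  moreover have "m \<cdot> h \<in> Hom C (Cod C \<pi>) (Cod C \<pi>)" "\<pi> = (m \<cdot> h) \<cdot> \<pi>"
    using me e_eq by (simp_all add: in_Hom_iff)
  moreover have "Id C (Cod C \<pi>) \<in> Hom C (Cod C \<pi>) (Cod C \<pi>)" "\<pi> = Id C (Cod C \<pi>) \<cdot> \<pi>"
    by (simp_all add: in_Hom_iff)
  ultimately have "m \<cdot> h = Id C (Cod C \<pi>)" by blast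
  then have "m \<in> isomorphisms C" using hm by (intro C.isoI[of m h]) simp_all
  then show "\<pi> \<in> E" using C.comp_EM(1)[OF e C.iso_in_EM(1), of m] me by simp
qed

lemma form_embeddings_F: "form_embeddings C F = M"
proof (intro Set.equalityI subsetI)
  fix m assume "m \<in> M"
  then show "m \<in> form_embeddings C F"
    unfolding form_embeddings_def using M_embedding by (auto intro!: bexI[of _ "Cod C m"])
next
  fix \<iota> assume "\<iota> \<in> form_embeddings C F"
  then obtain X S where q: "is_embedding C F X S \<iota>" unfolding form_embeddings_def by blast
  then have \<iota> [simp]: "\<iota> \<in> Arr C" and DX: "Cod C \<iota> = X" "Im C F \<iota> = S"
    unfolding is_embedding_def by auto
  obtain e m where e: "e \<in> E" and m: "m \<in> M" and em [simp]: "e \<in> Arr C" "m \<in> Arr C"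
    "Dom C e = Dom C \<iota>" "Dom C m = Cod C e" "Cod C m = Cod C \<iota>" and me: "m \<cdot> e = \<iota>"
    using C.EM_factorE[OF \<iota>] .
  have S: "Im C F m = S" using Im_factor[OF e m em(4)] Im_M[OF m] by (simp add: me DX)
  have XO: "X \<in> Obj C" using C.Cod_in_Obj[OF \<iota>] DX by simp
  have "S \<sqsubseteq>\<^bsub>fib F X\<^esub> S"
    using fib_le[OF XO, of "sieve A (AMap T m)" "sieve A (AMap T m)"]
      A.sieve_in_clusters[OF T_M[OF m], of "OMap T X"] Im_M[OF m] S DX by simp
  then obtain h where h: "h \<in> Hom C (Dom C m) (Dom C \<iota>)" and m_eq: "\<iota> \<cdot> h = m"
    using q S DX em(2,5) unfolding is_embedding_def by metis
  have [simp]: "h \<in> Arr C" "Cod C h = Dom C \<iota>" "Dom C h = Cod C e"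
    using h by (auto simp: in_Hom_iff)
  have "m \<cdot> (e \<cdot> h) = m \<cdot> Id C (Cod C e)"
    using C.assoc_eq1[OF me, of h] m_eq by simp
  then have eh: "e \<cdot> h = Id C (Cod C e)"
    by - (rule C.monoD[OF C.M_mono[OF m]], simp_all)
  have "\<exists>!g. g \<in> Hom C (Dom C \<iota>) (Dom C \<iota>) \<and> \<iota> = \<iota> \<cdot> g"
    using q \<open>S \<sqsubseteq>\<^bsub>fib F X\<^esub> S\<close> DX \<iota> unfolding is_embedding_def by metis
  moreover have "h \<cdot> e \<in> Hom C (Dom C \<iota>) (Dom C \<iota>)" "\<iota> = \<iota> \<cdot> (h \<cdot> e)"
    using me C.assoc_eq1[OF m_eq, of e] by (simp_all add: in_Hom_iff)
  moreover have "Id C (Dom C \<iota>) \<in> Hom C (Dom C \<iota>) (Dom C \<iota>)" "\<iota> = \<iota> \<cdot> Id C (Dom C \<iota>)"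
    by (simp_all add: in_Hom_iff)
  ultimately have "h \<cdot> e = Id C (Dom C \<iota>)" by blast
  then have "e \<in> isomorphisms C" using eh by (intro C.isoI[of e h]) simp_all
  then show "\<iota> \<in> M" using C.comp_EM(2)[OF C.iso_in_EM(2) m, of e] me by simp
qed

lemma has_noetherian_form: "has_noetherian_form_inducing U C E M"
  unfolding has_noetherian_form_inducing_def
  using is_form_F noetherian_F form_quotients_F form_embeddings_F by blast

end

section \<open>The category of sets\<close>

lemma set_cat_simps [simp]:
  "Obj (set_cat :: ('u set, 'u set_arrow) cat) = {X. small TYPE('u) X}"
  "(X, f, Y) \<in> Arr (set_cat :: ('u set, 'u set_arrow) cat) \<longleftrightarrow>
     small TYPE('u) X \<and> small TYPE('u) Y \<and> f \<in> X \<rightarrow>\<^sub>E Y"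
  "Dom set_cat (X, f, Y) = X" "Cod set_cat (X, f, Y) = Y"
  "Id set_cat X = (X, \<lambda>x\<in>X. x, X)"
  "(Y, g, Z) \<cdot>\<^bsub>set_cat\<^esub> (X, f, W) = (X, compose X g f, Z)"
  by (auto simp: set_cat_def)

lemma set_HomE:
  assumes "a \<in> Hom (set_cat :: ('u set, 'u set_arrow) cat) X Y"
  obtains f where "a = (X, f, Y)" "f \<in> X \<rightarrow>\<^sub>E Y" "small TYPE('u) X" "small TYPE('u) Y"
  using assms by (cases a) (auto simp: in_Hom_iff)

lemma compose_eq_iff: "compose X g f = compose X g' f' \<longleftrightarrow> (\<forall>x\<in>X. g (f x) = g' (f' x))"
  unfolding compose_def restrict_def fun_eq_iff by auto

lemma PiE_eqI: "f \<in> X \<rightarrow>\<^sub>E Y \<Longrightarrow> g \<in> X \<rightarrow>\<^sub>E Z \<Longrightarrow> (\<And>x. x \<in> X \<Longrightarrow> f x = g x) \<Longrightarrow> f = g"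
  by (rule extensionalityI[of _ X]) (auto simp: PiE_def)

lemma category_set_cat: "category (set_cat :: ('u set, 'u set_arrow) cat)"
proof
  fix f g :: "'u set_arrow" and X Y Z :: "'u set"
  assume f: "f \<in> Hom set_cat X Y" and g: "g \<in> Hom set_cat Y Z"
  obtain f' where f': "f = (X, f', Y)" "f' \<in> X \<rightarrow>\<^sub>E Y" "small TYPE('u) X" "small TYPE('u) Y"
    using f by (rule set_HomE)
  obtain g' where g': "g = (Y, g', Z)" "g' \<in> Y \<rightarrow>\<^sub>E Z" "small TYPE('u) Z"
    using g by (rule set_HomE)
  show "g \<cdot>\<^bsub>set_cat\<^esub> f \<in> Hom set_cat X Z"
    using f' g' by (auto simp: in_Hom_iff compose_def)
  fix h :: "'u set_arrow" and W assume h: "h \<in> Hom set_cat Z W"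
  obtain h' where h': "h = (Z, h', W)" using h by (rule set_HomE)
  show "(h \<cdot>\<^bsub>set_cat\<^esub> g) \<cdot>\<^bsub>set_cat\<^esub> f = h \<cdot>\<^bsub>set_cat\<^esub> (g \<cdot>\<^bsub>set_cat\<^esub> f)"
    using f' g' h' by (auto simp: compose_eq_iff) (auto simp: compose_def)
next
  fix f :: "'u set_arrow" and X Y assume "f \<in> Hom set_cat X Y"
  then obtain f' where f': "f = (X, f', Y)" "f' \<in> X \<rightarrow>\<^sub>E Y" by (rule set_HomE)
  show "f \<cdot>\<^bsub>set_cat\<^esub> Id set_cat X = f" "Id set_cat Y \<cdot>\<^bsub>set_cat\<^esub> f = f"
    using f' by (auto simp: compose_def fun_eq_iff PiE_iff extensional_def)
qed (auto simp: in_Hom_iff)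

lemma set_iso_iff:
  assumes "(X, f, Y) \<in> Arr set_cat"
  shows "(X, f, Y) \<in> isomorphisms set_cat \<longleftrightarrow> bij_betw f X Y"
proof
  assume "(X, f, Y) \<in> isomorphisms set_cat"
  then obtain g where g: "g \<in> Hom set_cat Y X" "g \<cdot>\<^bsub>set_cat\<^esub> (X, f, Y) = Id set_cat X"
    "(X, f, Y) \<cdot>\<^bsub>set_cat\<^esub> g = Id set_cat Y"
    unfolding isomorphisms_def by auto
  obtain g' where g': "g = (Y, g', X)" "g' \<in> Y \<rightarrow>\<^sub>E X" using g(1) by (rule set_HomE)
  have "compose X g' f = (\<lambda>x\<in>X. x)" "compose Y f g' = (\<lambda>x\<in>Y. x)" using g g' by auto
  then have "\<And>x. x \<in> X \<Longrightarrow> g' (f x) = x" "\<And>y. y \<in> Y \<Longrightarrow> f (g' y) = y"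
    by (metis compose_eq restrict_apply')+
  then show "bij_betw f X Y" using g' assms by (intro bij_betwI[of f X Y g']) auto
next
  assume b: "bij_betw f X Y"
  let ?g = "(Y, restrict (inv_into X f) Y, X)"
  have "inv_into X f y \<in> X" if "y \<in> Y" for y using b that bij_betw_imp_surj_on inv_into_into by metis
  then have "?g \<in> Hom set_cat Y X" using assms by (auto simp: in_Hom_iff)
  moreover have "?g \<cdot>\<^bsub>set_cat\<^esub> (X, f, Y) = Id set_cat X" "(X, f, Y) \<cdot>\<^bsub>set_cat\<^esub> ?g = Id set_cat Y"
    using b assms bij_betw_inv_into_left[OF b] bij_betw_inv_into_right[OF b]
    by (auto simp: compose_def fun_eq_iff)
  ultimately show "(X, f, Y) \<in> isomorphisms set_cat"
    using assms unfolding isomorphisms_def by (auto intro!: bexI[of _ ?g])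
qed

lemma surjections_iff: "(X, f, Y) \<in> surjections \<longleftrightarrow> (X, f, Y) \<in> Arr set_cat \<and> f ` X = Y"
  and injections_iff: "(X, f, Y) \<in> injections \<longleftrightarrow> (X, f, Y) \<in> Arr set_cat \<and> inj_on f X"
  by (simp_all add: surjections_def injections_def)

section \<open>Pullbacks and pushouts of sets\<close>

lemma set_pullbackI:
  fixes m n p q :: "'u \<Rightarrow> 'u"
  assumes arr: "(A, m, X) \<in> Arr set_cat" "(B, n, X) \<in> Arr set_cat" "(P, p, A) \<in> Arr set_cat"
      "(P, q, B) \<in> Arr set_cat"
    and sq: "\<And>r. r \<in> P \<Longrightarrow> m (p r) = n (q r)"
    and ex: "\<And>s t. s \<in> A \<Longrightarrow> t \<in> B \<Longrightarrow> m s = n t \<Longrightarrow> \<exists>r\<in>P. p r = s \<and> q r = t"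
    and uniq: "\<And>r r'. r \<in> P \<Longrightarrow> r' \<in> P \<Longrightarrow> p r = p r' \<Longrightarrow> q r = q r' \<Longrightarrow> r = r'"
  shows "is_pullback set_cat (A, m, X) (B, n, X) (P, p, A) (P, q, B)"
proof -
  have "\<exists>!h. h \<in> Hom set_cat W P \<and> (P, p, A) \<cdot>\<^bsub>set_cat\<^esub> h = a \<and> (P, q, B) \<cdot>\<^bsub>set_cat\<^esub> h = b"
    if a: "a \<in> Hom set_cat W A" and b: "b \<in> Hom set_cat W B"
      and ab: "(A, m, X) \<cdot>\<^bsub>set_cat\<^esub> a = (B, n, X) \<cdot>\<^bsub>set_cat\<^esub> b" for W :: "'u set" and a b
  proof -
    obtain a' where a': "a = (W, a', A)" "a' \<in> W \<rightarrow>\<^sub>E A" "small TYPE('u) W" using a by (rule set_HomE)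
    obtain b' where b': "b = (W, b', B)" "b' \<in> W \<rightarrow>\<^sub>E B" using b by (rule set_HomE)
    have "\<exists>r\<in>P. p r = a' w \<and> q r = b' w" if w: "w \<in> W" for w
      using ex[of "a' w" "b' w"] ab a' b' w by (auto simp: compose_eq_iff)
    then obtain h where h: "h w \<in> P \<and> p (h w) = a' w \<and> q (h w) = b' w" if "w \<in> W" for w
      by metis
    show ?thesis
    proof (rule ex1I[of _ "(W, restrict h W, P)"])
      show "(W, restrict h W, P) \<in> Hom set_cat W P \<and> (P, p, A) \<cdot>\<^bsub>set_cat\<^esub> (W, restrict h W, P) = a \<and>
          (P, q, B) \<cdot>\<^bsub>set_cat\<^esub> (W, restrict h W, P) = b"
        using h a' b' arr
        by (auto simp: in_Hom_iff compose_def fun_eq_iff PiE_iff extensional_def)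
      fix k assume k: "k \<in> Hom set_cat W P \<and> (P, p, A) \<cdot>\<^bsub>set_cat\<^esub> k = a \<and> (P, q, B) \<cdot>\<^bsub>set_cat\<^esub> k = b"
      then obtain k' where k': "k = (W, k', P)" "k' \<in> W \<rightarrow>\<^sub>E P" by (auto elim: set_HomE)
      have "compose W p k' = a'" "compose W q k' = b'" using k k' a' b' by auto
      then have "p (k' w) = a' w \<and> q (k' w) = b' w" if "w \<in> W" for w
        using that by (metis compose_eq)
      then have "k' w = restrict h W w" if "w \<in> W" for w
        using h that k' uniq[of "k' w" "h w"] by (auto simp: PiE_iff)
      then have "k' = restrict h W" by (intro PiE_eqI[OF k'(2), of _ P]) (use h in auto)
      then show "k = (W, restrict h W, P)" using k' by simp
    qed
  qed
  then show ?thesis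
    using arr sq unfolding is_pullback_def by (simp add: compose_eq_iff)
qed

lemma set_pullback_square:
  assumes "is_pullback set_cat (A, m, X) (B, n, X') (P, p, A') (P', q, B')"
  shows "X' = X" "A' = A" "B' = B" "P' = P" "\<And>r. r \<in> P \<Longrightarrow> m (p r) = n (q r)"
    "(A, m, X) \<in> Arr set_cat" "(B, n, X) \<in> Arr set_cat" "(P, p, A) \<in> Arr set_cat" "(P, q, B) \<in> Arr set_cat"
  using assms unfolding is_pullback_def by (auto simp: compose_eq_iff)

lemma set_pushout_square:
  assumes "is_pushout set_cat (X, d, A) (X', e, B) (A', p, P) (B', q, P')"
  shows "X' = X" "A' = A" "B' = B" "P' = P" "\<And>x. x \<in> X \<Longrightarrow> p (d x) = q (e x)"
    "(X, d, A) \<in> Arr set_cat" "(X, e, B) \<in> Arr set_cat" "(A, p, P) \<in> Arr set_cat" "(B, q, P) \<in> Arr set_cat"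
  using assms unfolding is_pushout_def by (auto simp: compose_eq_iff)

text \<open>The pushout of two surjections is a quotient of \<open>X\<close>. The premise
  \<open>ker\<close> says that its equivalence relation is the least one possible: every compatible
  pair \<open>a\<close>, \<open>b\<close> identifies what \<open>p\<close> identifies.\<close>

lemma set_pushoutI:
  fixes d e p q :: "'u \<Rightarrow> 'u"
  assumes arr: "(X, d, A) \<in> Arr set_cat" "(X, e, B) \<in> Arr set_cat" "(A, p, P) \<in> Arr set_cat"
      "(B, q, P) \<in> Arr set_cat"
    and sq: "\<And>x. x \<in> X \<Longrightarrow> p (d x) = q (e x)"
    and surj: "d ` X = A" "e ` X = B" "p ` A = P"
    and ker: "\<And>(a :: 'u \<Rightarrow> 'u) b x y. (\<And>z. z \<in> X \<Longrightarrow> a (d z) = b (e z)) \<Longrightarrow> x \<in> X \<Longrightarrow> y \<in> X \<Longrightarrow>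
      p (d x) = p (d y) \<Longrightarrow> a (d x) = a (d y)"
  shows "is_pushout set_cat (X, d, A) (X, e, B) (A, p, P) (B, q, P)"
proof -
  have "\<exists>!h. h \<in> Hom set_cat P Z \<and> h \<cdot>\<^bsub>set_cat\<^esub> (A, p, P) = a \<and> h \<cdot>\<^bsub>set_cat\<^esub> (B, q, P) = b"
    if a: "a \<in> Hom set_cat A Z" and b: "b \<in> Hom set_cat B Z"
      and ab: "a \<cdot>\<^bsub>set_cat\<^esub> (X, d, A) = b \<cdot>\<^bsub>set_cat\<^esub> (X, e, B)" for Z :: "'u set" and a b
  proof -
    obtain a' where a': "a = (A, a', Z)" "a' \<in> A \<rightarrow>\<^sub>E Z" "small TYPE('u) Z" using a by (rule set_HomE)
    obtain b' where b': "b = (B, b', Z)" "b' \<in> B \<rightarrow>\<^sub>E Z" using b by (rule set_HomE)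
    have ab': "a' (d x) = b' (e x)" if "x \<in> X" for x
      using ab a' b' that by (auto simp: compose_eq_iff)
    \<comment> \<open>A chosen preimage in \<open>X\<close>; by \<open>ker\<close> the mediating map
      does not depend on this choice.\<close>
    define s where "s r = inv_into X (\<lambda>x. p (d x)) r" for r
    have PX: "P = (\<lambda>x. p (d x)) ` X" using surj by auto
    have s: "s r \<in> X" "p (d (s r)) = r" if "r \<in> P" for r
      using that unfolding PX s_def by (auto intro: inv_into_into f_inv_into_f[where f = "\<lambda>x. p (d x)"])
    define h where "h = (\<lambda>r\<in>P. a' (d (s r)))"
    have hpd: "h (p (d x)) = a' (d x)" if "x \<in> X" for x
    proof -
      have r: "p (d x) \<in> P" using that PX by blast
      have "a' (d (s (p (d x)))) = a' (d x)"
        by (rule ker[of a' b', OF ab' s(1)[OF r] that s(2)[OF r]])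
      then show ?thesis using r by (simp add: h_def)
    qed
    have hP: "h \<in> P \<rightarrow>\<^sub>E Z" using s a' arr by (auto simp: h_def)
    show ?thesis
    proof (rule ex1I[of _ "(P, h, Z)"])
      have "h (p z) = a' z" if "z \<in> A" for z
        using that hpd unfolding surj(1)[symmetric] by blast
      then have "compose A h p = a'"
        by (intro PiE_eqI[OF _ a'(2), of _ Z]) (use hP arr in \<open>auto simp: compose_def\<close>)
      moreover have "h (q (e x)) = b' (e x)" if "x \<in> X" for x
        using hpd[OF that] sq[OF that] ab'[OF that] by simp
      then have "h (q z) = b' z" if "z \<in> B" for z
        using that unfolding surj(2)[symmetric] by blast
      then have "compose B h q = b'"
        by (intro PiE_eqI[OF _ b'(2), of _ Z]) (use hP arr in \<open>auto simp: compose_def\<close>)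
      ultimately show "(P, h, Z) \<in> Hom set_cat P Z \<and> (P, h, Z) \<cdot>\<^bsub>set_cat\<^esub> (A, p, P) = a \<and>
          (P, h, Z) \<cdot>\<^bsub>set_cat\<^esub> (B, q, P) = b"
        using hP arr a' b' by (simp add: in_Hom_iff)
      fix k assume k: "k \<in> Hom set_cat P Z \<and> k \<cdot>\<^bsub>set_cat\<^esub> (A, p, P) = a \<and> k \<cdot>\<^bsub>set_cat\<^esub> (B, q, P) = b"
      then obtain k' where k': "k = (P, k', Z)" "k' \<in> P \<rightarrow>\<^sub>E Z" by (auto elim: set_HomE)
      have "compose A k' p = a'" using k k' a' by auto
      then have "k' (p z) = a' z" if "z \<in> A" for z
        using that by (metis compose_eq)
      then have "k' r = h r" if "r \<in> P" for r
        using that hpd surj PX by auto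
      then have "k' = h" by (rule PiE_eqI[OF k'(2) hP])
      then show "k = (P, h, Z)" using k' by simp
    qed
  qed
  then show ?thesis
    using arr sq unfolding is_pushout_def by (simp add: compose_eq_iff)
qed

text \<open>Chosen representatives realize the quotient by a generated equivalence relation inside
  \<open>'u\<close>, where the objects of \<open>set_cat\<close> live.\<close>

lemma rtrancl_Eps_eq_iff:
  assumes "sym R"
  shows "(SOME y. (x, y) \<in> R\<^sup>*) = (SOME z. (x', z) \<in> R\<^sup>*) \<longleftrightarrow> (x, x') \<in> R\<^sup>*"
proof
  assume "(SOME y. (x, y) \<in> R\<^sup>*) = (SOME z. (x', z) \<in> R\<^sup>*)"
  moreover have "(w, SOME z. (w, z) \<in> R\<^sup>*) \<in> R\<^sup>*" for w
    by (rule someI[of "\<lambda>z. (w, z) \<in> R\<^sup>*" w]) simp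
  ultimately show "(x, x') \<in> R\<^sup>*"
    using sym_rtrancl[OF assms] by (metis rtrancl_trans symD)
next
  assume "(x, x') \<in> R\<^sup>*"
  then have "(x, y) \<in> R\<^sup>* \<longleftrightarrow> (x', y) \<in> R\<^sup>*" for y
    using sym_rtrancl[OF assms] by (metis rtrancl_trans symD)
  then show "(SOME y. (x, y) \<in> R\<^sup>*) = (SOME z. (x', z) \<in> R\<^sup>*)" by simp
qed

text \<open>\<open>R\<close> is the union of the kernel relations of \<open>d\<close> and
  \<open>e\<close>; the pushout is the quotient of \<open>X\<close> by the equivalence relation it
  generates. A compatible pair is constant along each link of a chain.\<close>

lemma set_pushout_ex:
  fixes d e :: "'u \<Rightarrow> 'u"
  assumes arr: "(X, d, A) \<in> Arr set_cat" "(X, e, B) \<in> Arr set_cat" and surj: "d ` X = A" "e ` X = B"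
  shows "\<exists>p q. is_pushout set_cat (X, d, A) (X, e, B) p q"
proof -
  define R where "R = {(x, y). x \<in> X \<and> y \<in> X \<and> (d x = d y \<or> e x = e y)}"
  define rep where "rep x = (SOME y. (x, y) \<in> R\<^sup>*)" for x
  have rep: "rep x = rep y \<longleftrightarrow> (x, y) \<in> R\<^sup>*" for x y
    unfolding rep_def by (rule rtrancl_Eps_eq_iff) (auto simp: R_def sym_def)
  define p where "p = (\<lambda>a\<in>A. rep (inv_into X d a))"
  define q where "q = (\<lambda>b\<in>B. rep (inv_into X e b))"
  have pd: "p (d x) = rep x" if "x \<in> X" for x
    using that surj inv_into_into[of "d x" d X] f_inv_into_f[of "d x" d X]
    by (auto simp: p_def rep R_def intro!: r_into_rtrancl)
  have qe: "q (e x) = rep x" if "x \<in> X" for x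
    using that surj inv_into_into[of "e x" e X] f_inv_into_f[of "e x" e X]
    by (auto simp: q_def rep R_def intro!: r_into_rtrancl)
  have "is_pushout set_cat (X, d, A) (X, e, B) (A, p, rep ` X) (B, q, rep ` X)"
  proof (rule set_pushoutI[OF arr])
    have "small TYPE('u) (rep ` X)" by (rule small_image) (use arr in simp)
    moreover have "p \<in> A \<rightarrow>\<^sub>E rep ` X" "q \<in> B \<rightarrow>\<^sub>E rep ` X"
      unfolding p_def q_def surj[symmetric] by (auto intro: inv_into_into)
    ultimately show "(A, p, rep ` X) \<in> Arr set_cat" "(B, q, rep ` X) \<in> Arr set_cat"
      using arr by auto
    show "p ` A = rep ` X"
      unfolding surj(1)[symmetric] image_image using pd by simp
    fix a b :: "'u \<Rightarrow> 'u" and x y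
    assume ab: "\<And>z. z \<in> X \<Longrightarrow> a (d z) = b (e z)" and xy: "x \<in> X" "y \<in> X" "p (d x) = p (d y)"
    have "(x, y) \<in> R\<^sup>*" using xy pd rep by simp
    then show "a (d x) = a (d y)"
    proof (induction rule: rtrancl_induct)
      case (step z w)
      then show ?case using ab by (auto simp: R_def) metis
    qed simp
  qed (use surj pd qe in auto)
  then show ?thesis by blast
qed

text \<open>As \<open>n\<close> is injective, the pullback is the preimage of its range, realized as
  a subset of \<open>A\<close> instead of a set of pairs coded in \<open>'u\<close>.\<close>

lemma set_pullback_ex:
  fixes m n :: "'u \<Rightarrow> 'u"
  assumes arr: "(A, m, X) \<in> Arr set_cat" "(B, n, X) \<in> Arr set_cat" and inj: "inj_on n B"
  shows "\<exists>p q. is_pullback set_cat (A, m, X) (B, n, X) p q"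
proof -
  define P where "P = {x \<in> A. m x \<in> n ` B}"
  have q: "inv_into B n (m x) \<in> B" "n (inv_into B n (m x)) = m x" if "x \<in> P" for x
    using that by (auto simp: P_def f_inv_into_f inv_into_into)
  have "small TYPE('u) P" by (rule small_subset[of _ A]) (use arr in \<open>auto simp: P_def\<close>)
  then have "is_pullback set_cat (A, m, X) (B, n, X) (P, \<lambda>x\<in>P. x, A) (P, \<lambda>x\<in>P. inv_into B n (m x), B)"
    using q arr inj
    by (intro set_pullbackI) (auto simp: P_def inv_into_f_f)
  then show ?thesis by blast
qed

section \<open>Surjections and injections as a proper factorization system\<close>

lemma set_proper_factorization_system:
  "proper_factorization_system (set_cat :: ('u set, 'u set_arrow) cat) surjections injections"
  unfolding proper_factorization_system_def factorization_system_def
proof (intro conjI)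
  interpret category "set_cat :: ('u set, 'u set_arrow) cat" by (rule category_set_cat)
  show "surjections \<subseteq> (Arr set_cat :: 'u set_arrow set)" "injections \<subseteq> (Arr set_cat :: 'u set_arrow set)"
    by (auto simp: surjections_iff injections_iff)
  have "a \<in> surjections \<inter> injections" if "a \<in> isomorphisms set_cat" for a :: "'u set_arrow"
  proof -
    obtain X f Y where a: "a = (X, f, Y)" by (cases a)
    show ?thesis
      using that iso_arr[OF that] set_iso_iff[of X f Y]
      unfolding a Int_iff surjections_iff injections_iff bij_betw_def by blast
  qed
  then show "isomorphisms set_cat \<subseteq> (surjections :: 'u set_arrow set)"
    "isomorphisms set_cat \<subseteq> (injections :: 'u set_arrow set)" by auto
  show "comp_closed set_cat (surjections :: 'u set_arrow set)"
    unfolding comp_closed_def by (auto simp: surjections_iff compose_def)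
  show "comp_closed set_cat (injections :: 'u set_arrow set)"
    unfolding comp_closed_def by (auto simp: injections_iff compose_def inj_on_def PiE_iff)
  show "\<forall>f\<in>Arr (set_cat :: ('u set, 'u set_arrow) cat). \<exists>e\<in>surjections. \<exists>m\<in>injections.
      Dom set_cat m = Cod set_cat e \<and> f = m \<cdot>\<^bsub>set_cat\<^esub> e"
  proof
    fix a :: "'u set_arrow" assume a: "a \<in> Arr set_cat"
    obtain X f Y where f: "a = (X, f, Y)" by (cases a)
    have s: "small TYPE('u) (f ` X)" by (rule small_image) (use a f in simp)
    show "\<exists>e\<in>surjections. \<exists>m\<in>injections. Dom set_cat m = Cod set_cat e \<and> a = m \<cdot>\<^bsub>set_cat\<^esub> e"
      by (rule bexI[of _ "(X, f, f ` X)"], rule bexI[of _ "(f ` X, \<lambda>y\<in>f ` X. y, Y)"])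
        (use a f s in \<open>auto simp: surjections_iff injections_iff inj_on_def compose_def PiE_iff
           extensional_def fun_eq_iff\<close>)
  qed
  show "surjections \<subseteq> epimorphisms (set_cat :: ('u set, 'u set_arrow) cat)"
  proof
    fix a :: "'u set_arrow" assume a: "a \<in> surjections"
    obtain X f Y where f: "a = (X, f, Y)" by (cases a)
    show "a \<in> epimorphisms set_cat"
    proof (rule epiI)
      fix b c :: "'u set_arrow" assume "b \<in> Arr set_cat" "c \<in> Arr set_cat" "Cod set_cat b = Cod set_cat c"
        "Dom set_cat b = Cod set_cat a" "Dom set_cat c = Cod set_cat a"
        and eq: "b \<cdot>\<^bsub>set_cat\<^esub> a = c \<cdot>\<^bsub>set_cat\<^esub> a"
      then have "b \<in> Hom set_cat Y (Cod set_cat c)" "c \<in> Hom set_cat Y (Cod set_cat c)"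
        using f by (simp_all add: in_Hom_iff)
      then obtain b' c' Z where bc: "b = (Y, b', Z)" "b' \<in> Y \<rightarrow>\<^sub>E Z" "c = (Y, c', Z)" "c' \<in> Y \<rightarrow>\<^sub>E Z"
        by (metis set_HomE)
      have "b' (f x) = c' (f x)" if "x \<in> X" for x
        using eq bc f that by (simp add: compose_eq_iff)
      moreover have "f ` X = Y" using a f by (simp add: surjections_iff)
      ultimately have "b' y = c' y" if "y \<in> Y" for y using that by blast
      then have "b' = c'" by (rule PiE_eqI[OF bc(2,4)])
      then show "b = c" using bc by simp
    qed (use a f in \<open>simp add: surjections_iff\<close>)
  qed
  show "injections \<subseteq> monomorphisms (set_cat :: ('u set, 'u set_arrow) cat)"
  proof
    fix a :: "'u set_arrow" assume a: "a \<in> injections"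
    obtain X f Y where f: "a = (X, f, Y)" by (cases a)
    show "a \<in> monomorphisms set_cat"
    proof (rule monoI)
      fix b c :: "'u set_arrow" assume "b \<in> Arr set_cat" "c \<in> Arr set_cat" "Dom set_cat b = Dom set_cat c"
        "Cod set_cat b = Dom set_cat a" "Cod set_cat c = Dom set_cat a"
        and eq: "a \<cdot>\<^bsub>set_cat\<^esub> b = a \<cdot>\<^bsub>set_cat\<^esub> c"
      then have "b \<in> Hom set_cat (Dom set_cat c) X" "c \<in> Hom set_cat (Dom set_cat c) X"
        using f by (simp_all add: in_Hom_iff)
      then obtain b' c' Z where bc: "b = (Z, b', X)" "b' \<in> Z \<rightarrow>\<^sub>E X" "c = (Z, c', X)" "c' \<in> Z \<rightarrow>\<^sub>E X"
        by (metis set_HomE)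
      have "b' = c'"
        by (rule PiE_eqI[OF bc(2,4)])
          (use eq bc f a in \<open>auto simp: injections_iff compose_eq_iff inj_on_def PiE_iff\<close>)
      then show "b = c" using bc by simp
    qed (use a f in \<open>simp add: injections_iff\<close>)
  qed
  show "\<forall>e\<in>surjections. \<forall>m\<in>injections. orthogonal (set_cat :: ('u set, 'u set_arrow) cat) e m"
    unfolding orthogonal_def
  proof (intro ballI impI)
    fix e m u v :: "'u set_arrow"
    assume e: "e \<in> surjections" and m: "m \<in> injections"
      and u: "u \<in> Hom set_cat (Dom set_cat e) (Dom set_cat m)"
      and v: "v \<in> Hom set_cat (Cod set_cat e) (Cod set_cat m)"
      and sq: "m \<cdot>\<^bsub>set_cat\<^esub> u = v \<cdot>\<^bsub>set_cat\<^esub> e"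
    obtain X e' Y where e': "e = (X, e', Y)" by (cases e)
    obtain Z m' W where m': "m = (Z, m', W)" by (cases m)
    obtain u' where u': "u = (X, u', Z)" "u' \<in> X \<rightarrow>\<^sub>E Z" using u e' m' by (auto elim: set_HomE)
    obtain v' where v': "v = (Y, v', W)" "v' \<in> Y \<rightarrow>\<^sub>E W" using v e' m' by (auto elim: set_HomE)
    have arr: "small TYPE('u) X" "small TYPE('u) Y" "small TYPE('u) Z" "small TYPE('u) W"
      "e' \<in> X \<rightarrow>\<^sub>E Y" "m' \<in> Z \<rightarrow>\<^sub>E W" "e' ` X = Y" "inj_on m' Z"
      using e m e' m' by (auto simp: surjections_iff injections_iff)
    have sq': "m' (u' x) = v' (e' x)" if "x \<in> X" for x
      using sq u' v' e' m' that by (simp add: compose_eq_iff)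
    define s where "s y = inv_into X e' y" for y
    have s: "s y \<in> X" "e' (s y) = y" if "y \<in> Y" for y
      using that arr(7) by (auto simp: s_def inv_into_into f_inv_into_f)
    define d where "d = (\<lambda>y\<in>Y. u' (s y))"
    have dY: "d \<in> Y \<rightarrow>\<^sub>E Z" using u' s by (auto simp: d_def)
    have md: "m' (d y) = v' y" if "y \<in> Y" for y using sq'[of "s y"] s that by (simp add: d_def)
    \<comment> \<open>\<open>m'\<close> sends both sides to the same element, so its injectivity
      makes \<open>d\<close> independent of the section \<open>s\<close>.\<close>
    have de: "d (e' x) = u' x" if "x \<in> X" for x
      using md[of "e' x"] sq'[OF that] arr that dY u' by (auto simp: inj_on_def PiE_iff)
    show "\<exists>!d. d \<in> Hom set_cat (Cod set_cat e) (Dom set_cat m) \<and> d \<cdot>\<^bsub>set_cat\<^esub> e = u \<and> m \<cdot>\<^bsub>set_cat\<^esub> d = v"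
    proof (rule ex1I[of _ "(Y, d, Z)"])
      have "compose X d e' = u'"
        by (rule PiE_eqI[OF _ u'(2), of _ Z]) (use dY arr de in \<open>auto simp: compose_def\<close>)
      moreover have "compose Y m' d = v'"
        by (rule PiE_eqI[OF _ v'(2), of _ W]) (use dY arr md in \<open>auto simp: compose_def\<close>)
      ultimately show "(Y, d, Z) \<in> Hom set_cat (Cod set_cat e) (Dom set_cat m) \<and>
          (Y, d, Z) \<cdot>\<^bsub>set_cat\<^esub> e = u \<and> m \<cdot>\<^bsub>set_cat\<^esub> (Y, d, Z) = v"
        using dY arr e' m' u' v' by (simp add: in_Hom_iff)
      fix k assume k: "k \<in> Hom set_cat (Cod set_cat e) (Dom set_cat m) \<and> k \<cdot>\<^bsub>set_cat\<^esub> e = u \<and> m \<cdot>\<^bsub>set_cat\<^esub> k = v"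
      then obtain k' where k': "k = (Y, k', Z)" "k' \<in> Y \<rightarrow>\<^sub>E Z" using e' m' by (auto elim: set_HomE)
      have "compose X k' e' = u'" using k k' e' u' by auto
      then have "k' (e' x) = u' x" if "x \<in> X" for x
        using that by (metis compose_eq)
      then have "k' = d"
        by (intro PiE_eqI[OF k'(2) dY]) (use arr de in auto)
      then show "k = (Y, d, Z)" using k' by simp
    qed
  qed
qed

lemma factorized_set_cat:
  assumes "grothendieck_universe TYPE('u)"
  shows "factorized_category TYPE('u) (set_cat :: ('u set, 'u set_arrow) cat) surjections injections"
  unfolding factorized_category_def locally_small_def
proof (intro conjI ballI impI)
  fix X Y :: "'u set" assume XY: "X \<in> Obj set_cat" "Y \<in> Obj set_cat"
  have "Hom set_cat X Y = (\<lambda>f. (X, f, Y)) ` (X \<rightarrow>\<^sub>E Y)"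
    using XY by (auto simp: in_Hom_iff elim!: set_HomE)
  then show "small TYPE('u) (Hom set_cat X Y)"
    using small_image[OF small_PiE[OF assms]] XY by simp
next
  fix m n :: "'u set_arrow"
  assume m: "m \<in> injections" "n \<in> injections" "Cod set_cat m = Cod set_cat n"
  then show "\<exists>p q. is_pullback set_cat m n p q"
    by (cases m; cases n) (auto simp: injections_iff intro!: set_pullback_ex simp del: Product_Type.split_paired_Ex)
next
  fix m n :: "'u set_arrow"
  assume m: "m \<in> surjections" "n \<in> surjections" "Dom set_cat m = Dom set_cat n"
  then show "\<exists>p q. is_pushout set_cat m n p q"
    by (cases m; cases n) (auto simp: surjections_iff intro!: set_pushout_ex simp del: Product_Type.split_paired_Ex)
qed (rule category_set_cat set_proper_factorization_system)+

section \<open>The set-valued functor of a noetherian form\<close>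

locale noetherian_inducing = factorized "TYPE('u)" C E M
  for C :: "('o, 'm) cat" (structure) and E M :: "'m set" +
  fixes F :: "('o, 'm, 'u) form"
  assumes univ: "grothendieck_universe TYPE('u)"
    and form: "is_form TYPE('u) C F"
    and noeth: "noetherian C F"
    and quotients: "form_quotients C F = E"
    and embeddings: "form_embeddings C F = M"
begin

abbreviation fibre :: "'o \<Rightarrow> 'u set" where "fibre X \<equiv> carrier (fib F X)"

section \<open>Calculus of direct and inverse images in a noetherian form\<close>

lemma lat: "X \<in> Obj C \<Longrightarrow> bounded_lattice (fib F X)"
  and fibre_small: "X \<in> Obj C \<Longrightarrow> small TYPE('u) (fibre X)"
  using form unfolding is_form_def by auto

lemma form_arr:
  assumes "f \<in> Arr C"
  shows "S \<in> fibre (Dom C f) \<Longrightarrow> dir F f S \<in> fibre (Cod C f)"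
    and "R \<in> fibre (Cod C f) \<Longrightarrow> inv_im F f R \<in> fibre (Dom C f)"
    and "isotone (fib F (Dom C f)) (fib F (Cod C f)) (dir F f)"
    and "isotone (fib F (Cod C f)) (fib F (Dom C f)) (inv_im F f)"
    and "S \<in> fibre (Dom C f) \<Longrightarrow> R \<in> fibre (Cod C f) \<Longrightarrow>
      dir F f S \<sqsubseteq>\<^bsub>fib F (Cod C f)\<^esub> R \<longleftrightarrow> S \<sqsubseteq>\<^bsub>fib F (Dom C f)\<^esub> inv_im F f R"
    and "S \<in> fibre (Dom C f) \<Longrightarrow> inv_im F f (dir F f S) = S \<squnion>\<^bsub>fib F (Dom C f)\<^esub> Ker C F f"
    and "R \<in> fibre (Cod C f) \<Longrightarrow> dir F f (inv_im F f R) = R \<sqinter>\<^bsub>fib F (Cod C f)\<^esub> Im C F f"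
proof -
  have O: "Dom C f \<in> Obj C" "Cod C f \<in> Obj C" "f \<in> Hom C (Dom C f) (Cod C f)"
    using assms by (auto simp: in_Hom_iff)
  have "dir F f \<in> fibre (Dom C f) \<rightarrow> fibre (Cod C f)" "inv_im F f \<in> fibre (Cod C f) \<rightarrow> fibre (Dom C f)"
    using form O unfolding is_form_def by blast+
  then show "S \<in> fibre (Dom C f) \<Longrightarrow> dir F f S \<in> fibre (Cod C f)"
    "R \<in> fibre (Cod C f) \<Longrightarrow> inv_im F f R \<in> fibre (Dom C f)" by auto
  show "isotone (fib F (Dom C f)) (fib F (Cod C f)) (dir F f)"
    "isotone (fib F (Cod C f)) (fib F (Dom C f)) (inv_im F f)"
    "S \<in> fibre (Dom C f) \<Longrightarrow> R \<in> fibre (Cod C f) \<Longrightarrow>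
      dir F f S \<sqsubseteq>\<^bsub>fib F (Cod C f)\<^esub> R \<longleftrightarrow> S \<sqsubseteq>\<^bsub>fib F (Dom C f)\<^esub> inv_im F f R"
    using form O unfolding is_form_def by blast+
  show "S \<in> fibre (Dom C f) \<Longrightarrow> inv_im F f (dir F f S) = S \<squnion>\<^bsub>fib F (Dom C f)\<^esub> Ker C F f"
    "R \<in> fibre (Cod C f) \<Longrightarrow> dir F f (inv_im F f R) = R \<sqinter>\<^bsub>fib F (Cod C f)\<^esub> Im C F f"
    using noeth O unfolding noetherian_def by blast+
qed

lemmas dir_closed [simp] = form_arr(1) and inv_closed [simp] = form_arr(2)

lemma dir_mono: "f \<in> Arr C \<Longrightarrow> S \<in> fibre (Dom C f) \<Longrightarrow> R \<in> fibre (Dom C f) \<Longrightarrow>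
    S \<sqsubseteq>\<^bsub>fib F (Dom C f)\<^esub> R \<Longrightarrow> dir F f S \<sqsubseteq>\<^bsub>fib F (Cod C f)\<^esub> dir F f R"
  by (rule use_iso2[OF form_arr(3)])

lemma inv_mono: "f \<in> Arr C \<Longrightarrow> S \<in> fibre (Cod C f) \<Longrightarrow> R \<in> fibre (Cod C f) \<Longrightarrow>
    S \<sqsubseteq>\<^bsub>fib F (Cod C f)\<^esub> R \<Longrightarrow> inv_im F f S \<sqsubseteq>\<^bsub>fib F (Dom C f)\<^esub> inv_im F f R"
  by (rule use_iso2[OF form_arr(4)])

lemma top_fibre [simp]: "X \<in> Obj C \<Longrightarrow> \<top>\<^bsub>fib F X\<^esub> \<in> fibre X"
  and bottom_fibre [simp]: "X \<in> Obj C \<Longrightarrow> \<bottom>\<^bsub>fib F X\<^esub> \<in> fibre X"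
proof -
  assume "X \<in> Obj C"
  then interpret bounded_lattice "fib F X" by (rule lat)
  show "\<top>\<^bsub>fib F X\<^esub> \<in> fibre X" "\<bottom>\<^bsub>fib F X\<^esub> \<in> fibre X" by simp_all
qed

lemma Im_fibre [simp]: "f \<in> Arr C \<Longrightarrow> Cod C f = X \<Longrightarrow> Im C F f \<in> fibre X"
  and Ker_fibre [simp]: "f \<in> Arr C \<Longrightarrow> Dom C f = X \<Longrightarrow> Ker C F f \<in> fibre X"
  unfolding Im_def Ker_def by auto

lemma dir_Comp:
  assumes "f \<in> Arr C" "g \<in> Arr C" "Dom C g = Cod C f" "S \<in> fibre (Dom C f)"
  shows "dir F (g \<cdot> f) S = dir F g (dir F f S)"
proof -
  have "f \<in> Hom C (Dom C f) (Cod C f)" "g \<in> Hom C (Cod C f) (Cod C g)"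
    "Dom C f \<in> Obj C" "Cod C f \<in> Obj C" "Cod C g \<in> Obj C"
    using assms by (auto simp: in_Hom_iff)
  then show ?thesis using form assms(4) unfolding is_form_def by blast
qed

lemma inv_Comp:
  assumes "f \<in> Arr C" "g \<in> Arr C" "Dom C g = Cod C f" "R \<in> fibre (Cod C g)"
  shows "inv_im F (g \<cdot> f) R = inv_im F f (inv_im F g R)"
proof -
  have "f \<in> Hom C (Dom C f) (Cod C f)" "g \<in> Hom C (Cod C f) (Cod C g)"
    "Dom C f \<in> Obj C" "Cod C f \<in> Obj C" "Cod C g \<in> Obj C"
    using assms by (auto simp: in_Hom_iff)
  then show ?thesis using form assms(4) unfolding is_form_def by blast
qed

lemma dir_Id: "X \<in> Obj C \<Longrightarrow> S \<in> fibre X \<Longrightarrow> dir F (Id C X) S = S"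
  and inv_Id: "X \<in> Obj C \<Longrightarrow> S \<in> fibre X \<Longrightarrow> inv_im F (Id C X) S = S"
  using form unfolding is_form_def by blast+

lemma Im_Id: "X \<in> Obj C \<Longrightarrow> Im C F (Id C X) = \<top>\<^bsub>fib F X\<^esub>"
  and Ker_Id: "X \<in> Obj C \<Longrightarrow> Ker C F (Id C X) = \<bottom>\<^bsub>fib F X\<^esub>"
  by (simp_all add: Im_def Ker_def dir_Id inv_Id)

lemma Im_Comp_le:
  assumes "f \<in> Arr C" "g \<in> Arr C" "Dom C g = Cod C f"
  shows "Im C F (g \<cdot> f) \<sqsubseteq>\<^bsub>fib F (Cod C g)\<^esub> Im C F g"
proof -
  interpret L: bounded_lattice "fib F (Cod C f)" using assms by (simp add: lat)
  have "dir F f \<top>\<^bsub>fib F (Dom C f)\<^esub> \<sqsubseteq>\<^bsub>fib F (Cod C f)\<^esub> \<top>\<^bsub>fib F (Cod C f)\<^esub>"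
    using assms by simp
  then have "dir F g (dir F f \<top>\<^bsub>fib F (Dom C f)\<^esub>) \<sqsubseteq>\<^bsub>fib F (Cod C g)\<^esub> dir F g \<top>\<^bsub>fib F (Cod C f)\<^esub>"
    using dir_mono[OF assms(2), of "dir F f \<top>\<^bsub>fib F (Dom C f)\<^esub>" "\<top>\<^bsub>fib F (Cod C f)\<^esub>"] assms by simp
  then show ?thesis using assms by (simp add: Im_def dir_Comp)
qed

lemma Ker_Comp_ge:
  assumes "f \<in> Arr C" "g \<in> Arr C" "Dom C g = Cod C f"
  shows "Ker C F f \<sqsubseteq>\<^bsub>fib F (Dom C f)\<^esub> Ker C F (g \<cdot> f)"
proof -
  interpret L: bounded_lattice "fib F (Cod C f)" using assms by (simp add: lat)
  have "\<bottom>\<^bsub>fib F (Cod C f)\<^esub> \<sqsubseteq>\<^bsub>fib F (Cod C f)\<^esub> inv_im F g \<bottom>\<^bsub>fib F (Cod C g)\<^esub>"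
    using assms form_arr(2)[OF assms(2), of "\<bottom>\<^bsub>fib F (Cod C g)\<^esub>"] by simp
  then have "inv_im F f \<bottom>\<^bsub>fib F (Cod C f)\<^esub> \<sqsubseteq>\<^bsub>fib F (Dom C f)\<^esub> inv_im F f (inv_im F g \<bottom>\<^bsub>fib F (Cod C g)\<^esub>)"
    using inv_mono[OF assms(1), of "\<bottom>\<^bsub>fib F (Cod C f)\<^esub>"] assms
      form_arr(2)[OF assms(2), of "\<bottom>\<^bsub>fib F (Cod C g)\<^esub>"] by simp
  then show ?thesis using assms by (simp add: Ker_def inv_Comp)
qed

lemma form_factorE:
  assumes "f \<in> Arr C"
  obtains e m where "e \<in> E" "m \<in> M" "e \<in> Arr C" "m \<in> Arr C" "Dom C e = Dom C f" "Dom C m = Cod C e"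
    "Cod C m = Cod C f" "m \<cdot> e = f"
    "is_quotient C F (Dom C f) (Ker C F f) e" "is_embedding C F (Cod C f) (Im C F f) m"
    "Ker C F e = Ker C F f" "Im C F m = Im C F f"
proof -
  obtain e m where em: "Dom C m = Cod C e" "m \<cdot> e = f"
    "is_quotient C F (Dom C f) (Ker C F f) e" "is_embedding C F (Cod C f) (Im C F f) m"
    using assms noeth unfolding noetherian_def by metis
  have "e \<in> E" "m \<in> M"
    unfolding quotients[symmetric] embeddings[symmetric] form_quotients_def form_embeddings_def
    using em(3,4) Dom_in_Obj[OF assms] Cod_in_Obj[OF assms] by blast+
  moreover have "Dom C e = Dom C f" "Ker C F e = Ker C F f" "Cod C m = Cod C f" "Im C F m = Im C F f"
    using em unfolding is_quotient_def is_embedding_def by auto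
  ultimately show ?thesis using that em by simp
qed

text \<open>Orthogonality of \<open>e\<close> against \<open>m\<close> gives a retraction of the
  quotient part \<open>e\<close> of \<open>m\<close>. Hence the kernel of \<open>e\<close>, which is
  that of \<open>m\<close>, lies below the kernel of an identity.\<close>

lemma M_Ker:
  assumes m: "m \<in> M"
  shows "Ker C F m = \<bottom>\<^bsub>fib F (Dom C m)\<^esub>"
proof -
  have "m \<in> Arr C" using m by simp
  then obtain e n where e: "e \<in> E" and [simp]: "n \<in> M" "e \<in> Arr C" "n \<in> Arr C"
    "Dom C e = Dom C m" "Dom C n = Cod C e" "Cod C n = Cod C m" and ne: "n \<cdot> e = m"
    and K: "Ker C F e = Ker C F m" by (rule form_factorE)
  obtain d where d [simp]: "d \<in> Arr C" "Dom C d = Cod C e" "Cod C d = Dom C m"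
    and de: "d \<cdot> e = Id C (Dom C m)"
    by (rule liftE[OF e m, of "Id C (Dom C m)" n]) (use m ne in simp_all)
  interpret L: bounded_lattice "fib F (Dom C m)" using m by (simp add: lat)
  have "Ker C F m \<sqsubseteq>\<^bsub>fib F (Dom C m)\<^esub> \<bottom>\<^bsub>fib F (Dom C m)\<^esub>"
    using Ker_Comp_ge[of e d] m by (simp add: de K Ker_Id)
  then show ?thesis
    by (intro L.le_antisym) (use m in simp_all)
qed

lemma E_Im:
  assumes e: "e \<in> E"
  shows "Im C F e = \<top>\<^bsub>fib F (Cod C e)\<^esub>"
proof -
  have "e \<in> Arr C" using e by simp
  then obtain d m where m: "m \<in> M" and [simp]: "d \<in> E" "d \<in> Arr C" "m \<in> Arr C"
    "Dom C d = Dom C e" "Dom C m = Cod C d" "Cod C m = Cod C e" and md: "m \<cdot> d = e"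
    and I: "Im C F m = Im C F e" using form_factorE by metis
  obtain k where k [simp]: "k \<in> Arr C" "Dom C k = Cod C e" "Cod C k = Dom C m"
    and mk: "m \<cdot> k = Id C (Cod C e)"
    by (rule liftE[OF e m, of d "Id C (Cod C e)"]) (use e md in simp_all)
  interpret L: bounded_lattice "fib F (Cod C e)" using e by (simp add: lat)
  have "\<top>\<^bsub>fib F (Cod C e)\<^esub> \<sqsubseteq>\<^bsub>fib F (Cod C e)\<^esub> Im C F e"
    using Im_Comp_le[of k m] e by (simp add: mk I Im_Id)
  then show ?thesis
    by (intro L.le_antisym) (use e in simp_all)
qed

text \<open>(N1) with top image makes \<open>f^*\<close> a section of \<open>f_!\<close>; in
  \<open>dir_retract\<close> bottom kernel makes it a retraction. This is why \<open>E\<close> goes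
  to surjections and \<open>M\<close> to injections.\<close>

lemma dir_section:
  assumes "f \<in> Arr C" "Im C F f = \<top>\<^bsub>fib F (Cod C f)\<^esub>" "R \<in> fibre (Cod C f)"
  shows "dir F f (inv_im F f R) = R"
proof -
  interpret L: bounded_lattice "fib F (Cod C f)" using assms by (simp add: lat)
  show ?thesis using form_arr(7)[OF assms(1,3)] assms L.top_meet[of R]
    by (simp add: L.eq_is_equal meet_comm)
qed

lemma dir_surj: "e \<in> E \<Longrightarrow> dir F e ` fibre (Dom C e) = fibre (Cod C e)"
  using dir_section[OF E_arr E_Im] dir_closed inv_closed[OF E_arr]
  by (auto simp: image_iff) (metis inv_closed E_arr)

lemma dir_retract:
  assumes "f \<in> Arr C" "Ker C F f = \<bottom>\<^bsub>fib F (Dom C f)\<^esub>" "S \<in> fibre (Dom C f)"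
  shows "inv_im F f (dir F f S) = S"
proof -
  interpret L: bounded_lattice "fib F (Dom C f)" using assms by (simp add: lat)
  show ?thesis using form_arr(6)[OF assms(1,3)] assms L.bottom_join[of S]
    by (simp add: L.eq_is_equal join_comm)
qed

lemma dir_inj: "m \<in> M \<Longrightarrow> inj_on (dir F m) (fibre (Dom C m))"
  by (rule inj_on_inverseI[of _ "inv_im F m"]) (simp add: dir_retract M_Ker)

lemma dir_split_inj:
  assumes "f \<in> Arr C" "k \<in> Arr C" "Dom C k = Cod C f" "k \<cdot> f = Id C (Dom C f)"
  shows "inj_on (dir F f) (fibre (Dom C f))"
proof (rule inj_on_inverseI[of _ "dir F k"])
  fix S assume "S \<in> fibre (Dom C f)"
  then show "dir F k (dir F f S) = S" using dir_Comp[of f k S] assms by (simp add: dir_Id)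
qed

section \<open>The functor of fibres and its preservation properties\<close>

definition fibre_functor :: "('o, 'm, 'u set, 'u set_arrow) cfunctor" where
  "fibre_functor = \<lparr> OMap = fibre,
     AMap = (\<lambda>f. (fibre (Dom C f), restrict (dir F f) (fibre (Dom C f)), fibre (Cod C f))) \<rparr>"

lemma OMap_fibre: "OMap fibre_functor X = fibre X"
  and AMap_fibre: "AMap fibre_functor f =
    (fibre (Dom C f), restrict (dir F f) (fibre (Dom C f)), fibre (Cod C f))"
  by (simp_all add: fibre_functor_def)

lemma AMap_arr: "f \<in> Arr C \<Longrightarrow>
    (fibre (Dom C f), restrict (dir F f) (fibre (Dom C f)), fibre (Cod C f)) \<in> Arr set_cat"
  by (simp add: fibre_small)

lemma fibre_is_functor: "is_functor C set_cat fibre_functor"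
  unfolding is_functor_def
proof (intro conjI ballI impI)
  show "category C" by (rule category_axioms)
  show "category (set_cat :: ('u set, 'u set_arrow) cat)" by (rule category_set_cat)
  fix X assume X: "X \<in> Obj C"
  show "OMap fibre_functor X \<in> Obj set_cat" using X by (simp add: OMap_fibre fibre_small)
  show "AMap fibre_functor (Id C X) = Id set_cat (OMap fibre_functor X)"
    using X by (auto simp: OMap_fibre AMap_fibre dir_Id)
next
  fix f assume f: "f \<in> Arr C"
  show "AMap fibre_functor f \<in> Hom set_cat (OMap fibre_functor (Dom C f)) (OMap fibre_functor (Cod C f))"
    using AMap_arr[OF f] unfolding in_Hom_iff AMap_fibre OMap_fibre by simp
  fix g assume g: "g \<in> Arr C" "Dom C g = Cod C f"
  show "AMap fibre_functor (g \<cdot> f) = AMap fibre_functor g \<cdot>\<^bsub>set_cat\<^esub> AMap fibre_functor f"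
    using f g by (auto simp: AMap_fibre compose_def dir_Comp intro!: restrict_ext)
qed

text \<open>Both the kernel and the bottom are sent to the bottom, so injectivity makes the kernel
  bottom; surjectivity makes the image top. In the factorization from (N2) the identity of the
  domain then factors through the quotient \<open>e\<close> and the identity of the codomain through
  the embedding \<open>m\<close>, so both are invertible.\<close>

lemma iso_if_dir_bij:
  assumes f: "f \<in> Arr C" and bij: "bij_betw (dir F f) (fibre (Dom C f)) (fibre (Cod C f))"
  shows "f \<in> isomorphisms C"
proof -
  let ?X = "Dom C f" and ?Y = "Cod C f"
  interpret X: bounded_lattice "fib F ?X" using f by (simp add: lat)
  interpret Y: bounded_lattice "fib F ?Y" using f by (simp add: lat)
  have [simp]: "?X \<in> Obj C" "?Y \<in> Obj C" using f by simp_all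
  have "dir F f \<bottom>\<^bsub>fib F ?X\<^esub> \<sqsubseteq>\<^bsub>fib F ?Y\<^esub> \<bottom>\<^bsub>fib F ?Y\<^esub>"
    using form_arr(5)[OF f, of "\<bottom>\<^bsub>fib F ?X\<^esub>" "\<bottom>\<^bsub>fib F ?Y\<^esub>"] f by simp
  then have "dir F f \<bottom>\<^bsub>fib F ?X\<^esub> = \<bottom>\<^bsub>fib F ?Y\<^esub>"
    by (intro Y.le_antisym) (use f in simp_all)
  moreover have "dir F f (Ker C F f) \<sqsubseteq>\<^bsub>fib F ?Y\<^esub> \<bottom>\<^bsub>fib F ?Y\<^esub>"
    using form_arr(5)[OF f, of "Ker C F f" "\<bottom>\<^bsub>fib F ?Y\<^esub>"] f by (simp add: Ker_def[symmetric])
  then have "dir F f (Ker C F f) = \<bottom>\<^bsub>fib F ?Y\<^esub>"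
    by (intro Y.le_antisym) (use f in simp_all)
  ultimately have K: "Ker C F f = \<bottom>\<^bsub>fib F ?X\<^esub>"
    using bij f by (auto simp: bij_betw_def inj_on_def)
  obtain S where S: "S \<in> fibre ?X" "dir F f S = \<top>\<^bsub>fib F ?Y\<^esub>"
    using bij bij_betw_imp_surj_on[OF bij] top_fibre[of ?Y] by (metis \<open>?Y \<in> Obj C\<close> imageE)
  have "dir F f S \<sqsubseteq>\<^bsub>fib F ?Y\<^esub> Im C F f"
    unfolding Im_def using dir_mono[OF f S(1), of "\<top>\<^bsub>fib F ?X\<^esub>"] S by simp
  then have I: "Im C F f = \<top>\<^bsub>fib F ?Y\<^esub>"
    unfolding S by (intro Y.le_antisym) (use f in simp_all)
  obtain e m where e: "e \<in> E" and m: "m \<in> M" and [simp]: "e \<in> Arr C" "m \<in> Arr C"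
    "Dom C e = ?X" "Dom C m = Cod C e" "Cod C m = ?Y" and me: "m \<cdot> e = f"
    and q: "is_quotient C F ?X (Ker C F f) e" and i: "is_embedding C F ?Y (Im C F f) m"
    using form_factorE[OF f] .
  have "Ker C F f \<sqsubseteq>\<^bsub>fib F ?X\<^esub> Ker C F (Id C ?X)" using K by (simp add: Ker_Id)
  then obtain h where "h \<in> Hom C (Cod C e) ?X" "Id C ?X = h \<cdot> e"
    using q arr_Id[of ?X] dom_Id[of ?X] cod_Id[of ?X] unfolding is_quotient_def
    by (metis \<open>?X \<in> Obj C\<close>)
  then have "e \<in> isomorphisms C"
    by (intro epi_split_mono_iso[OF E_epi[OF e], of h]) (auto simp: in_Hom_iff)
  have "Im C F (Id C ?Y) \<sqsubseteq>\<^bsub>fib F ?Y\<^esub> Im C F f" using I by (simp add: Im_Id)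
  then obtain k where "k \<in> Hom C ?Y (Dom C m)" "Id C ?Y = m \<cdot> k"
    using i arr_Id[of ?Y] dom_Id[of ?Y] cod_Id[of ?Y] unfolding is_embedding_def
    by (metis \<open>?Y \<in> Obj C\<close>)
  then have "m \<in> isomorphisms C"
    by (intro mono_split_epi_iso[OF M_mono[OF m], of k]) (auto simp: in_Hom_iff)
  then show ?thesis using iso_Comp[OF \<open>e \<in> isomorphisms C\<close>, of m] me by simp
qed

text \<open>The usual proof that right classes are stable under pullback, read on direct images.
  Orthogonality lifts \<open>q\<close> along the quotient part \<open>e\<close> of \<open>p\<close>,
  and the universal property turns the lift into a retraction \<open>k\<close> of \<open>e\<close>.
  So \<open>e\<close> has an injective direct image, and so has the embedding part
  \<open>l\<close>.\<close>

lemma dir_pullback_inj: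
  assumes pb: "is_pullback C m n p q" and mn: "m \<in> M" "n \<in> M"
  shows "inj_on (dir F p) (fibre (Dom C p))"
proof -
  note [simp] = pullback_arrs[OF pb]
  note sq = pullback_comm[OF pb]
  have "p \<in> Arr C" by simp
  then obtain e l where e: "e \<in> E" and l: "l \<in> M" and [simp]: "e \<in> Arr C" "l \<in> Arr C"
    "Dom C e = Dom C p" "Dom C l = Cod C e" "Cod C l = Cod C p" and le: "l \<cdot> e = p"
    by (rule form_factorE)
  have "n \<cdot> q = (m \<cdot> l) \<cdot> e" using sq le by simp
  then obtain d where [simp]: "d \<in> Arr C" "Dom C d = Cod C e" "Cod C d = Dom C n"
    and de: "d \<cdot> e = q" and nd: "n \<cdot> d = m \<cdot> l"
    by - (rule liftE[OF e mn(2), of q "m \<cdot> l"], simp_all)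
  obtain k where [simp]: "k \<in> Arr C" "Dom C k = Dom C l" "Cod C k = Dom C p"
    and pk: "p \<cdot> k = l" and qk: "q \<cdot> k = d"
    by (rule pullbackE[OF pb, of l d]) (simp_all add: nd)
  have "k \<cdot> e = Id C (Dom C p)"
    by (rule pullback_ext[OF pb]) (simp_all add: assoc_eq1[OF pk] assoc_eq1[OF qk] le de)
  then have "inj_on (dir F e) (fibre (Dom C p))" using dir_split_inj[of e k] by simp
  moreover have "inj_on (dir F l) (dir F e ` fibre (Dom C p))"
    by (rule inj_on_subset[OF dir_inj[OF l]]) (use dir_closed[of e] in auto)
  ultimately have "inj_on (dir F l \<circ> dir F e) (fibre (Dom C p))" by (rule comp_inj_on)
  then show ?thesis
    using dir_Comp[of e l] by (simp add: le inj_on_def)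
qed

text \<open>Dually, the embedding part \<open>l\<close> of \<open>p\<close> acquires a section
  \<open>r\<close>. A cluster \<open>R\<close> is hit by first lifting its image under
  \<open>r\<close> along the surjective direct image of \<open>c\<close>.\<close>

lemma dir_pushout_surj:
  assumes po: "is_pushout C d e p q" and de: "d \<in> E" "e \<in> E"
  shows "dir F p ` fibre (Dom C p) = fibre (Cod C p)"
proof -
  note [simp] = pushout_arrs[OF po]
  note sq = pushout_comm[OF po]
  have "p \<in> Arr C" by simp
  then obtain c l where c: "c \<in> E" and l: "l \<in> M" and [simp]: "c \<in> Arr C" "l \<in> Arr C"
    "Dom C c = Dom C p" "Dom C l = Cod C c" "Cod C l = Cod C p" and lc: "l \<cdot> c = p"
    by (rule form_factorE)
  have "l \<cdot> (c \<cdot> d) = q \<cdot> e" using sq assoc_eq1[OF lc, of d] by simp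
  then obtain k where [simp]: "k \<in> Arr C" "Dom C k = Cod C e" "Cod C k = Dom C l"
    and ke: "k \<cdot> e = c \<cdot> d" and lk: "l \<cdot> k = q"
    by - (rule liftE[OF de(2) l, of "c \<cdot> d" q], simp_all)
  obtain r where [simp]: "r \<in> Arr C" "Dom C r = Cod C p" "Cod C r = Cod C c"
    and rp: "r \<cdot> p = c" and rq: "r \<cdot> q = k"
    by (rule pushoutE[OF po, of c k]) (simp_all add: ke)
  have lr: "l \<cdot> r = Id C (Cod C p)"
    by (rule pushout_ext[OF po]) (simp_all add: rp rq lc lk)
  have "R \<in> dir F p ` fibre (Dom C p)" if R: "R \<in> fibre (Cod C p)" for R
  proof -
    obtain S where S: "S \<in> fibre (Dom C p)" "dir F c S = dir F r R"
      using dir_surj[OF c] dir_closed[of r R] R by (metis imageE \<open>Cod C r = Cod C c\<close>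
        \<open>Dom C c = Dom C p\<close> \<open>Dom C r = Cod C p\<close> \<open>r \<in> Arr C\<close>)
    have "dir F p S = dir F l (dir F r R)"
      using dir_Comp[of c l S] S by (simp add: lc)
    also have "\<dots> = R" using dir_Comp[of r l R] R by (simp add: lr dir_Id)
    finally show ?thesis using S by blast
  qed
  then show ?thesis using dir_closed[of p] by auto
qed

text \<open>The common value of \<open>S\<close> and \<open>R\<close> lies below the images of
  \<open>m\<close> and \<open>n\<close>. By (N3) the meet of these images is the image of an arrow,
  and the embedding properties make it factor through the pullback. So the common value lies below
  the image of the diagonal \<open>d\<close>, and by (N1) its inverse image under \<open>d\<close>
  is the point sought.\<close>

lemma fibre_pullback:
  assumes pb: "is_pullback C m n p q" and mn: "m \<in> M" "n \<in> M"
  shows "is_pullback set_cat (AMap fibre_functor m) (AMap fibre_functor n)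
    (AMap fibre_functor p) (AMap fibre_functor q)"
proof -
  note [simp] = pullback_arrs(1-4,6-8)[OF pb] pullback_arrs(5)[OF pb, symmetric]
  note sq = pullback_comm[OF pb]
  let ?X = "Cod C m"
  interpret X: bounded_lattice "fib F ?X" by (simp add: lat)
  have sq': "dir F m (dir F p r) = dir F n (dir F q r)" if "r \<in> fibre (Dom C p)" for r
    using dir_Comp[of p m r] dir_Comp[of q n r] that sq by simp
  have ex: "\<exists>r\<in>fibre (Dom C p). dir F p r = S \<and> dir F q r = R"
    if S: "S \<in> fibre (Dom C m)" and R: "R \<in> fibre (Dom C n)" and eq: "dir F m S = dir F n R" for S R
  proof -
    have "conormal C F ?X (Im C F m)"
      unfolding conormal_def by (rule bexI[of _ m]) simp_all
    moreover have "conormal C F ?X (Im C F n)"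
      unfolding conormal_def by (rule bexI[of _ n]) simp_all
    ultimately have "conormal C F ?X (Im C F m \<sqinter>\<^bsub>fib F ?X\<^esub> Im C F n)"
      using noeth Cod_in_Obj[of m] unfolding noetherian_def by simp
    then obtain f where f: "f \<in> Arr C" "Cod C f = ?X" "Im C F f = Im C F m \<sqinter>\<^bsub>fib F ?X\<^esub> Im C F n"
      unfolding conormal_def by blast
    obtain e i where i [simp]: "i \<in> Arr C" "Cod C i = ?X"
      and Ii: "Im C F i = Im C F m \<sqinter>\<^bsub>fib F ?X\<^esub> Im C F n"
      using form_factorE[OF f(1)] f by metis
    have emb: "is_embedding C F (Cod C l) (Im C F l) l" if l: "l \<in> M" for l
    proof -
      obtain Y T where "is_embedding C F Y T l"
        using l unfolding embeddings[symmetric] form_embeddings_def by blast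
      then show ?thesis unfolding is_embedding_def by blast
    qed
    have le: "Im C F i \<sqsubseteq>\<^bsub>fib F ?X\<^esub> Im C F m" "Im C F i \<sqsubseteq>\<^bsub>fib F ?X\<^esub> Im C F n"
      unfolding Ii using X.meet_left[of "Im C F m" "Im C F n"] X.meet_right[of "Im C F m" "Im C F n"]
      by simp_all
    obtain a where "a \<in> Hom C (Dom C i) (Dom C m)" "i = m \<cdot> a"
      using emb[OF mn(1)] le(1) i unfolding is_embedding_def by metis
    moreover obtain b where "b \<in> Hom C (Dom C i) (Dom C n)" "i = n \<cdot> b"
      using emb[OF mn(2)] le(2) i pullback_arrs(5)[OF pb] unfolding is_embedding_def by metis
    ultimately have a: "a \<in> Arr C" "Dom C a = Dom C i" "Cod C a = Dom C m" "m \<cdot> a = i"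
      and b: "b \<in> Arr C" "Dom C b = Dom C i" "Cod C b = Dom C n" "n \<cdot> b = i"
      unfolding in_Hom_iff by metis+
    obtain h where h [simp]: "h \<in> Arr C" "Dom C h = Dom C a" "Cod C h = Dom C p" and ph: "p \<cdot> h = a"
      by (rule pullbackE[OF pb a(1) b(1)]) (use a b in simp_all)
    \<comment> \<open>The diagonal of the pullback square.\<close>
    define d where "d = m \<cdot> p"
    have d [simp]: "d \<in> Arr C" "Dom C d = Dom C p" "Cod C d = ?X" by (simp_all add: d_def)
    have "d \<cdot> h = i" using a ph by (simp add: d_def)
    then have id: "Im C F i \<sqsubseteq>\<^bsub>fib F ?X\<^esub> Im C F d" using Im_Comp_le[of h d] by simp
    let ?Z = "dir F m S"
    have Z: "?Z \<in> fibre ?X" using S dir_closed[of m S] by simp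
    have "?Z \<sqsubseteq>\<^bsub>fib F ?X\<^esub> Im C F m"
    proof -
      interpret A: bounded_lattice "fib F (Dom C m)" by (simp add: lat)
      show ?thesis
        unfolding Im_def using dir_mono[of m S "\<top>\<^bsub>fib F (Dom C m)\<^esub>"] S by simp
    qed
    moreover have "dir F n R \<sqsubseteq>\<^bsub>fib F ?X\<^esub> Im C F n"
    proof -
      interpret B: bounded_lattice "fib F (Dom C n)" by (simp add: lat)
      show ?thesis
        unfolding Im_def using dir_mono[of n R "\<top>\<^bsub>fib F (Dom C n)\<^esub>"] R by simp
    qed
    ultimately have "?Z \<sqsubseteq>\<^bsub>fib F ?X\<^esub> Im C F i"
      unfolding Ii using Z eq by (intro X.meet_le) simp_all
    then have "?Z \<sqsubseteq>\<^bsub>fib F ?X\<^esub> Im C F d" by (rule X.le_trans[OF _ id]) (use Z in simp_all)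
    then have "?Z \<sqinter>\<^bsub>fib F ?X\<^esub> Im C F d = ?Z"
      using X.le_iff_join[of ?Z "Im C F d"] X.le_iff_meet[of ?Z "Im C F d"] Z by simp
    then have dd: "dir F d (inv_im F d ?Z) = ?Z"
      using form_arr(7)[of d ?Z] Z by simp
    have r: "inv_im F d ?Z \<in> fibre (Dom C p)" using inv_closed[of d ?Z] Z by simp
    have "dir F m (dir F p (inv_im F d ?Z)) = dir F m S"
      using dir_Comp[of p m "inv_im F d ?Z"] dd r by (simp add: d_def)
    then have "dir F p (inv_im F d ?Z) = S"
      using inj_onD[OF dir_inj[OF mn(1)], of "dir F p (inv_im F d ?Z)" S] dir_closed[of p] r S by simp
    moreover have "dir F n (dir F q (inv_im F d ?Z)) = dir F n R"
      using dir_Comp[of q n "inv_im F d ?Z"] dd r eq by (simp add: d_def sq)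
    then have "dir F q (inv_im F d ?Z) = R"
      using inj_onD[OF dir_inj[OF mn(2)], of "dir F q (inv_im F d ?Z)" R] dir_closed[of q] r R by simp
    ultimately show ?thesis using r by blast
  qed
  have inj: "inj_on (dir F p) (fibre (Dom C p))" by (rule dir_pullback_inj[OF pb mn])
  have pq: "dir F p r \<in> fibre (Dom C m)" "dir F q r \<in> fibre (Dom C n)" if "r \<in> fibre (Dom C p)" for r
    using dir_closed[of p r] dir_closed[of q r] that by simp_all
  have arrs: "AMap fibre_functor m = (fibre (Dom C m), restrict (dir F m) (fibre (Dom C m)), fibre ?X)"
    "AMap fibre_functor n = (fibre (Dom C n), restrict (dir F n) (fibre (Dom C n)), fibre ?X)"
    "AMap fibre_functor p = (fibre (Dom C p), restrict (dir F p) (fibre (Dom C p)), fibre (Dom C m))"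
    "AMap fibre_functor q = (fibre (Dom C p), restrict (dir F q) (fibre (Dom C p)), fibre (Dom C n))"
    by (simp_all add: AMap_fibre)
  have arrs': "AMap fibre_functor l \<in> Arr set_cat" if "l \<in> Arr C" for l
    using AMap_arr[OF that] unfolding AMap_fibre .
  show ?thesis
    unfolding arrs
  proof (rule set_pullbackI)
    fix S R assume "S \<in> fibre (Dom C m)" "R \<in> fibre (Dom C n)"
      "restrict (dir F m) (fibre (Dom C m)) S = restrict (dir F n) (fibre (Dom C n)) R"
    then obtain r where "r \<in> fibre (Dom C p)" "dir F p r = S" "dir F q r = R"
      using ex[of S R] by auto
    then show "\<exists>r\<in>fibre (Dom C p). restrict (dir F p) (fibre (Dom C p)) r = S \<and>
        restrict (dir F q) (fibre (Dom C p)) r = R" by auto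
  next
    fix r r' assume "r \<in> fibre (Dom C p)" "r' \<in> fibre (Dom C p)"
      "restrict (dir F p) (fibre (Dom C p)) r = restrict (dir F p) (fibre (Dom C p)) r'"
    then show "r = r'" using inj by (simp add: inj_on_def)
  qed (use pullback_arrs(1-4)[OF pb, THEN arrs'] sq' pq in \<open>simp_all only: arrs restrict_apply' \<close>)
qed

text \<open>By (N1) two clusters with equal direct images under the diagonal \<open>c\<close> have
  equal joins with the kernel of \<open>c\<close>. It thus suffices that a compatible pair of maps
  does not see the passage from \<open>T\<close> to its join with this kernel.\<close>

lemma fibre_pushout:
  assumes po: "is_pushout C d e p q" and de: "d \<in> E" "e \<in> E"
  shows "is_pushout set_cat (AMap fibre_functor d) (AMap fibre_functor e)
    (AMap fibre_functor p) (AMap fibre_functor q)"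
proof -
  note [simp] = pushout_arrs(1-4,6-8)[OF po] pushout_arrs(5)[OF po, symmetric]
  note sq = pushout_comm[OF po]
  let ?X = "Dom C d"
  interpret X: bounded_lattice "fib F ?X" by (simp add: lat)
  define c where "c = p \<cdot> d"
  have [simp]: "c \<in> Arr C" "Dom C c = ?X" "Cod C c = Cod C p" by (simp_all add: c_def)
  have cS: "dir F p (dir F d S) = dir F c S" "dir F q (dir F e S) = dir F c S" if "S \<in> fibre ?X" for S
    using dir_Comp[of d p S] dir_Comp[of e q S] that sq by (simp_all add: c_def)
  have KdX [simp]: "Ker C F d \<in> fibre ?X" "Ker C F e \<in> fibre ?X" "Ker C F c \<in> fibre ?X" by simp_all
  \<comment> \<open>By (N3) the join of the two kernels is the kernel of some \<open>f\<close>. The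
    quotients \<open>d\<close> and \<open>e\<close> make \<open>f\<close> factor through the
    pushout, so the kernel of \<open>c\<close> is at most this join; the other inequality is
    monotonicity of kernels under composition.\<close>
  have Kc: "Ker C F c = Ker C F d \<squnion>\<^bsub>fib F ?X\<^esub> Ker C F e"
  proof -
    have "normal C F ?X (Ker C F d)"
      unfolding normal_def by (rule bexI[of _ d]) simp_all
    moreover have "normal C F ?X (Ker C F e)"
      unfolding normal_def by (rule bexI[of _ e]) simp_all
    ultimately have "normal C F ?X (Ker C F d \<squnion>\<^bsub>fib F ?X\<^esub> Ker C F e)"
      using noeth Dom_in_Obj[of d] unfolding noetherian_def by simp
    then obtain f where f: "f \<in> Arr C" "Dom C f = ?X" "Ker C F f = Ker C F d \<squnion>\<^bsub>fib F ?X\<^esub> Ker C F e"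
      unfolding normal_def by blast
    have quo: "is_quotient C F (Dom C l) (Ker C F l) l" if l: "l \<in> E" for l
    proof -
      obtain Y T where "is_quotient C F Y T l"
        using l unfolding quotients[symmetric] form_quotients_def by blast
      then show ?thesis unfolding is_quotient_def by blast
    qed
    have le: "Ker C F d \<sqsubseteq>\<^bsub>fib F ?X\<^esub> Ker C F f" "Ker C F e \<sqsubseteq>\<^bsub>fib F ?X\<^esub> Ker C F f"
      unfolding f using X.join_left[of "Ker C F d" "Ker C F e"] X.join_right[of "Ker C F d" "Ker C F e"]
      by simp_all
    obtain a where "a \<in> Hom C (Cod C d) (Cod C f)" "f = a \<cdot> d"
      using quo[OF de(1)] le(1) f unfolding is_quotient_def by metis
    moreover obtain b where "b \<in> Hom C (Cod C e) (Cod C f)" "f = b \<cdot> e"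
      using quo[OF de(2)] le(2) f pushout_arrs(5)[OF po] unfolding is_quotient_def by metis
    ultimately have a: "a \<in> Arr C" "Dom C a = Cod C d" "Cod C a = Cod C f" "a \<cdot> d = f"
      and b: "b \<in> Arr C" "Dom C b = Cod C e" "Cod C b = Cod C f" "b \<cdot> e = f"
      unfolding in_Hom_iff by metis+
    obtain h where h [simp]: "h \<in> Arr C" "Dom C h = Cod C p" "Cod C h = Cod C a" and hp: "h \<cdot> p = a"
      by (rule pushoutE[OF po a(1) b(1)]) (use a b in simp_all)
    have "h \<cdot> c = f" using assoc_eq1[OF hp, of d] a by (simp add: c_def)
    then have 1: "Ker C F c \<sqsubseteq>\<^bsub>fib F ?X\<^esub> Ker C F f" using Ker_Comp_ge[of c h] by simp
    have "Ker C F d \<sqsubseteq>\<^bsub>fib F ?X\<^esub> Ker C F c" "Ker C F e \<sqsubseteq>\<^bsub>fib F ?X\<^esub> Ker C F c"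
      using Ker_Comp_ge[of d p] Ker_Comp_ge[of e q] sq by (simp_all add: c_def)
    then have "Ker C F d \<squnion>\<^bsub>fib F ?X\<^esub> Ker C F e \<sqsubseteq>\<^bsub>fib F ?X\<^esub> Ker C F c"
      by (intro X.join_le) simp_all
    then show ?thesis using 1 unfolding f by (intro X.le_antisym) simp_all
  qed
  have d_join: "dir F d (S \<squnion>\<^bsub>fib F ?X\<^esub> Ker C F d) = dir F d S" if "S \<in> fibre ?X" for S
    using form_arr(6)[of d S] dir_section[of d "dir F d S"] E_Im[OF de(1)] that by simp
  have e_join: "dir F e (S \<squnion>\<^bsub>fib F ?X\<^esub> Ker C F e) = dir F e S" if "S \<in> fibre ?X" for S
    using form_arr(6)[of e S] dir_section[of e "dir F e S"] E_Im[OF de(2)] that by simp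
  have ker: "a (dir F d S) = a (dir F d R)"
    if ab: "\<And>S. S \<in> fibre ?X \<Longrightarrow> a (dir F d S) = b (dir F e S)"
      and SR: "S \<in> fibre ?X" "R \<in> fibre ?X" "dir F c S = dir F c R" for a b :: "'u \<Rightarrow> 'u" and S R
  proof -
    \<comment> \<open>Joining with the kernel of \<open>d\<close> is invisible to
      \<open>dir F d\<close>, and then joining with the kernel of \<open>e\<close> is invisible to
      \<open>dir F e\<close>. Between the two steps the compatibility \<open>ab\<close> passes from
      \<open>a\<close> to \<open>b\<close> and back.\<close>
    have *: "a (dir F d (T \<squnion>\<^bsub>fib F ?X\<^esub> Ker C F c)) = a (dir F d T)" if T: "T \<in> fibre ?X" for T
    proof -
      let ?T = "T \<squnion>\<^bsub>fib F ?X\<^esub> Ker C F d"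
      have "T \<squnion>\<^bsub>fib F ?X\<^esub> Ker C F c = ?T \<squnion>\<^bsub>fib F ?X\<^esub> Ker C F e"
        unfolding Kc using X.weak_join_assoc[of T "Ker C F d" "Ker C F e"] T
        by (simp add: X.eq_is_equal)
      moreover have "a (dir F d (?T \<squnion>\<^bsub>fib F ?X\<^esub> Ker C F e)) = a (dir F d ?T)"
        using ab[of "?T \<squnion>\<^bsub>fib F ?X\<^esub> Ker C F e"] ab[of ?T] e_join[of ?T] T by simp
      ultimately show ?thesis using d_join[OF T] by simp
    qed
    have "S \<squnion>\<^bsub>fib F ?X\<^esub> Ker C F c = R \<squnion>\<^bsub>fib F ?X\<^esub> Ker C F c"
      using form_arr(6)[of c S] form_arr(6)[of c R] SR by simp
    then show ?thesis using *[OF SR(1)] *[OF SR(2)] by simp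
  qed
  have surj: "dir F d ` fibre ?X = fibre (Cod C d)" "dir F e ` fibre ?X = fibre (Cod C e)"
    "dir F p ` fibre (Cod C d) = fibre (Cod C p)"
    using dir_surj[OF de(1)] dir_surj[OF de(2)] dir_pushout_surj[OF po de] by simp_all
  have cl: "dir F d S \<in> fibre (Cod C d)" "dir F e S \<in> fibre (Cod C e)" if "S \<in> fibre ?X" for S
    using dir_closed[of d S] dir_closed[of e S] that by simp_all
  have arrs: "AMap fibre_functor d = (fibre ?X, restrict (dir F d) (fibre ?X), fibre (Cod C d))"
    "AMap fibre_functor e = (fibre ?X, restrict (dir F e) (fibre ?X), fibre (Cod C e))"
    "AMap fibre_functor p = (fibre (Cod C d), restrict (dir F p) (fibre (Cod C d)), fibre (Cod C p))"
    "AMap fibre_functor q = (fibre (Cod C e), restrict (dir F q) (fibre (Cod C e)), fibre (Cod C p))"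
    by (simp_all add: AMap_fibre)
  have arrs': "AMap fibre_functor l \<in> Arr set_cat" if "l \<in> Arr C" for l
    using AMap_arr[OF that] unfolding AMap_fibre .
  show ?thesis
    unfolding arrs
  proof (rule set_pushoutI)
    fix a b :: "'u \<Rightarrow> 'u" and S R
    assume ab: "\<And>S. S \<in> fibre ?X \<Longrightarrow>
        a (restrict (dir F d) (fibre ?X) S) = b (restrict (dir F e) (fibre ?X) S)"
      and SR: "S \<in> fibre ?X" "R \<in> fibre ?X"
        "restrict (dir F p) (fibre (Cod C d)) (restrict (dir F d) (fibre ?X) S) =
         restrict (dir F p) (fibre (Cod C d)) (restrict (dir F d) (fibre ?X) R)"
    have "a (dir F d S) = a (dir F d R)"
      by (rule ker[of a b]) (use ab SR cl cS in \<open>simp_all\<close>)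
    then show "a (restrict (dir F d) (fibre ?X) S) = a (restrict (dir F d) (fibre ?X) R)"
      using SR by simp
  qed (use pushout_arrs(1-4)[OF po, THEN arrs'] cS cl surj in
      \<open>simp_all only: arrs restrict_apply' image_restrict_eq\<close>)
qed

lemma fibre_transfer:
  "transfer_functor TYPE('u) C E M set_cat surjections injections fibre_functor"
  unfolding transfer_functor_def
proof (intro conjI ballI allI impI)
  show "conservative C set_cat fibre_functor"
    unfolding conservative_def AMap_fibre
    using set_iso_iff[OF AMap_arr] iso_if_dir_bij by (auto cong: bij_betw_cong)
  show "AMap fibre_functor ` E \<subseteq> surjections"
  proof
    fix a assume "a \<in> AMap fibre_functor ` E"
    then obtain e where e: "e \<in> E" "a = AMap fibre_functor e" by blast
    then show "a \<in> surjections"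
      using AMap_arr[of e] dir_surj[of e] unfolding e AMap_fibre surjections_iff by simp
  qed
  show "AMap fibre_functor ` M \<subseteq> injections"
  proof
    fix a assume "a \<in> AMap fibre_functor ` M"
    then obtain m where m: "m \<in> M" "a = AMap fibre_functor m" by blast
    then show "a \<in> injections"
      using AMap_arr[of m] dir_inj[of m] unfolding m AMap_fibre injections_iff by simp
  qed
qed (use fact factorized_set_cat[OF univ] fibre_is_functor fibre_pullback fibre_pushout in simp_all)

end

section \<open>Copower functors\<close>

lemma exact_factorized_category:
  assumes "locally_small U A" "puppe_exact A"
  shows "factorized_category U A (epimorphisms A) (monomorphisms A)"
proof -
  interpret puppe_exact A by (rule assms)
  show ?thesis
    unfolding factorized_category_def
  proof (intro conjI ballI impI assms(1) proper_factorization_system_epi_mono)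
    fix m n assume "m \<in> monomorphisms A" "n \<in> monomorphisms A" "Cod A m = Cod A n"
    then show "\<exists>p q. is_pullback A m n p q" by (intro pullback_ex mono_arr)
  next
    fix d e assume "d \<in> epimorphisms A" "e \<in> epimorphisms A" "Dom A d = Dom A e"
    then show "\<exists>p q. is_pushout A d e p q" by (intro pushout_ex epi_arr)
  qed
qed

text \<open>A converse to \<open>set_pullbackI\<close>: the universal property is tested on a
  one-element set, whose maps are points.\<close>

lemma set_pullback_ex1:
  assumes univ: "grothendieck_universe TYPE('u)"
    and pb: "is_pullback set_cat (V, m, X) (W, n, X) (P, p, V) (P, q, W :: 'u set)"
    and st: "s \<in> V" "t \<in> W" "m s = n t"
  shows "\<exists>!r. r \<in> P \<and> p r = s \<and> q r = t"
proof -
  have sm: "small TYPE('u) {s}" by (rule small_singleton[OF univ])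
  have arr: "(P, p, V) \<in> Arr set_cat" "(P, q, W) \<in> Arr set_cat" "(V, m, X) \<in> Arr set_cat"
    "(W, n, X) \<in> Arr set_cat"
    using set_pullback_square[OF pb] by blast+
  have "({s}, \<lambda>x\<in>{s}. s, V) \<in> Hom set_cat {s} V" "({s}, \<lambda>x\<in>{s}. t, W) \<in> Hom set_cat {s} W"
    "(V, m, X) \<cdot>\<^bsub>set_cat\<^esub> ({s}, \<lambda>x\<in>{s}. s, V) = (W, n, X) \<cdot>\<^bsub>set_cat\<^esub> ({s}, \<lambda>x\<in>{s}. t, W)"
    using st sm arr by (simp_all add: in_Hom_iff compose_eq_iff)
  then have ex1: "\<exists>!h. h \<in> Hom set_cat {s} P \<and> (P, p, V) \<cdot>\<^bsub>set_cat\<^esub> h = ({s}, \<lambda>x\<in>{s}. s, V) \<and>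
      (P, q, W) \<cdot>\<^bsub>set_cat\<^esub> h = ({s}, \<lambda>x\<in>{s}. t, W)"
    using pb sm unfolding is_pullback_def set_cat_simps(1,3,4) by blast
  have point: "({s}, \<lambda>x\<in>{s}. r, P) \<in> Hom set_cat {s} P \<and>
      (P, p, V) \<cdot>\<^bsub>set_cat\<^esub> ({s}, \<lambda>x\<in>{s}. r, P) = ({s}, \<lambda>x\<in>{s}. s, V) \<and>
      (P, q, W) \<cdot>\<^bsub>set_cat\<^esub> ({s}, \<lambda>x\<in>{s}. r, P) = ({s}, \<lambda>x\<in>{s}. t, W)"
    if "r \<in> P" "p r = s" "q r = t" for r
    using that sm arr by (auto simp: in_Hom_iff compose_def fun_eq_iff)
  obtain h where h: "h \<in> Hom set_cat {s} P" "(P, p, V) \<cdot>\<^bsub>set_cat\<^esub> h = ({s}, \<lambda>x\<in>{s}. s, V)"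
      "(P, q, W) \<cdot>\<^bsub>set_cat\<^esub> h = ({s}, \<lambda>x\<in>{s}. t, W)"
    using ex1 by blast
  obtain h' where h': "h = ({s}, h', P)" "h' \<in> {s} \<rightarrow>\<^sub>E P" using h(1) by (rule set_HomE)
  have "compose {s} p h' = (\<lambda>x\<in>{s}. s)" "compose {s} q h' = (\<lambda>x\<in>{s}. t)" using h h' by auto
  then have "p (h' s) = s" "q (h' s) = t" by (metis compose_eq restrict_apply' singletonI)+
  moreover have "h' s \<in> P" using h' by auto
  moreover have "r = h' s" if r: "r \<in> P" "p r = s" "q r = t" for r
  proof -
    have "({s}, \<lambda>x\<in>{s}. r, P) = ({s}, \<lambda>x\<in>{s}. h' s, P)"
      using ex1 point[OF r] point[of "h' s"] calculation by blast
    then show ?thesis by (auto dest: fun_cong[of _ _ s])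
  qed
  ultimately show ?thesis by blast
qed

locale copower =
  fixes A :: "('o, 'm) cat" (structure) and G :: 'o and Q :: "'u set \<Rightarrow> 'o"
    and \<iota> :: "'u set \<Rightarrow> 'u \<Rightarrow> 'm"
  assumes univ: "grothendieck_universe TYPE('u)"
    and exact: "puppe_exact A"
    and loc_small: "locally_small TYPE('u) A"
    and G: "G \<in> Obj A" and G_nonzero: "\<not> zero_object A G"
    and choice: "is_copower_choice A G Q \<iota>"
begin

sublocale puppe_exact A by (rule exact)

section \<open>Universal property and functoriality of copowers\<close>

lemma coproduct: "small TYPE('u) X \<Longrightarrow> is_coproduct A X (\<lambda>_. G) (Q X) (\<iota> X)"
  using choice unfolding is_copower_choice_def by blast

lemma Q_Obj [simp]: "small TYPE('u) X \<Longrightarrow> Q X \<in> Obj A"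
  using coproduct unfolding is_coproduct_def by blast

lemma \<iota>_arr [simp]:
  assumes "small TYPE('u) X" "x \<in> X"
  shows "\<iota> X x \<in> Arr A" "Dom A (\<iota> X x) = G" "Cod A (\<iota> X x) = Q X"
  using coproduct[OF assms(1)] assms(2) unfolding is_coproduct_def by (auto simp: in_Hom_iff)

lemma copower_ex1:
  assumes "small TYPE('u) X" "Z \<in> Obj A" "\<And>x. x \<in> X \<Longrightarrow> g x \<in> Hom A G Z"
  shows "\<exists>!h. h \<in> Hom A (Q X) Z \<and> (\<forall>x\<in>X. h \<cdot> \<iota> X x = g x)"
  using coproduct[OF assms(1)] assms(2,3) unfolding is_coproduct_def by blast

lemma copowerE:
  assumes "small TYPE('u) X" "Z \<in> Obj A" "\<And>x. x \<in> X \<Longrightarrow> g x \<in> Hom A G Z"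
  obtains h where "h \<in> Arr A" "Dom A h = Q X" "Cod A h = Z" "\<And>x. x \<in> X \<Longrightarrow> h \<cdot> \<iota> X x = g x"
  using copower_ex1[of X Z g, OF assms] by (auto simp: in_Hom_iff)

lemma copower_ext:
  assumes "small TYPE('u) X" "h \<in> Arr A" "k \<in> Arr A" "Dom A h = Q X" "Dom A k = Q X"
    "Cod A h = Cod A k" "\<And>x. x \<in> X \<Longrightarrow> h \<cdot> \<iota> X x = k \<cdot> \<iota> X x"
  shows "h = k"
proof -
  have "\<exists>!l. l \<in> Hom A (Q X) (Cod A h) \<and> (\<forall>x\<in>X. l \<cdot> \<iota> X x = h \<cdot> \<iota> X x)"
    by (rule copower_ex1) (use assms in \<open>auto simp: in_Hom_iff\<close>)
  moreover have "h \<in> Hom A (Q X) (Cod A h)" "k \<in> Hom A (Q X) (Cod A h)"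
    using assms by (auto simp: in_Hom_iff)
  ultimately show ?thesis using assms(7) by metis
qed

abbreviation H :: "'u set_arrow \<Rightarrow> 'm" where "H \<equiv> AMap (copower_functor A Q \<iota>)"

lemma H_arr [simp]:
  assumes "(X, f, Y) \<in> Arr set_cat"
  shows "H (X, f, Y) \<in> Arr A" "Dom A (H (X, f, Y)) = Q X" "Cod A (H (X, f, Y)) = Q Y"
    and H_\<iota>: "x \<in> X \<Longrightarrow> H (X, f, Y) \<cdot> \<iota> X x = \<iota> Y (f x)"
proof -
  have ex1: "\<exists>!h. h \<in> Hom A (Q X) (Q Y) \<and> (\<forall>x\<in>X. h \<cdot> \<iota> X x = \<iota> Y (f x))"
  proof (rule copower_ex1)
    fix x assume "x \<in> X"
    moreover from this have "f x \<in> Y" using assms by auto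
    ultimately show "\<iota> Y (f x) \<in> Hom A G (Q Y)" using assms by (simp add: in_Hom_iff)
  qed (use assms in simp_all)
  have H: "H (X, f, Y) = (THE h. h \<in> Hom A (Q X) (Q Y) \<and> (\<forall>x\<in>X. h \<cdot> \<iota> X x = \<iota> Y (f x)))"
    by (simp add: copower_functor_def)
  have *: "H (X, f, Y) \<in> Hom A (Q X) (Q Y) \<and> (\<forall>x\<in>X. H (X, f, Y) \<cdot> \<iota> X x = \<iota> Y (f x))"
    unfolding H by (rule theI'[OF ex1])
  then show "H (X, f, Y) \<in> Arr A" "Dom A (H (X, f, Y)) = Q X" "Cod A (H (X, f, Y)) = Q Y"
    "x \<in> X \<Longrightarrow> H (X, f, Y) \<cdot> \<iota> X x = \<iota> Y (f x)"
    by (auto simp: in_Hom_iff)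
qed

lemma H_Comp:
  assumes "(X, f, Y) \<in> Arr set_cat" "(Y, g, Z) \<in> Arr set_cat"
  shows "H (X, compose X g f, Z) = H (Y, g, Z) \<cdot> H (X, f, Y)"
proof (rule copower_ext[of X])
  have c: "(X, compose X g f, Z) \<in> Arr set_cat" using assms by (auto simp: compose_def)
  show "H (X, compose X g f, Z) \<in> Arr A" "Dom A (H (X, compose X g f, Z)) = Q X"
    "Cod A (H (X, compose X g f, Z)) = Cod A (H (Y, g, Z) \<cdot> H (X, f, Y))"
    "H (Y, g, Z) \<cdot> H (X, f, Y) \<in> Arr A" "Dom A (H (Y, g, Z) \<cdot> H (X, f, Y)) = Q X"
    using H_arr(1-3)[OF c] H_arr(1-3)[OF assms(1)] H_arr(1-3)[OF assms(2)] by simp_all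
  show "small TYPE('u) X" using assms by simp
  fix x assume x: "x \<in> X"
  have fx: "f x \<in> Y" using assms x by auto
  have "H (X, compose X g f, Z) \<cdot> \<iota> X x = \<iota> Z (g (f x))"
    using H_\<iota>[OF c x] x by (simp add: compose_eq)
  also have "\<dots> = H (Y, g, Z) \<cdot> (H (X, f, Y) \<cdot> \<iota> X x)"
    using H_\<iota>[OF assms(1) x] H_\<iota>[OF assms(2) fx] by simp
  finally show "H (X, compose X g f, Z) \<cdot> \<iota> X x = (H (Y, g, Z) \<cdot> H (X, f, Y)) \<cdot> \<iota> X x"
    using H_arr(1-3)[OF assms(1)] H_arr(1-3)[OF assms(2)] assms x by simp
qed

lemma H_Id:
  assumes "small TYPE('u) X"
  shows "H (X, \<lambda>x\<in>X. x, X) = Id A (Q X)"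
proof (rule copower_ext[OF assms])
  have c: "(X, \<lambda>x\<in>X. x, X) \<in> Arr set_cat" using assms by auto
  show "H (X, \<lambda>x\<in>X. x, X) \<in> Arr A" "Dom A (H (X, \<lambda>x\<in>X. x, X)) = Q X"
    "Cod A (H (X, \<lambda>x\<in>X. x, X)) = Cod A (Id A (Q X))"
    using H_arr(1-3)[OF c] assms by simp_all
  fix x assume "x \<in> X"
  then show "H (X, \<lambda>x\<in>X. x, X) \<cdot> \<iota> X x = Id A (Q X) \<cdot> \<iota> X x"
    using H_\<iota>[OF c, of x] assms by simp
qed (use assms in simp_all)

lemma copower_is_functor: "is_functor set_cat A (copower_functor A Q \<iota>)"
  unfolding is_functor_def
proof (intro conjI ballI impI)
  show "category (set_cat :: ('u set, 'u set_arrow) cat)" by (rule category_set_cat)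
  show "category A" by (rule category_axioms)
  fix X :: "'u set" assume "X \<in> Obj set_cat"
  then show "OMap (copower_functor A Q \<iota>) X \<in> Obj A"
    "H (Id set_cat X) = Id A (OMap (copower_functor A Q \<iota>) X)"
    using H_Id by (simp_all add: copower_functor_def)
next
  fix f g :: "'u set_arrow" assume f: "f \<in> Arr set_cat"
  obtain X f' Y where f': "f = (X, f', Y)" by (cases f)
  show "H f \<in> Hom A (OMap (copower_functor A Q \<iota>) (Dom set_cat f)) (OMap (copower_functor A Q \<iota>) (Cod set_cat f))"
    using H_arr(1-3)[OF f[unfolded f']] unfolding f' in_Hom_iff by (simp add: copower_functor_def)
  assume g: "g \<in> Arr set_cat" "Dom set_cat g = Cod set_cat f"
  then obtain g' Z where g': "g = (Y, g', Z)" using f' by (cases g) auto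
  show "H (g \<cdot>\<^bsub>set_cat\<^esub> f) = H g \<cdot> H f"
    using H_Comp[of X f' Y g' Z] f g unfolding f' g' by simp
qed

text \<open>
  Since \<open>A\<close> has zero arrows, the copower is functorial even for partial maps; partial inverses of
  injections then give retractions that are compatible with pullback squares.
\<close>

lemma partial_mapE:
  assumes X: "small TYPE('u) X" and Y: "small TYPE('u) Y" and g: "\<And>x. x \<in> S \<Longrightarrow> g x \<in> Y"
  obtains r where "r \<in> Arr A" "Dom A r = Q X" "Cod A r = Q Y"
    "\<And>x. x \<in> X \<Longrightarrow> x \<in> S \<Longrightarrow> r \<cdot> \<iota> X x = \<iota> Y (g x)"
    "\<And>x. x \<in> X \<Longrightarrow> x \<notin> S \<Longrightarrow> zero_arrow A (r \<cdot> \<iota> X x)"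
proof -
  obtain Z0 where Z0: "zero_object A Z0" using zero_object_ex by blast
  obtain z where z: "zero_arrow A z" "z \<in> Arr A" "Dom A z = G" "Cod A z = Q Y"
    using zero_arrow_ex[OF Z0 G Q_Obj[OF Y]] .
  have gx: "(if x \<in> S then \<iota> Y (g x) else z) \<in> Hom A G (Q Y)" for x
    using g Y z by (auto simp: in_Hom_iff)
  obtain r where r: "r \<in> Arr A" "Dom A r = Q X" "Cod A r = Q Y"
    "\<And>x. x \<in> X \<Longrightarrow> r \<cdot> \<iota> X x = (if x \<in> S then \<iota> Y (g x) else z)"
    by (rule copowerE[where g = "\<lambda>x. if x \<in> S then \<iota> Y (g x) else z", OF X Q_Obj[OF Y] gx]) (rule that)
  show ?thesis by (rule that[OF r(1-3)]) (use r(4) z(1) in simp_all)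
qed

text \<open>The projection onto one summand, which zero arrows make available. It separates the
  injections, since the identity of \<open>G\<close> is not zero.\<close>

lemma coordinateE:
  assumes X: "small TYPE('u) X" and x: "x \<in> X"
  obtains d where "d \<in> Arr A" "Dom A d = Q X" "Cod A d = G" "d \<cdot> \<iota> X x = Id A G"
    "\<And>y. y \<in> X \<Longrightarrow> y \<noteq> x \<Longrightarrow> zero_arrow A (d \<cdot> \<iota> X y)"
proof -
  obtain Z0 where Z0: "zero_object A Z0" using zero_object_ex by blast
  obtain z where z: "zero_arrow A z" "z \<in> Arr A" "Dom A z = G" "Cod A z = G"
    using zero_arrow_ex[OF Z0 G G] .
  have gx: "(if y = x then Id A G else z) \<in> Hom A G G" for y
    using G z by (auto simp: in_Hom_iff)
  obtain d where d: "d \<in> Arr A" "Dom A d = Q X" "Cod A d = G"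
    "\<And>y. y \<in> X \<Longrightarrow> d \<cdot> \<iota> X y = (if y = x then Id A G else z)"
    by (rule copowerE[where g = "\<lambda>y. if y = x then Id A G else z", OF X G gx]) (rule that)
  show ?thesis by (rule that[OF d(1-3)]) (use d(4) z(1) x in simp_all)
qed

lemma Id_G_nonzero: "\<not> zero_arrow A (Id A G)"
  using zero_Id_iff[OF _ G] zero_object_ex G_nonzero by blast

text \<open>If \<open>f\<close> identified \<open>x\<close> and \<open>y\<close>, the monic
  \<open>H f\<close> would identify their injections, which the coordinate at \<open>x\<close>
  separates. If \<open>f\<close> missed \<open>y\<close>, the coordinate at \<open>y\<close> would
  vanish after \<open>H f\<close>; as \<open>H f\<close> is epic, that coordinate would be zero, yet
  it is the identity on the summand of \<open>y\<close>.\<close>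

lemma copower_conservative: "conservative set_cat A (copower_functor A Q \<iota>)"
  unfolding conservative_def
proof (intro ballI impI)
  fix a :: "'u set_arrow" assume a: "a \<in> Arr set_cat" and iso: "H a \<in> isomorphisms A"
  obtain X f Y where f: "a = (X, f, Y)" by (cases a)
  have arr: "(X, f, Y) \<in> Arr set_cat" using a f by simp
  have X: "small TYPE('u) X" and Y: "small TYPE('u) Y" and fXY: "\<And>x. x \<in> X \<Longrightarrow> f x \<in> Y"
    using arr by auto
  note [simp] = H_arr(1-3)[OF arr]
  have "inj_on f X"
  proof (rule inj_onI, rule ccontr)
    fix x y assume xy: "x \<in> X" "y \<in> X" "f x = f y" "x \<noteq> y"
    have "H (X, f, Y) \<cdot> \<iota> X x = H (X, f, Y) \<cdot> \<iota> X y"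
      using H_\<iota>[OF arr] xy by simp
    then have eq: "\<iota> X x = \<iota> X y"
      by - (rule monoD[OF iso_mono[OF iso[unfolded f]]], use X xy in simp_all)
    obtain d where "d \<cdot> \<iota> X x = Id A G" "\<And>z. z \<in> X \<Longrightarrow> z \<noteq> x \<Longrightarrow> zero_arrow A (d \<cdot> \<iota> X z)"
      using coordinateE[OF X xy(1)] by blast
    then show False using eq xy Id_G_nonzero by metis
  qed
  moreover have "f ` X = Y"
  proof (intro Set.equalityI subsetI, use fXY in blast, rule ccontr)
    fix y assume y: "y \<in> Y" "y \<notin> f ` X"
    obtain d where d [simp]: "d \<in> Arr A" "Dom A d = Q Y" "Cod A d = G" and dy: "d \<cdot> \<iota> Y y = Id A G"
      and d0: "\<And>z. z \<in> Y \<Longrightarrow> z \<noteq> y \<Longrightarrow> zero_arrow A (d \<cdot> \<iota> Y z)"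
      using coordinateE[OF Y y(1)] by blast
    obtain Z0 where Z0: "zero_object A Z0" using zero_object_ex by blast
    obtain z where z: "zero_arrow A z" "z \<in> Arr A" "Dom A z = Q Y" "Cod A z = G"
      using zero_arrow_ex[OF Z0 Q_Obj[OF Y] G] .
    have "d \<cdot> H (X, f, Y) = z \<cdot> H (X, f, Y)"
    proof (rule copower_ext[OF X])
      fix x assume x: "x \<in> X"
      have "zero_arrow A (d \<cdot> \<iota> Y (f x))" using d0 fXY x y by blast
      moreover have "zero_arrow A (z \<cdot> \<iota> Y (f x))" by (rule zero_Comp[OF z(1)]) (use z Y fXY x in simp_all)
      ultimately have "d \<cdot> \<iota> Y (f x) = z \<cdot> \<iota> Y (f x)"
        by (rule zero_eq) (use z Y fXY x in simp_all)
      then show "(d \<cdot> H (X, f, Y)) \<cdot> \<iota> X x = (z \<cdot> H (X, f, Y)) \<cdot> \<iota> X x"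
        using z X x H_\<iota>[OF arr x] by simp
    qed (use z in simp_all)
    then have "d = z" by - (rule epiD[OF iso_epi[OF iso[unfolded f]]], use z in simp_all)
    moreover have "zero_arrow A (z \<cdot> \<iota> Y y)" by (rule zero_Comp[OF z(1)]) (use z Y y in simp_all)
    ultimately show False using dy Id_G_nonzero by simp
  qed
  ultimately show "a \<in> isomorphisms set_cat" using set_iso_iff[OF arr] f by (simp add: bij_betw_def)
qed

text \<open>The image of the partial inverse of \<open>f\<close>. Being zero off the range, it
  exists even when \<open>X\<close> is empty and \<open>Y\<close> is not, a case in which
  \<open>f\<close> has no retraction among sets.\<close>

lemma retractionE:
  assumes f: "(X, f, Y) \<in> Arr set_cat" and inj: "inj_on f X"
  obtains r where "r \<in> Arr A" "Dom A r = Q Y" "Cod A r = Q X" "r \<cdot> H (X, f, Y) = Id A (Q X)"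
    "\<And>x. x \<in> X \<Longrightarrow> r \<cdot> \<iota> Y (f x) = \<iota> X x"
    "\<And>y. y \<in> Y \<Longrightarrow> y \<notin> f ` X \<Longrightarrow> zero_arrow A (r \<cdot> \<iota> Y y)"
proof -
  have X: "small TYPE('u) X" and Y: "small TYPE('u) Y" and fXY: "\<And>x. x \<in> X \<Longrightarrow> f x \<in> Y"
    using f by auto
  obtain r where r [simp]: "r \<in> Arr A" "Dom A r = Q Y" "Cod A r = Q X"
    and r1: "\<And>y. y \<in> Y \<Longrightarrow> y \<in> f ` X \<Longrightarrow> r \<cdot> \<iota> Y y = \<iota> X (inv_into X f y)"
    and r0: "\<And>y. y \<in> Y \<Longrightarrow> y \<notin> f ` X \<Longrightarrow> zero_arrow A (r \<cdot> \<iota> Y y)"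
    by (rule partial_mapE[where g = "inv_into X f" and S = "f ` X", OF Y X inv_into_into], assumption, rule that)
  have rf: "r \<cdot> \<iota> Y (f x) = \<iota> X x" if "x \<in> X" for x
    using r1[of "f x"] fXY[OF that] inj that by simp
  have "r \<cdot> H (X, f, Y) = Id A (Q X)"
    by (rule copower_ext[OF X]) (use H_arr(1-3)[OF f] H_\<iota>[OF f] rf X in simp_all)
  then show ?thesis by (rule that[OF r]) (use rf r0 in simp_all)
qed

section \<open>Preservation of the classes, of pullbacks and of pushouts\<close>

lemma H_injection:
  assumes "a \<in> injections"
  shows "H a \<in> monomorphisms A"
proof -
  obtain X f Y where a: "a = (X, f, Y)" by (cases a)
  have f: "(X, f, Y) \<in> Arr set_cat" "inj_on f X" using assms unfolding a injections_iff by auto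
  show ?thesis
    by (rule retractionE[OF f], unfold a, rule split_mono) (use H_arr(1-3)[OF f(1)] in simp_all)
qed

text \<open>Surjections split by choice, and functors preserve split epimorphisms.\<close>

lemma H_surjection:
  assumes "a \<in> surjections"
  shows "H a \<in> epimorphisms A"
proof -
  obtain X f Y where a: "a = (X, f, Y)" by (cases a)
  have f: "(X, f, Y) \<in> Arr set_cat" and surj: "f ` X = Y" using assms unfolding a surjections_iff by auto
  let ?s = "restrict (inv_into X f) Y"
  have s: "(Y, ?s, X) \<in> Arr set_cat" using f surj by (auto intro: inv_into_into)
  have "compose Y f ?s = (\<lambda>y\<in>Y. y)"
    using surj by (auto simp: compose_def fun_eq_iff f_inv_into_f)
  then have "H (X, f, Y) \<cdot> H (Y, ?s, X) = Id A (Q Y)"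
    using H_Comp[OF s f] H_Id f by simp
  then show ?thesis
    unfolding a by (intro split_epi[of _ "H (Y, ?s, X)"]) (use H_arr(1-3)[OF f] H_arr(1-3)[OF s] in simp_all)
qed

text \<open>The mediating arrow of a cone \<open>f\<close>, \<open>g\<close> is
  \<open>rp \<cdot> f\<close>. Its \<open>q\<close>-component is \<open>g\<close> by the identity
  \<open>bc\<close> and the retraction \<open>rn\<close> of \<open>n\<close>; its
  \<open>p\<close>-component is then \<open>f\<close> because \<open>m\<close> is monic and the
  square commutes.\<close>

lemma H_pullback:
  assumes mn: "a \<in> injections" "b \<in> injections" and pb: "is_pullback set_cat a b c d"
  shows "is_pullback A (H a) (H b) (H c) (H d)"
proof -
  obtain V m X where a: "a = (V, m, X)" by (cases a)
  obtain W n X' where b: "b = (W, n, X')" by (cases b)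
  obtain P p V' where c: "c = (P, p, V')" by (cases c)
  obtain P' q W' where d: "d = (P', q, W')" by (cases d)
  note sq = set_pullback_square[OF pb[unfolded a b c d]]
  have arr: "(V, m, X) \<in> Arr set_cat" "(W, n, X) \<in> Arr set_cat" "(P, p, V) \<in> Arr set_cat"
    "(P, q, W) \<in> Arr set_cat" by (rule sq)+
  have pb': "is_pullback set_cat (V, m, X) (W, n, X) (P, p, V) (P, q, W)"
    using pb unfolding a b c d sq(1-4) .
  have inj: "inj_on m V" "inj_on n W" using mn unfolding a b injections_iff by blast+
  have small: "small TYPE('u) V" "small TYPE('u) W" "small TYPE('u) X" "small TYPE('u) P"
    and maps: "\<And>x. x \<in> V \<Longrightarrow> m x \<in> X" "\<And>x. x \<in> W \<Longrightarrow> n x \<in> X" "\<And>x. x \<in> P \<Longrightarrow> p x \<in> V"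
      "\<And>x. x \<in> P \<Longrightarrow> q x \<in> W"
    using arr by auto
  have comm: "m (p r) = n (q r)" if "r \<in> P" for r by (rule sq(5)[OF that])
  have injp: "inj_on p P"
  proof (rule inj_onI)
    fix r r' assume r: "r \<in> P" "r' \<in> P" "p r = p r'"
    then have "n (q r) = n (q r')" using comm by metis
    then have "q r = q r'" using inj(2) maps(4) r by (meson inj_on_def)
    moreover have "\<exists>!s. s \<in> P \<and> p s = p r \<and> q s = q r"
      by (rule set_pullback_ex1[OF univ pb' maps(3)[OF r(1)] maps(4)[OF r(1)] comm[OF r(1)]])
    ultimately show "r = r'" using r by metis
  qed
  note [simp] = H_arr(1-3)[OF arr(1)] H_arr(1-3)[OF arr(2)] H_arr(1-3)[OF arr(3)] H_arr(1-3)[OF arr(4)] small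
  let ?m = "H (V, m, X)" and ?n = "H (W, n, X)" and ?p = "H (P, p, V)" and ?q = "H (P, q, W)"
  have mp: "?m \<cdot> ?p = ?n \<cdot> ?q"
  proof -
    have "compose P m p = compose P n q" using comm by (simp add: compose_eq_iff)
    then show ?thesis using H_Comp[OF arr(3,1)] H_Comp[OF arr(4,2)] by simp
  qed
  obtain rp where rp [simp]: "rp \<in> Arr A" "Dom A rp = Q V" "Cod A rp = Q P"
    and "rp \<cdot> ?p = Id A (Q P)"
    and rp1: "\<And>x. x \<in> P \<Longrightarrow> rp \<cdot> \<iota> V (p x) = \<iota> P x"
    and rp0: "\<And>y. y \<in> V \<Longrightarrow> y \<notin> p ` P \<Longrightarrow> zero_arrow A (rp \<cdot> \<iota> V y)"
    by (rule retractionE[OF arr(3) injp]) (rule that)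
  obtain rn where rn [simp]: "rn \<in> Arr A" "Dom A rn = Q X" "Cod A rn = Q W"
    and rnn: "rn \<cdot> ?n = Id A (Q W)"
    and rn1: "\<And>x. x \<in> W \<Longrightarrow> rn \<cdot> \<iota> X (n x) = \<iota> W x"
    and rn0: "\<And>y. y \<in> X \<Longrightarrow> y \<notin> n ` W \<Longrightarrow> zero_arrow A (rn \<cdot> \<iota> X y)"
    by (rule retractionE[OF arr(2) inj(2)]) (rule that)
  \<comment> \<open>A Beck-Chevalley identity for the partial inverses of \<open>n\<close> and
    \<open>p\<close>. For \<open>x\<close> off the range of \<open>p\<close>, the pullback property
    puts \<open>m x\<close> off the range of \<open>n\<close>, so both sides vanish there.\<close>
  have bc: "rn \<cdot> ?m = ?q \<cdot> rp"
  proof (rule copower_ext[of V])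
    fix x assume x: "x \<in> V"
    have l: "(rn \<cdot> ?m) \<cdot> \<iota> V x = rn \<cdot> \<iota> X (m x)" using H_\<iota>[OF arr(1) x] x by simp
    show "(rn \<cdot> ?m) \<cdot> \<iota> V x = (?q \<cdot> rp) \<cdot> \<iota> V x"
    proof (cases "x \<in> p ` P")
      case True
      then obtain r where r: "r \<in> P" "x = p r" by blast
      have "rn \<cdot> \<iota> X (m x) = \<iota> W (q r)" using rn1[of "q r"] comm maps r by simp
      moreover have "?q \<cdot> (rp \<cdot> \<iota> V x) = \<iota> W (q r)" using rp1 r H_\<iota>[OF arr(4) r(1)] by simp
      ultimately show ?thesis using l x by simp
    next
      case False
      have "m x \<notin> n ` W"
      proof
        assume "m x \<in> n ` W"
        then obtain w where "w \<in> W" "m x = n w" by blast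
        then show False using set_pullback_ex1[OF univ pb' x] False by blast
      qed
      then have "zero_arrow A (rn \<cdot> \<iota> X (m x))" using rn0 maps x by blast
      moreover have "zero_arrow A (?q \<cdot> (rp \<cdot> \<iota> V x))" using rp0[OF x False] by (rule Comp_zero) (use x in simp_all)
      ultimately have "rn \<cdot> \<iota> X (m x) = ?q \<cdot> (rp \<cdot> \<iota> V x)"
        by (rule zero_eq) (use x maps in simp_all)
      then show ?thesis using l x by simp
    qed
  qed simp_all
  have "\<exists>!h. h \<in> Hom A Z (Q P) \<and> ?p \<cdot> h = f \<and> ?q \<cdot> h = g"
    if "f \<in> Hom A Z (Q V)" "g \<in> Hom A Z (Q W)" and eq: "?m \<cdot> f = ?n \<cdot> g" for Z f g
  proof -
    have fg [simp]: "f \<in> Arr A" "Dom A f = Z" "Cod A f = Q V" "g \<in> Arr A" "Dom A g = Z" "Cod A g = Q W"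
      using that by (auto simp: in_Hom_iff)
    have mono: "?m \<in> monomorphisms A" "?p \<in> monomorphisms A"
      using H_injection[of "(V, m, X)"] H_injection[of "(P, p, V)"] inj injp arr by (simp_all add: injections_iff)
    have qh: "?q \<cdot> (rp \<cdot> f) = g"
      using assoc_eq[OF bc, of f] assoc_eq1[OF rnn, of g] eq by simp
    have "?m \<cdot> (?p \<cdot> (rp \<cdot> f)) = ?m \<cdot> f"
      using assoc_eq[OF mp, of "rp \<cdot> f"] qh eq by simp
    then have ph: "?p \<cdot> (rp \<cdot> f) = f" by - (rule monoD[OF mono(1)], simp_all)
    show ?thesis
    proof (rule ex1I[of _ "rp \<cdot> f"])
      show "rp \<cdot> f \<in> Hom A Z (Q P) \<and> ?p \<cdot> (rp \<cdot> f) = f \<and> ?q \<cdot> (rp \<cdot> f) = g"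
        using ph qh by (simp add: in_Hom_iff)
      fix k assume "k \<in> Hom A Z (Q P) \<and> ?p \<cdot> k = f \<and> ?q \<cdot> k = g"
      then show "k = rp \<cdot> f"
        by - (rule monoD[OF mono(2)], use ph in \<open>simp_all add: in_Hom_iff\<close>)
    qed
  qed
  then show ?thesis
    unfolding a b c d sq(1-4) is_pullback_def using mp by simp
qed

text \<open>
  Copowers are left adjoint to \<open>Hom(G, -)\<close>; the hom-set is encoded as a small subset of \<open>'u\<close> by \<open>\<phi>\<close>.
\<close>

lemma H_pushout:
  assumes po: "is_pushout set_cat a b c d"
  shows "is_pushout A (H a) (H b) (H c) (H d)"
proof -
  obtain X dd V where a: "a = (X, dd, V)" by (cases a)
  obtain X' e W where b: "b = (X', e, W)" by (cases b)
  obtain V' p P where c: "c = (V', p, P)" by (cases c)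
  obtain W' q P' where d: "d = (W', q, P')" by (cases d)
  note sq = set_pushout_square[OF po[unfolded a b c d]]
  have arr: "(X, dd, V) \<in> Arr set_cat" "(X, e, W) \<in> Arr set_cat" "(V, p, P) \<in> Arr set_cat"
    "(W, q, P) \<in> Arr set_cat" by (rule sq)+
  have po': "is_pushout set_cat (X, dd, V) (X, e, W) (V, p, P) (W, q, P)"
    using po unfolding a b c d sq(1-4) .
  have small: "small TYPE('u) V" "small TYPE('u) W" "small TYPE('u) X" "small TYPE('u) P"
    using arr by auto
  note [simp] = H_arr(1-3)[OF arr(1)] H_arr(1-3)[OF arr(2)] H_arr(1-3)[OF arr(3)] H_arr(1-3)[OF arr(4)] small
  let ?d = "H (X, dd, V)" and ?e = "H (X, e, W)" and ?p = "H (V, p, P)" and ?q = "H (W, q, P)"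
  have comm: "?p \<cdot> ?d = ?q \<cdot> ?e"
  proof -
    have "compose X p dd = compose X q e" using sq(5) by (simp add: compose_eq_iff)
    then show ?thesis using H_Comp[OF arr(1,3)] H_Comp[OF arr(2,4)] by simp
  qed
  have "\<exists>!h. h \<in> Hom A (Q P) Z \<and> h \<cdot> ?p = f \<and> h \<cdot> ?q = g"
    if Z: "Z \<in> Obj A" and f: "f \<in> Hom A (Q V) Z" and g: "g \<in> Hom A (Q W) Z"
      and eq: "f \<cdot> ?d = g \<cdot> ?e" for Z f g
  proof -
    have sm: "small TYPE('u) (Hom A G Z)" using loc_small G Z unfolding locally_small_def by blast
    obtain \<phi> :: "'m \<Rightarrow> 'u" where \<phi>: "inj_on \<phi> (Hom A G Z)" using small_encode[OF sm] .
    define K where "K = \<phi> ` Hom A G Z"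
    have K: "small TYPE('u) K" unfolding K_def by (rule small_image[OF sm])
    \<comment> \<open>The transpose of \<open>h\<close> under the adjunction, with its values coded
      by \<phi>. \<open>T_inj\<close>, \<open>T_surj\<close> and \<open>T_nat\<close> say that it is
      a natural bijection, so cocones under the copowers correspond to cocones under the
      sets.\<close>
    define T where "T S h = (S, \<lambda>x\<in>S. \<phi> (h \<cdot> \<iota> S x), K)" for S h
    have T_Hom: "T S h \<in> Hom set_cat S K" if "small TYPE('u) S" "h \<in> Hom A (Q S) Z" for S h
      using that K by (auto simp: T_def in_Hom_iff K_def)
    have T_inj: "h = k" if S: "small TYPE('u) S" and h: "h \<in> Hom A (Q S) Z" and k: "k \<in> Hom A (Q S) Z"
      and T: "T S h = T S k" for S h k
    proof (rule copower_ext[OF S])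
      fix x assume x: "x \<in> S"
      have "\<phi> (h \<cdot> \<iota> S x) = \<phi> (k \<cdot> \<iota> S x)"
        using T x unfolding T_def by (auto dest: fun_cong[of _ _ x])
      moreover have "h \<cdot> \<iota> S x \<in> Hom A G Z" "k \<cdot> \<iota> S x \<in> Hom A G Z"
        using h k S x by (auto simp: in_Hom_iff)
      ultimately show "h \<cdot> \<iota> S x = k \<cdot> \<iota> S x" using \<phi> by (meson inj_onD)
    qed (use h k in \<open>auto simp: in_Hom_iff\<close>)
    have T_surj: "\<exists>h\<in>Hom A (Q S) Z. T S h = t" if S: "small TYPE('u) S" and t: "t \<in> Hom set_cat S K" for S t
    proof -
      obtain t' where t': "t = (S, t', K)" "t' \<in> S \<rightarrow>\<^sub>E K" using t by (rule set_HomE)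
      have *: "inv_into (Hom A G Z) \<phi> (t' x) \<in> Hom A G Z" "\<phi> (inv_into (Hom A G Z) \<phi> (t' x)) = t' x"
        if "x \<in> S" for x
      proof -
        have "t' x \<in> \<phi> ` Hom A G Z" using t' that unfolding K_def by blast
        then show "inv_into (Hom A G Z) \<phi> (t' x) \<in> Hom A G Z" "\<phi> (inv_into (Hom A G Z) \<phi> (t' x)) = t' x"
          by (rule inv_into_into, rule f_inv_into_f)
      qed
      obtain h where h: "h \<in> Arr A" "Dom A h = Q S" "Cod A h = Z"
        "\<And>x. x \<in> S \<Longrightarrow> h \<cdot> \<iota> S x = inv_into (Hom A G Z) \<phi> (t' x)"
        by (rule copowerE[where g = "\<lambda>x. inv_into (Hom A G Z) \<phi> (t' x)", OF S Z *(1)], assumption, rule that)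
      have "(\<lambda>x\<in>S. \<phi> (h \<cdot> \<iota> S x)) = t'"
        by (rule PiE_eqI[OF _ t'(2), of _ UNIV]) (use h * in auto)
      then show ?thesis using h t' by (intro bexI[of _ h]) (auto simp: T_def in_Hom_iff)
    qed
    have T_nat: "T R h \<cdot>\<^bsub>set_cat\<^esub> (S, l, R) = T S (h \<cdot> H (S, l, R))"
      if l: "(S, l, R) \<in> Arr set_cat" and h: "h \<in> Hom A (Q R) Z" for S l R h
    proof -
      have "\<phi> (h \<cdot> \<iota> R (l x)) = \<phi> ((h \<cdot> H (S, l, R)) \<cdot> \<iota> S x)" "l x \<in> R" if "x \<in> S" for x
        using H_\<iota>[OF l that] H_arr(1-3)[OF l] h l that by (auto simp: in_Hom_iff)
      then show ?thesis by (auto simp: T_def compose_def fun_eq_iff)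
    qed
    have fg: "f \<in> Arr A" "Dom A f = Q V" "Cod A f = Z" "g \<in> Arr A" "Dom A g = Q W" "Cod A g = Z"
      using f g by (auto simp: in_Hom_iff)
    have "T V f \<cdot>\<^bsub>set_cat\<^esub> (X, dd, V) = T W g \<cdot>\<^bsub>set_cat\<^esub> (X, e, W)"
      using T_nat[OF arr(1) f] T_nat[OF arr(2) g] eq by simp
    then have ex1: "\<exists>!t. t \<in> Hom set_cat P K \<and> t \<cdot>\<^bsub>set_cat\<^esub> (V, p, P) = T V f \<and>
        t \<cdot>\<^bsub>set_cat\<^esub> (W, q, P) = T W g"
      using po' T_Hom[OF small(1) f] T_Hom[OF small(2) g] K
      unfolding is_pushout_def set_cat_simps(1,3,4) by blast
    have comp: "h \<cdot> ?p \<in> Hom A (Q V) Z" "h \<cdot> ?q \<in> Hom A (Q W) Z" if "h \<in> Hom A (Q P) Z" for h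
      using that by (auto simp: in_Hom_iff)
    have iff: "h \<cdot> ?p = f \<and> h \<cdot> ?q = g \<longleftrightarrow>
        T P h \<cdot>\<^bsub>set_cat\<^esub> (V, p, P) = T V f \<and> T P h \<cdot>\<^bsub>set_cat\<^esub> (W, q, P) = T W g"
      if h: "h \<in> Hom A (Q P) Z" for h
      using T_nat[OF arr(3) h] T_nat[OF arr(4) h] T_inj[OF small(1) comp(1)[OF h] f]
        T_inj[OF small(2) comp(2)[OF h] g] by metis
    obtain t where t: "t \<in> Hom set_cat P K" "t \<cdot>\<^bsub>set_cat\<^esub> (V, p, P) = T V f"
      "t \<cdot>\<^bsub>set_cat\<^esub> (W, q, P) = T W g" using ex1 by blast
    obtain h where h: "h \<in> Hom A (Q P) Z" "T P h = t" using T_surj[OF small(4) t(1)] by blast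
    show ?thesis
    proof (rule ex1I[of _ h])
      show "h \<in> Hom A (Q P) Z \<and> h \<cdot> ?p = f \<and> h \<cdot> ?q = g" using iff[OF h(1)] h t by simp
      fix k assume k: "k \<in> Hom A (Q P) Z \<and> k \<cdot> ?p = f \<and> k \<cdot> ?q = g"
      then have "T P k = t" using iff[of k] T_Hom[OF small(4), of k] ex1 t by blast
      then show "k = h" using T_inj[OF small(4), of k h] k h by simp
    qed
  qed
  then show ?thesis
    unfolding a b c d sq(1-4) is_pushout_def using comm by simp
qed

lemma copower_transfer:
  "transfer_functor TYPE('u) set_cat surjections injections A (epimorphisms A) (monomorphisms A)
     (copower_functor A Q \<iota>)"
  unfolding transfer_functor_def
  using factorized_set_cat[OF univ] exact_factorized_category[OF loc_small exact] copower_is_functor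
    copower_conservative H_injection H_surjection H_pullback H_pushout by blast

end

section \<open>Universal targets\<close>

lemma transfer_functor_compose:
  assumes T: "transfer_functor U C E M D E' M' T" and S: "transfer_functor U D E' M' B E'' M'' S"
  shows "transfer_functor U C E M B E'' M'' \<lparr> OMap = OMap S \<circ> OMap T, AMap = AMap S \<circ> AMap T \<rparr>"
proof -
  have fT: "is_functor C D T" and fS: "is_functor D B S"
    using T S unfolding transfer_functor_def by auto
  have arr: "AMap T f \<in> Arr D" "Dom D (AMap T f) = OMap T (Dom C f)" "Cod D (AMap T f) = OMap T (Cod C f)"
    if "f \<in> Arr C" for f
    using fT that unfolding is_functor_def by (auto simp: in_Hom_iff)
  have "is_functor C B \<lparr> OMap = OMap S \<circ> OMap T, AMap = AMap S \<circ> AMap T \<rparr>"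
    using fT fS arr unfolding is_functor_def by (simp add: in_Hom_iff)
  moreover have "conservative C B \<lparr> OMap = OMap S \<circ> OMap T, AMap = AMap S \<circ> AMap T \<rparr>"
    using T S arr unfolding transfer_functor_def conservative_def by simp
  moreover have "AMap T m \<in> M'" if "m \<in> M" for m using T that unfolding transfer_functor_def by blast
  moreover have "AMap T e \<in> E'" if "e \<in> E" for e using T that unfolding transfer_functor_def by blast
  ultimately show ?thesis
    using T S unfolding transfer_functor_def by (auto simp: image_subset_iff)
qed

section \<open>Subobjects, clusters and generators\<close>

context puppe_exact
begin

lemma sieve_Comp_le:
  assumes "h \<in> Arr C" "n \<in> Arr C" "Dom C n = Cod C h"
  shows "sieve C (n \<cdot> h) \<subseteq> sieve C n"
proof
  fix g assume "g \<in> sieve C (n \<cdot> h)"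
  then obtain l where "l \<in> Arr C" "Cod C l = Dom C h" "g = n \<cdot> (h \<cdot> l)"
    using assms by (auto simp: sieve_iff)
  then show "g \<in> sieve C n" using assms unfolding sieve_iff by (intro exI[of _ "h \<cdot> l"]) simp
qed

text \<open>Equal sieves mean mutual factorization, and for monomorphisms the two factoring arrows
  are inverse to each other.\<close>

lemma subobject_equiv_iff:
  "(m, n) \<in> subobject_equiv C X \<longleftrightarrow>
     m \<in> monomorphisms C \<and> n \<in> monomorphisms C \<and> Cod C m = X \<and> Cod C n = X \<and> sieve C m = sieve C n"
proof -
  have "(\<exists>h\<in>isomorphisms C. Dom C h = Dom C m \<and> Cod C h = Dom C n \<and> n \<cdot> h = m) \<longleftrightarrow> sieve C m = sieve C n"
    if m: "m \<in> monomorphisms C" and n: "n \<in> monomorphisms C" and mn: "Cod C m = Cod C n"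
  proof
    note [simp] = mono_arr[OF m] mono_arr[OF n]
    assume "\<exists>h\<in>isomorphisms C. Dom C h = Dom C m \<and> Cod C h = Dom C n \<and> n \<cdot> h = m"
    then obtain h where h: "h \<in> isomorphisms C" "Dom C h = Dom C m" "Cod C h = Dom C n" "n \<cdot> h = m" by blast
    obtain k where k [simp]: "k \<in> Arr C" "Dom C k = Dom C n" "Cod C k = Dom C m"
      and hk: "h \<cdot> k = Id C (Dom C n)"
      using isoE[OF h(1)] h by metis
    note [simp] = iso_arr[OF h(1)] h(2,3)
    have mk: "m \<cdot> k = n" by (subst assoc_eq1[OF h(4), of k, symmetric]) (simp_all add: hk)
    show "sieve C m = sieve C n"
      using sieve_Comp_le[of h n] sieve_Comp_le[of k m] by (auto simp: h(4) mk)
  next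
    note [simp] = mono_arr[OF m] mono_arr[OF n]
    assume eq: "sieve C m = sieve C n"
    obtain u where u [simp]: "u \<in> Arr C" "Dom C u = Dom C m" "Cod C u = Dom C n" and nu: "n \<cdot> u = m"
      using sieve_le[of m n] eq by auto
    obtain v where v [simp]: "v \<in> Arr C" "Dom C v = Dom C n" "Cod C v = Dom C m" and mv: "m \<cdot> v = n"
      using sieve_le[of n m] eq by auto
    have "v \<cdot> u = Id C (Dom C m)"
      by (rule monoD[OF m]) (use assoc_eq1[OF mv, of u] nu in simp_all)
    moreover have "u \<cdot> v = Id C (Dom C n)"
      by (rule monoD[OF n]) (use assoc_eq1[OF nu, of v] mv in simp_all)
    ultimately have "u \<in> isomorphisms C" by (intro isoI[of u v]) simp_all
    then show "\<exists>h\<in>isomorphisms C. Dom C h = Dom C m \<and> Cod C h = Dom C n \<and> n \<cdot> h = m"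
      using nu by (intro bexI[of _ u]) simp_all
  qed
  then show ?thesis unfolding subobject_equiv_def by auto
qed

text \<open>All representatives of a subobject have the same sieve, so the union over the class
  picks it out without a choice.\<close>

lemma subobjects_bij_clusters:
  "bij_betw (\<lambda>c. \<Union> (sieve C ` c)) (subobjects C X) (clusters C X)"
proof -
  let ?M = "{m \<in> monomorphisms C. Cod C m = X}"
  have cls: "\<Union> (sieve C ` (subobject_equiv C X `` {m})) = sieve C m" if "m \<in> ?M" for m
    using that by (auto simp: subobject_equiv_iff)
  have cls_eq: "subobject_equiv C X `` {m} = {n \<in> ?M. sieve C n = sieve C m}" if "m \<in> ?M" for m
    using that by (auto simp: subobject_equiv_iff)
  show ?thesis
    unfolding bij_betw_def
  proof (intro conjI)
    show "inj_on (\<lambda>c. \<Union> (sieve C ` c)) (subobjects C X)"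
    proof (rule inj_onI)
      fix c c' assume "c \<in> subobjects C X" "c' \<in> subobjects C X"
        and eq: "\<Union> (sieve C ` c) = \<Union> (sieve C ` c')"
      then obtain m m' where m: "m \<in> ?M" "c = subobject_equiv C X `` {m}"
        and m': "m' \<in> ?M" "c' = subobject_equiv C X `` {m'}"
        unfolding subobjects_def by (auto elim!: quotientE)
      then have "sieve C m = sieve C m'" using eq cls by simp
      then show "c = c'" using cls_eq m m' by simp
    qed
    show "(\<lambda>c. \<Union> (sieve C ` c)) ` subobjects C X = clusters C X"
    proof (intro Set.equalityI subsetI)
      fix S assume "S \<in> (\<lambda>c. \<Union> (sieve C ` c)) ` subobjects C X"
      then obtain m where "m \<in> ?M" "S = sieve C m"
        unfolding subobjects_def using cls by (auto elim!: quotientE)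
      then show "S \<in> clusters C X" using sieve_in_clusters by simp
    next
      fix S assume "S \<in> clusters C X"
      then obtain m where "m \<in> ?M" "S = sieve C m" using clusters_monoE[of S X] by blast
      then show "S \<in> (\<lambda>c. \<Union> (sieve C ` c)) ` subobjects C X"
        unfolding subobjects_def using cls[of m] quotientI[of m ?M "subobject_equiv C X"] by blast
    qed
  qed
qed

lemma small_clusters_iff: "small U (clusters C X) \<longleftrightarrow> small U (subobjects C X)"
  using subobjects_bij_clusters[of X] small_image small_inj_on_image unfolding bij_betw_def by metis

text \<open>Let \<open>c\<close> be an arrow with annihilator \<open>T'\<close>. If
  \<open>c \<cdot> g\<close> were nonzero for some \<open>g\<close> in \<open>T\<close>, the
  generator would supply \<open>h\<close> with \<open>(c \<cdot> g) \<cdot> h\<close> nonzero. But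
  \<open>g \<cdot> h\<close> is an arrow from the generator in \<open>T\<close>, hence in
  \<open>T'\<close>.\<close>

lemma clusters_le_if_generator:
  assumes gen: "is_generator C S" and TT: "T \<in> clusters C X" "T' \<in> clusters C X"
    and le: "T \<inter> Hom C S X \<subseteq> T'"
  shows "T \<subseteq> T'"
proof
  fix g assume g: "g \<in> T"
  then have [simp]: "g \<in> Arr C" "Cod C g = X" using clusters_into TT by auto
  obtain c where c [simp]: "c \<in> Arr C" "Dom C c = X" and T': "T' = annihilator C c"
    using TT by (auto simp: clusters_def)
  obtain d where d [simp]: "d \<in> Arr C" "Dom C d = X" and T: "T = annihilator C d"
    using TT by (auto simp: clusters_def)
  obtain Z where Z: "zero_object C Z" using zero_object_ex by blast
  obtain z where z: "zero_arrow C z" "z \<in> Arr C" "Dom C z = Dom C g" "Cod C z = Cod C c"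
    using zero_arrow_ex[OF Z, of "Dom C g" "Cod C c"] by auto
  have "c \<cdot> g = z"
  proof (rule ccontr)
    assume "c \<cdot> g \<noteq> z"
    moreover have "c \<cdot> g \<in> Hom C (Dom C g) (Cod C c)" "z \<in> Hom C (Dom C g) (Cod C c)"
      using z by (auto simp: in_Hom_iff)
    ultimately obtain h where h: "h \<in> Hom C S (Dom C g)" "(c \<cdot> g) \<cdot> h \<noteq> z \<cdot> h"
      using gen Dom_in_Obj[of g] Cod_in_Obj[of c] unfolding is_generator_def by (metis \<open>g \<in> Arr C\<close> c(1))
    have [simp]: "h \<in> Arr C" "Dom C h = S" "Cod C h = Dom C g" using h by (auto simp: in_Hom_iff)
    have "zero_arrow C ((d \<cdot> g) \<cdot> h)" by (rule zero_Comp) (use g in \<open>auto simp: T annihilator_iff\<close>)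
    then have "g \<cdot> h \<in> T \<inter> Hom C S X" by (simp add: T annihilator_iff in_Hom_iff)
    then have "g \<cdot> h \<in> T'" using le by blast
    then have "zero_arrow C ((c \<cdot> g) \<cdot> h)" by (simp add: T' annihilator_iff)
    moreover have "zero_arrow C (z \<cdot> h)" by (rule zero_Comp[OF z(1)]) (use z in simp_all)
    ultimately have "(c \<cdot> g) \<cdot> h = z \<cdot> h" by (rule zero_eq) (use z in simp_all)
    then show False using h by blast
  qed
  then show "g \<in> T'" using z by (simp add: T' annihilator_iff)
qed

text \<open>Intersecting with \<open>Hom C S X\<close> is injective on clusters, so these are at
  most as many as the subsets of a small hom-set.\<close>

lemma well_powered_if_generator:
  assumes "grothendieck_universe TYPE('u)" "locally_small TYPE('u) C" "is_generator C S"
  shows "well_powered TYPE('u) C"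
  unfolding well_powered_def
proof
  fix X assume X: "X \<in> Obj C"
  have "small TYPE('u) (Hom C S X)"
    using assms X unfolding locally_small_def is_generator_def by blast
  then have "small TYPE('u) (Pow (Hom C S X))" by (rule small_Pow[OF assms(1)])
  moreover have "inj_on (\<lambda>T. T \<inter> Hom C S X) (clusters C X)"
    by (rule inj_onI) (metis clusters_le_if_generator[OF assms(3)] Int_lower1 subset_antisym)
  ultimately have "small TYPE('u) (clusters C X)" by (rule small_inj_on) auto
  then show "small TYPE('u) (subobjects C X)" by (simp add: small_clusters_iff)
qed

end

section \<open>Universal targets from copowers\<close>

lemma copower_choice_ex:
  assumes "has_small_coproducts TYPE('u) A" "G \<in> Obj A"
  obtains Q and \<iota> :: "'u set \<Rightarrow> 'u \<Rightarrow> 'm" where "is_copower_choice A G Q \<iota>"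
proof -
  have "\<exists>Q \<iota>. is_coproduct A X (\<lambda>_. G) Q \<iota>" if "small TYPE('u) X" for X :: "'u set"
    using assms(1)[unfolded has_small_coproducts_def, rule_format, of X "\<lambda>_. G"] assms(2) that by blast
  then obtain Q \<iota> where "\<And>X :: 'u set. small TYPE('u) X \<Longrightarrow> is_coproduct A X (\<lambda>_. G) (Q X) (\<iota> X)"
    by metis
  then show ?thesis using that unfolding is_copower_choice_def by blast
qed

lemma copower_if_well_powered:
  assumes "grothendieck_universe TYPE('u)" "well_powered_abelian_with_coproducts TYPE('u) A"
    "G \<in> Obj A" "\<not> zero_object A G" "is_copower_choice A G Q (\<iota> :: 'u set \<Rightarrow> 'u \<Rightarrow> 'm)"
  shows "copower A G Q \<iota>"
  using assms abelian_puppe_exact[of A] unfolding well_powered_abelian_with_coproducts_def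
  by (intro copower.intro) auto

lemma universal_target_if_well_powered:
  assumes univ: "grothendieck_universe TYPE('u)"
    and A: "well_powered_abelian_with_coproducts TYPE('u) A" and nonzero: "nonzero_category A"
  shows "universal_target TYPE('u) TYPE('c \<times> 'd) A (epimorphisms A) (monomorphisms A)"
proof -
  have exact: "puppe_exact A" and loc: "locally_small TYPE('u) A" and wp: "well_powered TYPE('u) A"
    using A abelian_puppe_exact unfolding well_powered_abelian_with_coproducts_def by auto
  obtain G where G: "G \<in> Obj A" "\<not> zero_object A G" using nonzero unfolding nonzero_category_def by blast
  obtain Q and \<iota> :: "'u set \<Rightarrow> 'u \<Rightarrow> 'b" where "is_copower_choice A G Q \<iota>"
    using copower_choice_ex[OF _ G(1)] A unfolding well_powered_abelian_with_coproducts_def by blast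
  then have cp: "copower A G Q \<iota>" by (rule copower_if_well_powered[OF univ A G])
  show ?thesis
    unfolding universal_target_def
  proof (intro conjI allI impI)
    show "factorized_category TYPE('u) A (epimorphisms A) (monomorphisms A)"
      by (rule exact_factorized_category[OF loc exact])
    fix C :: "('c, 'd) cat" and E M assume fact: "factorized_category TYPE('u) C E M"
    show "has_noetherian_form_inducing TYPE('u) C E M \<longleftrightarrow>
        (\<exists>T. transfer_functor TYPE('u) C E M A (epimorphisms A) (monomorphisms A) T)"
    proof
      assume "has_noetherian_form_inducing TYPE('u) C E M"
      then obtain F :: "('c, 'd, 'u) form" where "noetherian_inducing C E M F"
        unfolding has_noetherian_form_inducing_def noetherian_inducing_def noetherian_inducing_axioms_def
          factorized_def using univ fact by blast
      then show "\<exists>T. transfer_functor TYPE('u) C E M A (epimorphisms A) (monomorphisms A) T"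
        using transfer_functor_compose[OF noetherian_inducing.fibre_transfer copower.copower_transfer[OF cp]]
        by blast
    next
      assume "\<exists>T. transfer_functor TYPE('u) C E M A (epimorphisms A) (monomorphisms A) T"
      then obtain T where T: "transfer_functor TYPE('u) C E M A (epimorphisms A) (monomorphisms A) T" ..
      have "small TYPE('u) (clusters A X)" if "X \<in> Obj A" for X
        using wp that puppe_exact.small_clusters_iff[OF exact] unfolding well_powered_def by blast
      then have "transfer_to_exact TYPE('u) C E M A T"
        using T exact by (intro transfer_to_exact.intro)
      then show "has_noetherian_form_inducing TYPE('u) C E M"
        by (rule transfer_to_exact.has_noetherian_form)
    qed
  qed
qed

theorem proposition3p37:
  assumes "grothendieck_universe TYPE('u)"
  shows
    "(\<forall>(A :: ('a, 'b) cat) G (Q :: 'u set \<Rightarrow> 'a) \<iota>.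
        well_powered_abelian_with_coproducts TYPE('u) A \<and>
        G \<in> Obj A \<and> \<not> zero_object A G \<and> is_copower_choice A G Q \<iota> \<longrightarrow>
        transfer_functor TYPE('u) set_cat surjections injections A (epimorphisms A) (monomorphisms A)
          (copower_functor A Q \<iota>)) \<and>
     (\<forall>A :: ('a, 'b) cat.
        well_powered_abelian_with_coproducts TYPE('u) A \<and> nonzero_category A \<longrightarrow>
        universal_target TYPE('u) TYPE('c \<times> 'd) A (epimorphisms A) (monomorphisms A)) \<and>
     (\<forall>A :: ('a, 'b) cat.
        grothendieck_abelian TYPE('u) A \<and> nonzero_category A \<longrightarrow>
        universal_target TYPE('u) TYPE('c \<times> 'd) A (epimorphisms A) (monomorphisms A))"
proof (intro conjI allI impI)
  fix A :: "('a, 'b) cat" and G and Q :: "'u set \<Rightarrow> 'a" and \<iota>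
  assume "well_powered_abelian_with_coproducts TYPE('u) A \<and>
    G \<in> Obj A \<and> \<not> zero_object A G \<and> is_copower_choice A G Q \<iota>"
  then have "copower A G Q \<iota>" by (intro copower_if_well_powered[OF assms]) blast+
  then show "transfer_functor TYPE('u) set_cat surjections injections A (epimorphisms A) (monomorphisms A)
      (copower_functor A Q \<iota>)"
    by (rule copower.copower_transfer)
next
  fix A :: "('a, 'b) cat"
  assume "well_powered_abelian_with_coproducts TYPE('u) A \<and> nonzero_category A"
  then show "universal_target TYPE('u) TYPE('c \<times> 'd) A (epimorphisms A) (monomorphisms A)"
    using universal_target_if_well_powered[OF assms] by blast
next
  fix A :: "('a, 'b) cat"
  assume A: "grothendieck_abelian TYPE('u) A \<and> nonzero_category A"
  then obtain S where A': "locally_small TYPE('u) A" "abelian A" "has_small_coproducts TYPE('u) A"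
    and S: "is_generator A S"
    unfolding grothendieck_abelian_def by (elim conjE exE)
  have "well_powered TYPE('u) A"
    by (rule puppe_exact.well_powered_if_generator[OF abelian_puppe_exact[OF A'(2)] assms A'(1) S])
  then have "well_powered_abelian_with_coproducts TYPE('u) A"
    unfolding well_powered_abelian_with_coproducts_def using A' by (intro conjI)
  then show "universal_target TYPE('u) TYPE('c \<times> 'd) A (epimorphisms A) (monomorphisms A)"
    by (rule universal_target_if_well_powered[OF assms _ conjunct2[OF A]])
qed

end
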